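(* Let $P_n$ be the path on $n$ vertices. If $n$ is even, then $2\lfloor n/16\rfloor+1\le b^A_g(P_n)\le 4\lceil n/16\rceil+5$. If $n$ is odd, then $2\lfloor n/16\rfloor-4\le b^A_g(P_n)\le 4\lceil n/16\rceil$.
   Context: The balance game on a finite simple graph $G$ is played by two players, Admirable (A) and Impish (I), who alternately select a not-yet-labeled vertex of $G$ until all vertices are labeled; Admirable labels each vertex she selects by $0$ and Impish labels each vertex he selects by $1$. Each edge receives the sum modulo $2$ of the labels of its endpoints. Let $e_0$ and $e_1$ be the numbers of edges labeled $0$ and $1$ at the end; the discrepancy is $d=e_1-e_0$. Admirable tries to minimize $d$ and Impish tries to maximize $d$. $b^A_g(G)$ is the value of $d$ under optimal play of both players when Admirable moves first. *)

theory Defs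
  imports Complex_Main
begin

type_synonym 'a graph = "'a set \<times> 'a set set"

abbreviation verts :: "'a graph \<Rightarrow> 'a set" where
  "verts G \<equiv> fst G"

abbreviation edges :: "'a graph \<Rightarrow> 'a set set" where
  "edges G \<equiv> snd G"

definition finite_simple_graph :: "'a graph \<Rightarrow> bool" where
  "finite_simple_graph G \<longleftrightarrow>
     finite (verts G) \<and> (\<forall>e\<in>edges G. e \<subseteq> verts G \<and> card e = 2)"

definition path_graph :: "nat \<Rightarrow> nat graph" where
  "path_graph n = ({1..n}, {{i, i + 1} |i. 1 \<le> i \<and> i < n})"

lemma finite_simple_graph_path_graph: "finite_simple_graph (path_graph n)"
  by (auto simp: finite_simple_graph_def path_graph_def)

datatype player = Admirable | Impish

text \<open>
  A position of the balance game is a partial labeling of the vertices; the vertices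
  outside its domain are the ones not yet labeled.
\<close>

type_synonym 'a labeling = "'a \<rightharpoonup> nat"

definition edge_label :: "'a labeling \<Rightarrow> 'a set \<Rightarrow> nat" where
  "edge_label f e = (\<Sum>v\<in>e. the (f v)) mod 2"

definition discrepancy :: "'a graph \<Rightarrow> 'a labeling \<Rightarrow> int" where
  "discrepancy G f =
     int (card {e \<in> edges G. edge_label f e = 1}) -
     int (card {e \<in> edges G. edge_label f e = 0})"

text \<open>
  The value of a position under optimal play, with the given player to move, by backward
  induction. The test for infinite vertex sets only serves to make the recursion terminate;
  it is irrelevant for finite graphs.
\<close>

function game_value :: "'a graph \<Rightarrow> player \<Rightarrow> 'a labeling \<Rightarrow> int" where
  "game_value G Admirable f =
     (if infinite (verts G) \<or> verts G \<subseteq> dom f then discrepancy G f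
      else Min ((\<lambda>v. game_value G Impish (f(v \<mapsto> 0))) ` (verts G - dom f)))"
| "game_value G Impish f =
     (if infinite (verts G) \<or> verts G \<subseteq> dom f then discrepancy G f
      else Max ((\<lambda>v. game_value G Admirable (f(v \<mapsto> 1))) ` (verts G - dom f)))"
  by pat_completeness auto

lemma unlabeled_decreases:
  assumes "finite V" "v \<in> V - dom f"
  shows "card (V - dom (f(v \<mapsto> x))) < card (V - dom f)"
  using assms by (intro psubset_card_mono) auto

termination
  by (relation "measure (\<lambda>(G, p, f). card (verts G - dom f))")
    (simp_all only: in_measure prod.case de_Morgan_disj not_not unlabeled_decreases wf_measure)

declare game_value.simps [simp del]

definition balance_game_A :: "'a graph \<Rightarrow> int" where
  "balance_game_A G = game_value G Admirable Map.empty"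

end

theory Submission
  imports Defs "HOL-Library.Multiset"
begin

text \<open>
  The labeled vertices cut the path into segments, and the discrepancy is a sum over the segments.
  A player who moves second can answer every move in the component in which it was made, so the
  values he or she can guarantee add up, as long as every component has an even number of free
  vertices. Deleting an edge of the path changes the discrepancy by at most 1. Hence the path may be
  cut into blocks of 16 vertices: moving second on such a block, Impish guarantees a discrepancy of
  at least 3 and Admirable one of at most 3, which gives at least \<open>3 - 1\<close> and at most \<open>3 + 1\<close>
  per block. For odd \<open>n\<close> Admirable opens in the incomplete block and then moves second.
  In the two remaining cases, even \<open>n\<close> for Admirable and odd \<open>n\<close> for Impish, the player is to move
  with an even number of free vertices left and may pretend to move second: the initiative never
  hurts. The strategies on the blocks are explicit.
\<close>

section \<open>Values of positions and additional moves\<close>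

text \<open>Guarantees of the second mover replace optimal values because guarantees add over unions
  of positions. A guarantee needs an answer to every move, so it exists only for an even number of
  free vertices; runs of odd length therefore have to stay together in groups, and this shapes the
  strategies on the blocks. A path on an even number of vertices has an odd number of edges, so its
  discrepancy is odd. Attaching a block costs 1, hence blocks with guarantee 1 gain Impish nothing,
  and the next possible value is 3; a block of 16 vertices reaches it and nets 2. Evaluating the
  whole game tree on 16 vertices is avoided: what happens inside a run depends on the rest only
  through the owners of its two ends, so the tree collapses into bounds for small groups of runs,
  each proved once and reused.\<close>

fun other :: "player \<Rightarrow> player" where
  "other Admirable = Impish"
| "other Impish = Admirable"

text \<open>Multiplication by \<open>gain p\<close> makes player \<open>p\<close> the maximizer, so
  that statements about a player cover both roles. For Admirable a bound \<open>b\<close> then means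
  a discrepancy of at most \<open>-b\<close>.\<close>

fun gain :: "player \<Rightarrow> int" where
  "gain Admirable = -1"
| "gain Impish = 1"

fun label :: "player \<Rightarrow> nat" where
  "label Admirable = 0"
| "label Impish = 1"

lemma other_other [simp]: "other (other p) = p"
  by (cases p) auto

lemma game_value_terminal:
  "verts G \<subseteq> dom f \<Longrightarrow> game_value G p f = discrepancy G f"
  by (cases p) (simp_all only: game_value.simps(1)[of G f] game_value.simps(2)[of G f] simp_thms if_True)

lemma game_value_attained:
  assumes "finite (verts G)" "\<not> verts G \<subseteq> dom f"
  shows "\<exists>v \<in> verts G - dom f. game_value G p f = game_value G (other p) (f(v \<mapsto> label p))"
proof (cases p)
  case Admirable
  have "game_value G p f \<in> (\<lambda>v. game_value G Impish (f(v \<mapsto> 0))) ` (verts G - dom f)"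
    unfolding Admirable game_value.simps(1)[of G f] using assms by (auto simp: not_le intro!: Min_in)
  then show ?thesis using Admirable by auto
next
  case Impish
  have "game_value G p f \<in> (\<lambda>v. game_value G Admirable (f(v \<mapsto> 1))) ` (verts G - dom f)"
    unfolding Impish game_value.simps(2)[of G f] using assms by (auto simp: not_le intro!: Max_in)
  then show ?thesis using Impish by auto
qed

lemma game_value_optimal:
  assumes "finite (verts G)" "v \<in> verts G - dom f"
  shows "gain p * game_value G (other p) (f(v \<mapsto> label p)) \<le> gain p * game_value G p f"
proof (cases p)
  case Admirable
  have "game_value G Admirable f = Min ((\<lambda>v. game_value G Impish (f(v \<mapsto> 0))) ` (verts G - dom f))"
    using assms by (subst game_value.simps(1)) auto
  also have "\<dots> \<le> game_value G Impish (f(v \<mapsto> 0))"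
    by (rule Min_le) (use assms in blast)+
  finally show ?thesis by (simp add: Admirable)
next
  case Impish
  have "game_value G Admirable (f(v \<mapsto> 1)) \<le> Max ((\<lambda>v. game_value G Admirable (f(v \<mapsto> 1))) ` (verts G - dom f))"
    by (rule Max_ge) (use assms in blast)+
  also have "\<dots> = game_value G Impish f"
    using assms by (subst game_value.simps(2)[of G f]) auto
  finally show ?thesis by (simp add: Impish)
qed

lemma card_unlabeled_Suc:
  assumes "finite V" "v \<in> V - dom f"
  shows "card (V - dom f) = Suc (card (V - dom (f(v \<mapsto> x))))"
proof -
  have "V - dom (f(v \<mapsto> x)) = (V - dom f) - {v}" by auto
  then show ?thesis using assms by (simp only: card.remove finite_Diff)
qed

text \<open>
  The prefilled vertex is treated as still free in a shadow game.
  If the shadow strategy asks for it, any other vertex is prefilled instead; by parity the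
  prefilled vertex that is left at the end goes to \<open>p\<close> anyway.
\<close>

lemma extra_move:
  assumes "finite (verts G)" "even (card (verts G - dom f))" "v \<in> verts G - dom f"
  shows "gain p * game_value G (other p) f \<le> gain p * game_value G (other p) (f(v \<mapsto> label p))"
  using assms(2,3)
proof (induction "card (verts G - dom f)" arbitrary: f v rule: less_induct)
  case less
  let ?V = "verts G" and ?g = "f(v \<mapsto> label p)"
  note fin = assms(1)
  \<comment> \<open>Parity ensures that the opponent still has a move once \<open>v\<close> is
    prefilled: an odd number of free vertices is not 0.\<close>
  have odd: "odd (card (?V - dom ?g))"
    using less.prems card_unlabeled_Suc[OF fin, of v f "label p"] by simp
  then have "\<not> ?V \<subseteq> dom ?g" by (auto simp: Diff_eq_empty_iff[THEN iffD2])
  then obtain w where w: "w \<in> ?V - dom ?g"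
    and gw: "game_value G (other p) ?g = game_value G p (?g(w \<mapsto> label (other p)))"
    using game_value_attained[OF fin, of ?g "other p"] by auto
  let ?fw = "f(w \<mapsto> label (other p))"
  have vw: "v \<noteq> w" "w \<in> ?V - dom f" using w by auto
  \<comment> \<open>\<open>w\<close> is optimal for the opponent when \<open>v\<close> is prefilled;
    copied into the shadow game it is merely a legal move, so only an inequality is
    available.\<close>
  have "gain p * game_value G (other p) f \<le> gain p * game_value G p ?fw"
    using game_value_optimal[OF fin vw(2), of "other p"] by (cases p) auto
  moreover have "\<not> ?V \<subseteq> dom ?fw" using less.prems vw by auto
  then obtain x where x: "x \<in> ?V - dom ?fw"
    and gx: "game_value G p ?fw = game_value G (other p) (?fw(x \<mapsto> label p))"
    using game_value_attained[OF fin, of ?fw p] by auto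
  define h where "h = ?fw(x \<mapsto> label p)"
  have ch: "card (?V - dom f) = Suc (Suc (card (?V - dom h)))"
    unfolding h_def using card_unlabeled_Suc[OF fin vw(2)] card_unlabeled_Suc[OF fin x] by metis
  then have evh: "even (card (?V - dom h))" and lt: "card (?V - dom h) < card (?V - dom f)"
    using less.prems(1) by auto
  have "gain p * game_value G (other p) h \<le> gain p * game_value G p (?g(w \<mapsto> label (other p)))"
  proof (cases "x = v")
    case True
    then have heq: "h = ?g(w \<mapsto> label (other p))" using vw by (simp add: h_def fun_eq_iff)
    show ?thesis
    proof (cases "?V \<subseteq> dom h")
      case True
      then show ?thesis by (simp flip: heq add: game_value_terminal)
    next
      case False
      then obtain z where z: "z \<in> ?V - dom h" by blast
      show ?thesis
        unfolding heq[symmetric]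
        using less.hyps[OF lt evh z] game_value_optimal[OF fin z, of p] by linarith
    qed
  next
    case False
    then have v: "v \<in> ?V - dom h" using less.prems vw by (auto simp: h_def)
    have heq: "h(v \<mapsto> label p) = (?g(w \<mapsto> label (other p)))(x \<mapsto> label p)"
      using False vw x by (simp add: h_def fun_eq_iff)
    have "x \<in> ?V - dom (?g(w \<mapsto> label (other p)))" using x False by auto
    then show ?thesis
      using less.hyps[OF lt evh v] game_value_optimal[OF fin, of x "?g(w \<mapsto> label (other p))" p]
      unfolding heq by linarith
  qed
  ultimately show ?case unfolding gw using gx by (simp add: h_def)
qed

text \<open>Any free vertex serves as first move: after it the opponent is to move with one vertex
  prefilled for \<open>p\<close>, which by \<open>extra_move\<close> is no worse for
  \<open>p\<close> than the opponent moving at once.\<close>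

corollary first_move_advantage:
  assumes "finite (verts G)" "even (card (verts G - dom f))"
  shows "gain p * game_value G (other p) f \<le> gain p * game_value G p f"
proof (cases "verts G \<subseteq> dom f")
  case True
  then show ?thesis by (simp add: game_value_terminal)
next
  case False
  then obtain v where "v \<in> verts G - dom f" by blast
  then show ?thesis
    using extra_move[OF assms] game_value_optimal[OF assms(1)] order_trans by blast
qed

section \<open>Segments\<close>

text \<open>
  The labeled vertices cut the path into segments. A segment \<open>(l, m, r)\<close> is a run of \<open>m\<close> free
  vertices together with the owners \<open>l\<close> and \<open>r\<close> of the labeled vertices next to it, where \<open>None\<close>
  stands for an end of the path. Runs of length 0 are kept, because they are exactly the edges with
  two labeled vertices; hence the value of a finished game is the sum of \<open>edge l r\<close> over its segments.
\<close>

type_synonym mark = "player option"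
type_synonym seg = "mark \<times> nat \<times> mark"

fun edge :: "mark \<Rightarrow> mark \<Rightarrow> int" where
  "edge (Some p) (Some q) = (if p = q then -1 else 1)"
| "edge _ _ = 0"

lemma edge_commute: "edge l r = edge r l"
  by (cases "(l, r)" rule: edge.cases) auto

fun rank :: "mark \<Rightarrow> nat" where
  "rank (Some Admirable) = 0"
| "rank (Some Impish) = 1"
| "rank None = 2"

lemma rank_inject: "rank l = rank r \<longleftrightarrow> l = r"
  by (cases l rule: rank.cases; cases r rule: rank.cases) auto

text \<open>A segment and its mirror image become the same element, so multisets of segments
  identify reflected positions. The order given by \<open>rank\<close> serves to pick one of the two
  orientations.\<close>

definition seg :: "mark \<Rightarrow> nat \<Rightarrow> mark \<Rightarrow> seg" where
  "seg l m r = (if rank r < rank l then (r, m, l) else (l, m, r))"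

lemma seg_commute: "seg l m r = seg r m l"
  using rank_inject[of l r] by (simp add: seg_def)

lemma seg_eq_iff:
  "seg l m r = seg l' m' r' \<longleftrightarrow> m = m' \<and> (l = l' \<and> r = r' \<or> l = r' \<and> r = l')"
  by (cases l rule: rank.cases; cases r rule: rank.cases;
      cases l' rule: rank.cases; cases r' rule: rank.cases) (auto simp: seg_def)

definition free :: "seg multiset \<Rightarrow> nat" where
  "free M = (\<Sum>(l, m, r)\<in>#M. m)"

text \<open>The sum has a meaning only for \<open>free M = 0\<close>; otherwise a run with free
  vertices would be charged like an edge. Only finished positions are scored.\<close>

definition score :: "seg multiset \<Rightarrow> int" where
  "score M = (\<Sum>(l, m, r)\<in>#M. edge l r)"

lemma free_simps [simp]:
  "free {#} = 0" "free (add_mset (seg l m r) M) = m + free M" "free (M + N) = free M + free N"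
  by (auto simp: free_def seg_def)

lemma score_simps [simp]:
  "score {#} = 0" "score (add_mset (seg l m r) M) = edge l r + score M"
  "score (M + N) = score M + score N"
  by (auto simp: score_def seg_def edge_commute)

definition move :: "player \<Rightarrow> seg multiset \<Rightarrow> seg multiset \<Rightarrow> bool" where
  "move p M N \<longleftrightarrow> (\<exists>K l i j r. M = add_mset (seg l (Suc (i + j)) r) K \<and>
     N = add_mset (seg l i (Some p)) (add_mset (seg (Some p) j r) K))"

lemma free_move: "move p M N \<Longrightarrow> free M = Suc (free N)"
  by (auto simp: move_def)

lemma move_mono: "move p M N \<Longrightarrow> move p (M + K) (N + K)"
  unfolding move_def by fastforce

lemma move_unionE:
  assumes "move p (M + N) X"
  obtains M' where "move p M M'" "X = M' + N" | N' where "move p N N'" "X = M + N'"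
proof -
  obtain K l i j r where eq: "M + N = add_mset (seg l (Suc (i + j)) r) K"
    and X: "X = add_mset (seg l i (Some p)) (add_mset (seg (Some p) j r) K)"
    using assms by (auto simp: move_def)
  let ?T = "seg l (Suc (i + j)) r"
  have "?T \<in># M + N" unfolding eq by simp
  then consider "?T \<in># M" | "?T \<in># N" by auto
  then show thesis
  proof cases
    case 1
    then obtain M1 where M: "M = add_mset ?T M1" by (meson mset_add)
    then have "K = M1 + N" using eq by simp
    then show thesis using that(1) M X unfolding move_def by fastforce
  next
    case 2
    then obtain N1 where N: "N = add_mset ?T N1" by (meson mset_add)
    then have "K = M + N1" using eq by simp
    then show thesis using that(2) N X unfolding move_def by fastforce
  qed
qed

lemma move_singleE:
  assumes "move p {#seg l m r#} X"
  obtains i j where "m = Suc (i + j)" "X = {#seg l i (Some p), seg (Some p) j r#}"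
proof -
  obtain K l' i j r' where K: "{#seg l m r#} = add_mset (seg l' (Suc (i + j)) r') K"
    and X: "X = add_mset (seg l' i (Some p)) (add_mset (seg (Some p) j r') K)"
    using assms unfolding move_def by blast
  then have eq: "seg l m r = seg l' (Suc (i + j)) r'" and K: "K = {#}"
    by (simp_all add: single_is_union)
  note X = X[unfolded K]
  \<comment> \<open>\<open>seg\<close> forgets the orientation, so the segment in
    \<open>move\<close> may be the mirror image of the given one; the two pieces then trade
    places.\<close>
  from eq consider "m = Suc (i + j)" "l = l'" "r = r'" | "m = Suc (j + i)" "l = r'" "r = l'"
    by (auto simp: seg_eq_iff)
  then show thesis
  proof cases
    case 1
    then show thesis using X that by auto
  next
    case 2
    moreover have "X = {#seg r' j (Some p), seg (Some p) i l'#}"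
      unfolding X seg_commute[of l'] seg_commute[of _ j r'] by (simp add: add_mset_commute)
    ultimately show thesis using that[of j i] by simp
  qed
qed

text \<open>\<open>p\<close> moves second and can bring \<open>gain p\<close> times the discrepancy to at least \<open>b\<close>.\<close>

inductive secure :: "player \<Rightarrow> seg multiset \<Rightarrow> int \<Rightarrow> bool" for p where
  final: "free M = 0 \<Longrightarrow> b \<le> gain p * score M \<Longrightarrow> secure p M b"
| round: "free M \<noteq> 0 \<Longrightarrow>
    (\<And>N. move (other p) M N \<Longrightarrow> \<exists>M'. move p N M' \<and> secure p M' b) \<Longrightarrow> secure p M b"

lemma secure_finalD: "secure p M b \<Longrightarrow> free M = 0 \<Longrightarrow> b \<le> gain p * score M"
  by (erule secure.cases) auto

lemma secure_roundD:
  assumes "secure p M b" "move (other p) M N"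
  obtains M' where "move p N M'" "secure p M' b"
  using assms(1)
proof cases
  case final
  then show thesis using free_move[OF assms(2)] by simp
next
  case round
  then show thesis using assms(2) that by blast
qed

lemma secure_mono: "secure p M b \<Longrightarrow> c \<le> b \<Longrightarrow> secure p M c"
proof (induction rule: secure.induct)
  case (final M b)
  show ?case by (rule secure.final) (use final in auto)
next
  case (round M b)
  show ?case by (rule secure.round) (use round in blast)+
qed

text \<open>Parity is hidden in \<open>secure\<close>: for positions built from \<open>seg\<close>,
  \<open>round\<close> asks for a reply to every move, which forces an even number of free vertices.
  So the part in which the opponent moves always offers a reply, and the final scores of the two
  parts add.\<close>

lemma secure_union: "secure p M b \<Longrightarrow> secure p N c \<Longrightarrow> secure p (M + N) (b + c)"
proof (induction "free M + free N" arbitrary: M N rule: less_induct)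
  case less
  show ?case
  proof (cases "free (M + N) = 0")
    case True
    then have "b \<le> gain p * score M" "c \<le> gain p * score N"
      using less.prems[THEN secure_finalD] by auto
    then show ?thesis by (intro secure.final True) (simp add: distrib_left)
  next
    case False
    then show ?thesis
    proof (rule secure.round)
      fix X
      assume "move (other p) (M + N) X"
      then show "\<exists>X'. move p X X' \<and> secure p X' (b + c)"
      proof (cases rule: move_unionE)
        case (1 M1)
        obtain M2 where M2: "move p M1 M2" "secure p M2 b"
          by (rule secure_roundD[OF less.prems(1) 1(1)])
        have "free M2 < free M" using free_move[OF 1(1)] free_move[OF M2(1)] by simp
        then have "secure p (M2 + N) (b + c)"
          by (intro less.hyps M2(2) less.prems(2)) simp
        then show ?thesis using 1(2) move_mono[OF M2(1)] by blast
      next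
        case (2 N1)
        obtain N2 where N2: "move p N1 N2" "secure p N2 c"
          by (rule secure_roundD[OF less.prems(2) 2(1)])
        have "free N2 < free N" using free_move[OF 2(1)] free_move[OF N2(1)] by simp
        then have "secure p (M + N2) (b + c)"
          by (intro less.hyps N2(2) less.prems(1)) simp
        then show ?thesis using 2(2) move_mono[OF N2(1), of M] by (auto simp: add.commute)
      qed
    qed
  qed
qed

section \<open>Deleting an edge of the path\<close>

lemma edge_None [simp]: "edge l None = 0"
  by (cases l) auto

text \<open>This is the price of a deleted edge: putting it back costs either player at most
  1.\<close>

lemma gain_edge_ge: "-1 \<le> gain p * edge l r"
  by (cases p; cases l; cases r) auto

text \<open>
  A path of free vertices is compared with the two paths that arise by deleting one of its edges:
  moves correspond to each other, and only the value of the deleted edge makes a difference.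
\<close>

definition split_at :: "mark \<Rightarrow> nat \<Rightarrow> nat \<Rightarrow> mark \<Rightarrow> seg multiset \<Rightarrow> seg multiset" where
  "split_at l m m' r K = add_mset (seg l m None) (add_mset (seg None m' r) K)"

definition joined_at :: "mark \<Rightarrow> nat \<Rightarrow> nat \<Rightarrow> mark \<Rightarrow> seg multiset \<Rightarrow> seg multiset" where
  "joined_at l m m' r K = add_mset (seg l (m + m') r) K"

lemma moveI:
  assumes "M = add_mset (seg l (Suc (i + j)) r) K"
    "N = add_mset (seg l i (Some p)) (add_mset (seg (Some p) j r) K)"
  shows "move p M N"
  using assms unfolding move_def by blast

lemma move_addE:
  assumes "move p (add_mset (seg l m r) K) X"
  obtains i j where "m = Suc (i + j)"
      "X = add_mset (seg l i (Some p)) (add_mset (seg (Some p) j r) K)"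
    | K' where "move p K K'" "X = add_mset (seg l m r) K'"
proof -
  from assms have "move p ({#seg l m r#} + K) X" by simp
  then show thesis
  proof (cases rule: move_unionE)
    case (1 Y)
    from 1(1) obtain i j where "m = Suc (i + j)" "Y = {#seg l i (Some p), seg (Some p) j r#}"
      by (rule move_singleE)
    then show thesis using that(1)[of i j] 1(2) by simp
  next
    case (2 K')
    then show thesis using that(2) by simp
  qed
qed

text \<open>A new label falls on one side of the deleted edge. That edge afterwards lies inside a
  shorter run or at its border, so the position keeps the shape \<open>joined_at\<close>.\<close>

lemma move_joinedD:
  assumes "move q (joined_at l m m' r K) N"
  shows "\<exists>l1 m1 m1' r1 K1. N = joined_at l1 m1 m1' r1 K1 \<and>
    move q (split_at l m m' r K) (split_at l1 m1 m1' r1 K1)"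
proof -
  from assms have "move q (add_mset (seg l (m + m') r) K) N" by (simp add: joined_at_def)
  then show ?thesis
  proof (cases rule: move_addE)
    case (1 i j)
    show ?thesis
    \<comment> \<open>The run has \<open>m\<close> vertices before the deleted edge, so the new
      label lies before it exactly if \<open>i < m\<close>. In both cases \<open>k\<close> counts
      the free vertices left between the label and the edge.\<close>
    proof (cases "i < m")
      case True
      then obtain k where m: "m = Suc (i + k)" by (metis less_iff_Suc_add)
      then have j: "j = k + m'" using 1(1) by simp
      have "N = joined_at (Some q) k m' r (add_mset (seg l i (Some q)) K)"
        using 1(2) j by (simp add: joined_at_def add_mset_commute)
      moreover have "move q (split_at l m m' r K)
          (split_at (Some q) k m' r (add_mset (seg l i (Some q)) K))"
        by (rule moveI[where i=i and j=k]) (auto simp: split_at_def m)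
      ultimately show ?thesis by blast
    next
      case False
      then obtain k where i: "i = m + k" by (metis le_iff_add not_less)
      then have m': "m' = Suc (k + j)" using 1(1) by simp
      have "N = joined_at l m k (Some q) (add_mset (seg (Some q) j r) K)"
        using 1(2) i by (simp add: joined_at_def)
      moreover have "move q (split_at l m m' r K)
          (split_at l m k (Some q) (add_mset (seg (Some q) j r) K))"
        by (rule moveI[where l=None and i=k and j=j and r=r]) (auto simp: split_at_def m')
      ultimately show ?thesis by blast
    qed
  next
    case (2 K')
    have "move q (split_at l m m' r K) (split_at l m m' r K')"
      using move_mono[OF 2(1), of "{#seg l m None, seg None m' r#}"] by (simp add: split_at_def)
    moreover have "N = joined_at l m m' r K'" using 2(2) by (simp add: joined_at_def)
    ultimately show ?thesis by blast
  qed
qed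

text \<open>This is the way back: moves of the opponent are carried from the joined to the split
  position, replies from the split to the joined one.\<close>

lemma move_splitD:
  assumes "move q (split_at l m m' r K) N"
  shows "\<exists>l1 m1 m1' r1 K1. N = split_at l1 m1 m1' r1 K1 \<and>
    move q (joined_at l m m' r K) (joined_at l1 m1 m1' r1 K1)"
proof -
  from assms have "move q (add_mset (seg l m None) (add_mset (seg None m' r) K)) N"
    by (simp add: split_at_def)
  then show ?thesis
  proof (cases rule: move_addE)
    case (1 i k)
    have "N = split_at (Some q) k m' r (add_mset (seg l i (Some q)) K)"
      using 1(2) by (simp add: split_at_def add_mset_commute)
    moreover have "move q (joined_at l m m' r K)
        (joined_at (Some q) k m' r (add_mset (seg l i (Some q)) K))"
      by (rule moveI[where l=l and i=i and j="k + m'" and r=r])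
        (auto simp: joined_at_def 1(1) add.assoc add_mset_commute)
    ultimately show ?thesis by blast
  next
    case (2 N1)
    from 2(1) show ?thesis
    proof (cases rule: move_addE)
      case (1 k j)
      have "N = split_at l m k (Some q) (add_mset (seg (Some q) j r) K)"
        using 1(2) 2(2) by (simp add: split_at_def)
      moreover have "move q (joined_at l m m' r K)
          (joined_at l m k (Some q) (add_mset (seg (Some q) j r) K))"
        by (rule moveI[where l=l and i="m + k" and j=j and r=r])
          (auto simp: joined_at_def 1(1) add.assoc)
      ultimately show ?thesis by blast
    next
      case (2 K')
      have "move q (joined_at l m m' r K) (joined_at l m m' r K')"
        using move_mono[OF 2(1), of "{#seg l (m + m') r#}"] by (simp add: joined_at_def)
      moreover have "N = split_at l m m' r K'"
        using 2 \<open>N = add_mset (seg l m None) N1\<close> by (simp add: split_at_def)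
      ultimately show ?thesis by blast
    qed
  qed
qed

lemma secure_joined_at:
  "secure p (split_at l m m' r K) b \<Longrightarrow> secure p (joined_at l m m' r K) (b - 1)"
proof (induction "m + m' + free K" arbitrary: l m m' r K rule: less_induct)
  case less
  show ?case
  proof (cases "free (joined_at l m m' r K) = 0")
    case True
    then have "b \<le> gain p * score (split_at l m m' r K)"
      by (intro secure_finalD[OF less.prems]) (simp add: joined_at_def split_at_def)
    \<comment> \<open>Both runs are now empty and the deleted edge joins \<open>l\<close> to
      \<open>r\<close>. The joined position scores \<open>edge l r\<close>, while the split one
      scores 0 there because its two remnants end in \<open>None\<close>.\<close>
    then have "b - 1 \<le> gain p * score (joined_at l m m' r K)"
      using gain_edge_ge[of p l r]
      by (simp add: joined_at_def split_at_def distrib_left edge_commute[of None])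
    then show ?thesis by (rule secure.final[OF True])
  next
    case False
    then show ?thesis
    proof (rule secure.round)
      fix N
      assume N: "move (other p) (joined_at l m m' r K) N"
      then obtain l1 m1 m1' r1 K1 where N1: "N = joined_at l1 m1 m1' r1 K1"
        "move (other p) (split_at l m m' r K) (split_at l1 m1 m1' r1 K1)"
        using move_joinedD by blast
      obtain X where X: "move p (split_at l1 m1 m1' r1 K1) X" "secure p X b"
        by (rule secure_roundD[OF less.prems N1(2)])
      then obtain l2 m2 m2' r2 K2 where N2: "X = split_at l2 m2 m2' r2 K2"
        "move p (joined_at l1 m1 m1' r1 K1) (joined_at l2 m2 m2' r2 K2)"
        using move_splitD by blast
      have "m2 + m2' + free K2 < m + m' + free K"
        using free_move[OF N1(2)] free_move[OF X(1)] N2(1) by (simp add: split_at_def)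
      then have "secure p (joined_at l2 m2 m2' r2 K2) (b - 1)"
        using less.hyps X(2) N2(1) by blast
      then show "\<exists>M'. move p N M' \<and> secure p M' (b - 1)"
        using N1(1) N2(2) by blast
    qed
  qed
qed

lemma secure_join:
  assumes "secure p {#seg l m None#} b" "secure p (add_mset (seg None m' r) K) c"
  shows "secure p (add_mset (seg l (m + m') r) K) (b + c - 1)"
  using secure_joined_at[of p l m m' r K "b + c"] secure_union[OF assms]
  by (simp add: split_at_def joined_at_def add_mset_commute)

section \<open>Paths\<close>

text \<open>In a word, \<open>None\<close> is a free vertex; as a mark it is an end of the path.\<close>

fun segs :: "mark \<Rightarrow> nat \<Rightarrow> player option list \<Rightarrow> seg multiset" where
  "segs l k [] = {#seg l k None#}"
| "segs l k (None # w) = segs l (Suc k) w"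
| "segs l k (Some p # w) = add_mset (seg l k (Some p)) (segs (Some p) 0 w)"

text \<open>The accumulators \<open>l\<close> and \<open>k\<close> influence the first segment only;
  its far end \<open>r\<close> and the other segments \<open>K\<close> are determined by the word.
  This uniformity allows \<open>move_segs\<close> to compare the word after a free cell with the
  same word after a label.\<close>

lemma segs_head: "\<exists>K j r. \<forall>l k. segs l k w = add_mset (seg l (k + j) r) K"
proof (induction w)
  case Nil
  have "\<forall>l k. segs l k [] = add_mset (seg l (k + 0) None) {#}" by simp
  then show ?case by blast
next
  case (Cons c w)
  show ?case
  proof (cases c)
    case None
    from Cons obtain K j r where "\<forall>l k. segs l k w = add_mset (seg l (k + j) r) K" by blast
    then have "\<forall>l k. segs l k (c # w) = add_mset (seg l (k + Suc j) r) K" by (simp add: None)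
    then show ?thesis by blast
  next
    case (Some p)
    then have "\<forall>l k. segs l k (c # w) = add_mset (seg l (k + 0) (Some p)) (segs (Some p) 0 w)" by simp
    then show ?thesis by blast
  qed
qed

lemma move_segs: "move p (segs l k (u @ None # v)) (segs l k (u @ Some p # v))"
proof (induction l k u rule: segs.induct)
  case (1 l k)
  obtain K j r where "\<forall>l k. segs l k v = add_mset (seg l (k + j) r) K"
    using segs_head by blast
  then show ?case by (intro moveI[of _ l k j r K]) simp_all
next
  case (2 l k w)
  then show ?case by simp
next
  case (3 l k q w)
  then show ?case using move_mono[OF 3, of "{#seg l k (Some q)#}"] by simp
qed

lemma segs_replicate: "segs l k (replicate m None @ w) = segs l (k + m) w"
  by (induction m arbitrary: k) auto

lemma replicate_Suc_add: "replicate (Suc (i + j)) x @ w = replicate i x @ x # replicate j x @ w"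
  by (induction i) auto

lemma word_cases:
  fixes w :: "'a option list"
  obtains m where "w = replicate m None" | m c v where "w = replicate m None @ Some c # v"
proof (induction w arbitrary: thesis)
  case Nil
  then show ?case by (metis replicate_0)
next
  case (Cons x w)
  show ?case
  proof (cases x)
    case None
    show ?thesis
      by (rule Cons.IH) (metis None Cons.prems replicate_Suc append_Cons)+
  next
    case (Some a)
    then show ?thesis using Cons.prems(2)[of 0] by simp
  qed
qed

text \<open>A move on the multiset names neither the place nor the orientation of the segment. Some
  cell of the word realizes it, possibly in another copy of that segment or reflected, and yields
  the same multiset.\<close>

lemma move_segsE:
  assumes "move p (segs l 0 w) N"
  shows "\<exists>u v. w = u @ None # v \<and> N = segs l 0 (u @ Some p # v)"
  using assms
proof (induction "length w" arbitrary: l w N rule: less_induct)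
  case less
  show ?case
  proof (cases w rule: word_cases)
    case (1 m)
    then have "move p {#seg l m None#} N" using less.prems segs_replicate[of l 0 m "[]"] by simp
    then obtain i j where ij: "m = Suc (i + j)" "N = {#seg l i (Some p), seg (Some p) j None#}"
      by (rule move_singleE)
    have "w = replicate i None @ None # replicate j None"
      using replicate_Suc_add[of i j None "[]"] by (simp add: 1 ij(1))
    moreover have "N = segs l 0 (replicate i None @ Some p # replicate j None)"
      using segs_replicate[of "Some p" 0 j "[]"] by (simp add: segs_replicate ij(2))
    ultimately show ?thesis by blast
  next
    case (2 m c v)
    then have "move p (add_mset (seg l m (Some c)) (segs (Some c) 0 v)) N"
      using less.prems by (simp add: segs_replicate)
    then show ?thesis
    proof (cases rule: move_addE)
      case (1 i j)
      have "w = replicate i None @ None # replicate j None @ Some c # v"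
        unfolding 2 1(1) replicate_Suc_add ..
      moreover have "N = segs l 0 (replicate i None @ Some p # replicate j None @ Some c # v)"
        by (simp add: segs_replicate 1(2))
      ultimately show ?thesis by blast
    next
      case (2 N')
      have "length v < length w" using \<open>w = _\<close> by simp
      then obtain u' v' where "v = u' @ None # v'" "N' = segs (Some c) 0 (u' @ Some p # v')"
        using less.hyps 2(1) by blast
      then have "w = (replicate m None @ Some c # u') @ None # v'"
        "N = segs l 0 ((replicate m None @ Some c # u') @ Some p # v')"
        using \<open>w = _\<close> 2(2) by (simp_all add: segs_replicate)
      then show ?thesis by blast
    qed
  qed
qed

lemma free_segs: "free (segs l k w) = k + length (filter (\<lambda>c. c = None) w)"
  by (induction l k w rule: segs.induct) auto

section \<open>From labelings to words\<close>

definition owner :: "nat \<Rightarrow> player" where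
  "owner c = (if c = 0 then Admirable else Impish)"

lemma owner_label [simp]: "owner (label p) = p"
  by (cases p) (auto simp: owner_def)

definition cells :: "nat \<Rightarrow> nat labeling \<Rightarrow> player option list" where
  "cells n f = map (\<lambda>i. map_option owner (f i)) [1..<Suc n]"

lemma length_cells [simp]: "length (cells n f) = n"
  by (simp add: cells_def)

lemma nth_cells: "i < n \<Longrightarrow> cells n f ! i = map_option owner (f (Suc i))"
  by (simp add: cells_def del: upt_Suc)

lemma cells_update:
  assumes "v < n"
  shows "cells n (f(Suc v \<mapsto> label p)) = (cells n f)[v := Some p]"
  using assms by (intro nth_equalityI) (auto simp: nth_cells nth_list_update)

text \<open>Each summand is the edge that enters a cell from the left. The segment behind the last
  cell ends in \<open>None\<close> and contributes 0.\<close>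

lemma score_segs:
  "None \<notin> set w \<Longrightarrow> score (segs l 0 w) = (\<Sum>i<length w. edge ((l # w) ! i) (w ! i))"
proof (induction w arbitrary: l)
  case Nil
  then show ?case by simp
next
  case (Cons c w)
  then obtain p where c: "c = Some p" by (cases c) auto
  show ?case
    using Cons.IH[of c] Cons.prems by (simp add: c sum.lessThan_Suc_shift del: sum.lessThan_Suc)
qed

lemma discrepancy_path_graph:
  "discrepancy (path_graph n) f = (\<Sum>i = 1..<n. if edge_label f {i, i + 1} = 1 then 1 else -1)"
proof -
  let ?e = "\<lambda>i::nat. {i, i + 1}"
  have inj: "inj_on ?e A" for A by (auto simp: inj_on_def doubleton_eq_iff)
  have edges: "edges (path_graph n) = ?e ` {1..<n}" by (auto simp: path_graph_def)
  have card: "int (card {e \<in> edges (path_graph n). P e}) = (\<Sum>i = 1..<n. if P (?e i) then 1 else 0)"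
    for P
  proof -
    have "{e \<in> edges (path_graph n). P e} = ?e ` {i \<in> {1..<n}. P (?e i)}" unfolding edges by auto
    then have "card {e \<in> edges (path_graph n). P e} = card {i \<in> {1..<n}. P (?e i)}"
      by (simp only: card_image[OF inj])
    then show ?thesis by (simp add: sum.If_cases Int_def)
  qed
  show ?thesis
    unfolding discrepancy_def card sum_subtractf[symmetric]
    by (intro sum.cong) (auto simp: edge_label_def)
qed

lemma discrepancy_eq_score:
  assumes dom: "{1..n} \<subseteq> dom f" and ran: "ran f \<subseteq> {0, 1}"
  shows "discrepancy (path_graph n) f = score (segs None 0 (cells n f))"
proof (cases n)
  case 0
  then show ?thesis by (simp add: discrepancy_path_graph cells_def)
next
  case (Suc m)
  have val: "\<exists>p. f i = Some (label p)" if "1 \<le> i" "i \<le> n" for i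
  proof -
    have "i \<in> dom f" using that dom by auto
    then obtain c where c: "f i = Some c" by auto
    then have "c \<in> {0, 1}" using ran ranI by fastforce
    then have "c = label (owner c)" by (auto simp: owner_def)
    then show ?thesis using c by metis
  qed
  have "None \<notin> set (cells n f)"
  proof
    assume "None \<in> set (cells n f)"
    then obtain i where "i < n" "cells n f ! i = None" by (metis in_set_conv_nth length_cells)
    then show False using val[of "Suc i"] by (auto simp: nth_cells)
  qed
  then have "score (segs None 0 (cells n f)) =
      (\<Sum>i<n. edge ((None # cells n f) ! i) (cells n f ! i))"
    by (simp add: score_segs)
  \<comment> \<open>The summand of the first cell comes from the left end of the path and vanishes;
    what remains are the \<open>m = n - 1\<close> edges.\<close>
  also have "\<dots> = (\<Sum>i<m. edge (cells n f ! i) (cells n f ! Suc i))"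
    by (simp add: Suc sum.lessThan_Suc_shift edge_commute[of None] del: sum.lessThan_Suc)
  also have "\<dots> = (\<Sum>i<m. if edge_label f {Suc i, Suc i + 1} = 1 then 1 else -1)"
  proof (rule sum.cong)
    fix i
    assume "i \<in> {..<m}"
    then have i: "i < n" "Suc i < n" using Suc by auto
    obtain p where p: "f (Suc i) = Some (label p)" using val[of "Suc i"] i by auto
    obtain q where q: "f (Suc (Suc i)) = Some (label q)" using val[of "Suc (Suc i)"] i by auto
    show "edge (cells n f ! i) (cells n f ! Suc i) =
        (if edge_label f {Suc i, Suc i + 1} = 1 then 1 else -1)"
      by (cases p; cases q) (simp_all add: nth_cells i p q edge_label_def owner_def)
  qed simp
  also have "\<dots> = (\<Sum>i = 1..<n. if edge_label f {i, i + 1} = 1 then 1 else -1)"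
    by (rule sum.reindex_bij_witness[of _ "\<lambda>i. i - 1" Suc]) (auto simp: Suc)
  finally show ?thesis by (simp add: discrepancy_path_graph)
qed

text \<open>A strategy on multisets becomes a strategy in the game. Forgetting where the segments
  lie is harmless, because a finished labeling is scored through its multiset of segments
  alone.\<close>

lemma secure_game_value:
  assumes "secure p M b" "M = segs None 0 (cells n f)" "ran f \<subseteq> {0, 1}"
  shows "b \<le> gain p * game_value (path_graph n) (other p) f"
  using assms
proof (induction arbitrary: f rule: secure.induct)
  case (final M b)
  have "None \<notin> set (cells n f)"
    using final.hyps(1) final.prems(1) by (auto simp: free_segs filter_empty_conv)
  then have "{1..n} \<subseteq> dom f"
    by (auto simp: cells_def simp del: upt_Suc)
  moreover have "verts (path_graph n) = {1..n}" by (simp add: path_graph_def)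
  ultimately show ?case
    using final by (simp add: game_value_terminal discrepancy_eq_score)
next
  case (round M b)
  let ?G = "path_graph n" and ?q = "other p"
  have V: "verts ?G = {1..n}" by (simp add: path_graph_def)
  then have fin: "finite (verts ?G)" by simp
  have ran_upd: "ran (g(x \<mapsto> label r)) \<subseteq> {0, 1}" if "ran g \<subseteq> {0, 1}" for g x r
    using that by (cases r) (auto simp: ran_def)
  have "\<not> verts ?G \<subseteq> dom f"
  proof
    assume sub: "verts ?G \<subseteq> dom f"
    have "cells n f ! i \<noteq> None" if "i < n" for i
    proof -
      have "Suc i \<in> dom f" using sub that V by (auto simp: subset_eq)
      then show ?thesis using that by (auto simp: nth_cells)
    qed
    then have "None \<notin> set (cells n f)" by (metis in_set_conv_nth length_cells)
    then have "filter (\<lambda>c. c = None) (cells n f) = []" by (intro filter_False) metis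
    then show False using round.hyps(1) round.prems(1) by (simp add: free_segs)
  qed
  \<comment> \<open>It suffices to treat one optimal move of the opponent, as \<open>secure\<close>
    provides a reply to every move.\<close>
  then obtain x where x: "x \<in> verts ?G - dom f"
    and gx: "game_value ?G ?q f = game_value ?G p (f(x \<mapsto> label ?q))"
    using game_value_attained[OF fin, of f ?q] by auto
  obtain i where i: "x = Suc i" "i < n" using x V by (cases x) auto
  let ?f = "f(x \<mapsto> label ?q)"
  have "cells n f ! i = None" using i x by (auto simp: nth_cells)
  then have "cells n f = take i (cells n f) @ None # drop (Suc i) (cells n f)"
    using i id_take_nth_drop[of i "cells n f"] by simp
  moreover have "cells n ?f = take i (cells n f) @ Some ?q # drop (Suc i) (cells n f)"
    using i by (simp add: cells_update upd_conv_take_nth_drop)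
  ultimately have "move ?q M (segs None 0 (cells n ?f))"
    unfolding round.prems(1) using move_segs by metis
  then obtain M' where M': "move p (segs None 0 (cells n ?f)) M'"
    and IH: "\<And>g. M' = segs None 0 (cells n g) \<Longrightarrow> ran g \<subseteq> {0, 1} \<Longrightarrow>
      b \<le> gain p * game_value ?G ?q g"
    using round.IH by blast
  \<comment> \<open>The reply is pulled back to a vertex of the path: the free cell with index
    \<open>length u\<close> is vertex \<open>Suc (length u)\<close>.\<close>
  obtain u v where uv: "cells n ?f = u @ None # v" "M' = segs None 0 (u @ Some p # v)"
    using move_segsE[OF M'] by blast
  let ?y = "Suc (length u)"
  have len: "length u < n" using arg_cong[OF uv(1), of length] by simp
  have "cells n ?f ! length u = None" unfolding uv(1) by simp
  then have "?f ?y = None" using len by (simp add: nth_cells del: fun_upd_apply)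
  then have y: "?y \<in> verts ?G - dom ?f" unfolding V Diff_iff domIff using len by simp
  have "cells n (?f(?y \<mapsto> label p)) = u @ Some p # v"
    using len by (simp add: cells_update uv(1) del: fun_upd_apply)
  then have "b \<le> gain p * game_value ?G ?q (?f(?y \<mapsto> label p))"
    using IH[of "?f(?y \<mapsto> label p)"] uv(2) ran_upd[OF ran_upd[OF round.prems(2)]] by simp
  also have "\<dots> \<le> gain p * game_value ?G p ?f"
    by (rule game_value_optimal[OF fin y])
  finally show ?case by (simp add: gx)
qed

lemma segs_empty: "segs None 0 (cells n Map.empty) = {#seg None n None#}"
proof -
  have "cells n Map.empty = replicate n None @ []" by (rule nth_equalityI) (auto simp: nth_cells)
  then show ?thesis by (simp only: segs_replicate segs.simps) simp
qed

lemma segs_opening: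
  "segs None 0 (cells (Suc (i + j)) [Suc i \<mapsto> label p]) = {#seg None i (Some p), seg None j (Some p)#}"
proof -
  have "cells (Suc (i + j)) [Suc i \<mapsto> label p] = replicate i None @ Some p # replicate j None @ []"
    by (rule nth_equalityI) (auto simp: nth_cells nth_append nth_Cons' simp del: replicate_Suc)
  then show ?thesis
    by (simp only: segs_replicate segs.simps) (simp add: seg_commute[of None])
qed

section \<open>Checking explicit strategies\<close>

fun len :: "seg \<Rightarrow> nat" where
  "len (l, m, r) = m"

fun normal :: "seg \<Rightarrow> bool" where
  "normal (l, m, r) \<longleftrightarrow> rank l \<le> rank r"

fun cut :: "player \<Rightarrow> nat \<Rightarrow> seg \<Rightarrow> seg list" where
  "cut p i (l, m, r) = [seg l i (Some p), seg (Some p) (m - Suc i) r]"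

text \<open>Of the two mirror images of a move in a segment with equal ends, one suffices.\<close>

fun cuts :: "player \<Rightarrow> seg \<Rightarrow> seg list list" where
  "cuts p (l, m, r) = map (\<lambda>i. cut p i (l, m, r)) [0..<(if l = r then Suc m div 2 else m)]"

text \<open>\<open>remdups\<close> drops moves in further copies of a segment, since they lead to
  the same multiset.\<close>

definition attacks :: "player \<Rightarrow> seg list \<Rightarrow> seg list list" where
  "attacks p s = concat (map (\<lambda>T. map (\<lambda>x. x @ remove1 T s) (cuts p T)) (remdups s))"

fun reply :: "player \<Rightarrow> nat \<Rightarrow> seg list \<Rightarrow> seg list" where
  "reply p k [] = []"
| "reply p k (T # s) = (if k < len T then cut p k T @ s else T # reply p (k - len T) s)"

fun same_elems :: "'a list \<Rightarrow> 'a list \<Rightarrow> bool" where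
  "same_elems [] ys \<longleftrightarrow> ys = []"
| "same_elems (x # xs) ys \<longleftrightarrow> x \<in> set ys \<and> same_elems xs (remove1 x ys)"

text \<open>This is the counterpart of \<open>score\<close> for unfinished positions: runs with free
  vertices count 0 here, their worth being supplied by the groups of the certificate.\<close>

fun settled :: "seg list \<Rightarrow> int" where
  "settled [] = 0"
| "settled ((l, m, r) # s) = (if m = 0 then edge l r else 0) + settled s"

definition answers :: "player \<Rightarrow> int \<Rightarrow> seg list \<Rightarrow> nat \<times> (seg list \<times> int) list \<Rightarrow> bool" where
  "answers p b s = (\<lambda>(k, cs). k < sum_list (map len s) \<and>
     (let t = reply p k s in same_elems (filter (\<lambda>T. len T \<noteq> 0) t) (concat (map fst cs)) \<and>
       b \<le> gain p * settled t + sum_list (map snd cs)))"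

definition plan :: "player \<Rightarrow> seg list \<Rightarrow> int \<Rightarrow> (nat \<times> (seg list \<times> int) list) list \<Rightarrow> bool" where
  "plan p s b rs \<longleftrightarrow> list_all normal s \<and> sum_list (map len s) \<noteq> 0 \<and>
     list_all2 (answers p b) (attacks (other p) s) rs"

text \<open>A separate constant keeps the lists folded, so that earlier bounds match the groups of a
  certificate syntactically.\<close>

definition holds :: "player \<Rightarrow> seg list \<Rightarrow> int \<Rightarrow> bool" where
  "holds p s b \<longleftrightarrow> secure p (mset s) b"

section \<open>Soundness of the check\<close>

lemma same_elems_mset: "same_elems xs ys \<Longrightarrow> mset xs = mset ys"
  by (induction xs ys rule: same_elems.induct) auto

lemma normal_seg: "normal (seg l m r)"
  by (auto simp: seg_def)

lemma normal_eq_seg: "normal (l, m, r) \<Longrightarrow> (l, m, r) = seg l m r"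
  by (auto simp: seg_def)

lemma mset_cut: "mset (cut p i (l, m, r)) = {#seg l i (Some p), seg (Some p) (m - Suc i) r#}"
  by simp

lemma move_reply:
  "list_all normal s \<Longrightarrow> k < sum_list (map len s) \<Longrightarrow> move p (mset s) (mset (reply p k s))"
proof (induction p k s rule: reply.induct)
  case (1 p k)
  then show ?case by simp
next
  case (2 p k T s)
  obtain l m r where T: "T = (l, m, r)" by (cases T)
  show ?case
  proof (cases "k < len T")
    case True
    then obtain j where m: "m = Suc (k + j)" using T less_iff_Suc_add by auto
    have "T = seg l (Suc (k + j)) r" using 2 T m normal_eq_seg by simp
    moreover have "mset (cut p k T) = {#seg l k (Some p), seg (Some p) j r#}" using T m by simp
    ultimately show ?thesis
      using True by (intro moveI[of _ l k j r "mset s"]) simp_all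
  next
    case False
    then have "move p (mset s) (mset (reply p (k - len T) s))" using 2 by simp
    from move_mono[OF this, of "{#T#}"] False show ?thesis by simp
  qed
qed

text \<open>The enumeration is complete up to reflection and up to the choice among equal segments,
  and neither changes the resulting multiset.\<close>

lemma move_attacks:
  assumes "list_all normal s" "move p (mset s) N"
  shows "\<exists>t \<in> set (attacks p s). N = mset t \<and> list_all normal t"
proof -
  obtain K l i j r where s: "mset s = add_mset (seg l (Suc (i + j)) r) K"
    and N: "N = add_mset (seg l i (Some p)) (add_mset (seg (Some p) j r) K)"
    using assms(2) unfolding move_def by blast
  let ?m = "Suc (i + j)" let ?T = "seg l ?m r"
  have T: "?T \<in> set s" using s by (metis set_mset_mset union_single_eq_member)
  have K: "K = mset (remove1 ?T s)" by (simp add: s)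
  have "\<exists>x \<in> set (cuts p ?T). mset x = {#seg l i (Some p), seg (Some p) j r#}"
  proof -
    have *: "\<exists>x \<in> set (cuts p (l, Suc (i + j), r)). mset x = {#seg l i (Some p), seg (Some p) j r#}"
      if "l \<noteq> r \<or> i \<le> j" for l i j r
    proof -
      \<comment> \<open>For equal ends, \<open>i \<le> j\<close> gives
        \<open>2 * i + 2 \<le> i + j + 2\<close>, so \<open>i\<close> lies in the enumerated half;
        the middle vertex is included.\<close>
      have "i \<in> set [0..<if l = r then Suc (Suc (i + j)) div 2 else Suc (i + j)]" using that by auto
      then have "cut p i (l, Suc (i + j), r) \<in> set (cuts p (l, Suc (i + j), r))"
        unfolding cuts.simps set_map by (rule imageI)
      then show ?thesis by (rule rev_bexI) (simp add: mset_cut)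
    qed
    have flip: "{#seg r j (Some p), seg (Some p) i l#} = {#seg l i (Some p), seg (Some p) j r#}"
      by (metis seg_commute add_mset_commute)
    \<comment> \<open>Reflection swaps \<open>i\<close> and \<open>j\<close>. With different ends
      the normalized orientation decides which reading applies; with equal ends the reading with the
      smaller first index is taken.\<close>
    consider "?T = (l, Suc (i + j), r)" "l \<noteq> r \<or> i \<le> j"
      | "?T = (r, Suc (j + i), l)" "r \<noteq> l \<or> j \<le> i"
      unfolding seg_def add.commute[of j] by (metis nat_le_linear)
    then show ?thesis
    proof cases
      case 1
      then show ?thesis using *[OF 1(2)] by (simp only:)
    next
      case 2
      then show ?thesis using *[OF 2(2)] by (simp only: flip)
    qed
  qed
  then obtain x where x: "x \<in> set (cuts p ?T)" "mset x = {#seg l i (Some p), seg (Some p) j r#}"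
    by blast
  have "list_all normal x" using x(1) by (cases ?T) (auto simp: normal_seg)
  moreover have "list_all normal (remove1 ?T s)"
    using assms(1) by (auto simp: list_all_iff dest: notin_set_remove1)
  moreover have "x @ remove1 ?T s \<in> set (attacks p s)"
    using x(1) T by (auto simp: attacks_def)
  moreover have "N = mset (x @ remove1 ?T s)" using x(2) K N by simp
  ultimately show ?thesis by (metis list_all_append)
qed

lemma score_settled: "\<forall>T\<in>set t. len T = 0 \<Longrightarrow> settled t = score (mset t)"
  by (induction t rule: settled.induct) (auto simp: score_def)

lemma settled_filter: "settled (filter (\<lambda>T. len T = 0) t) = settled t"
  by (induction t rule: settled.induct) auto

lemma free_mset: "free (mset t) = sum_list (map len t)"
  by (induction t) (auto simp: free_def)

lemma secure_parts:
  "\<forall>(t, c) \<in> set cs. holds p t c \<Longrightarrow> secure p (mset (concat (map fst cs))) (sum_list (map snd cs))"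
proof (induction cs)
  case Nil
  then show ?case by (auto intro: secure.final)
next
  case (Cons x cs)
  then show ?case by (auto simp: holds_def intro: secure_union)
qed

text \<open>After the reply the position is the union of its finished edges, worth
  \<open>settled\<close>, and of the groups with known bounds, so \<open>secure_union\<close>
  applies.\<close>

lemma secure_reply:
  assumes "answers p b s (k, cs)" "\<forall>(t, c) \<in> set cs. holds p t c"
  shows "secure p (mset (reply p k s)) b"
proof -
  let ?t = "reply p k s" and ?zero = "\<lambda>T. len T = 0"
  have "secure p (mset (filter ?zero ?t)) (gain p * settled ?t)"
  proof (rule secure.final)
    show "free (mset (filter ?zero ?t)) = 0" unfolding free_mset by (auto simp: sum_list_eq_0_iff)
    show "gain p * settled ?t \<le> gain p * score (mset (filter ?zero ?t))"
      using score_settled[of "filter ?zero ?t"] by (simp add: settled_filter)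
  qed
  moreover have "secure p (mset (filter (\<lambda>T. \<not> ?zero T) ?t)) (sum_list (map snd cs))"
    using assms(1) same_elems_mset secure_parts[OF assms(2)] by (fastforce simp: answers_def Let_def)
  ultimately have "secure p (mset (filter ?zero ?t) + mset (filter (\<lambda>T. \<not> ?zero T) ?t))
      (gain p * settled ?t + sum_list (map snd cs))"
    by (rule secure_union)
  moreover have "mset (filter ?zero ?t) + mset (filter (\<lambda>T. \<not> ?zero T) ?t) = mset ?t"
    by (simp add: mset_filter flip: multiset_partition)
  ultimately show ?thesis
    using assms(1) secure_mono by (fastforce simp: answers_def Let_def)
qed

text \<open>The first premise is pure computation and the second refers to bounds proved earlier.
  Each fact thus verifies a single round of the game, not the tree below it.\<close>

lemma holdsI:
  assumes "plan p s b rs" "list_all (list_all (\<lambda>(t, c). holds p t c) \<circ> snd) rs"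
  shows "holds p s b"
  unfolding holds_def
proof (rule secure.round)
  show "free (mset s) \<noteq> 0" using assms(1) by (simp add: free_mset plan_def)
  fix N
  assume "move (other p) (mset s) N"
  then obtain t where t: "t \<in> set (attacks (other p) s)" "N = mset t" "list_all normal t"
    using move_attacks assms(1) by (metis plan_def)
  then obtain k cs where kcs: "(k, cs) \<in> set rs" "answers p b t (k, cs)"
    using assms(1) unfolding plan_def list_all2_conv_all_nth in_set_conv_nth by (metis surj_pair)
  have cs: "\<forall>(t, c) \<in> set cs. holds p t c"
    using assms(2) kcs(1) by (fastforce simp: list_all_iff)
  have "move p N (mset (reply p k t))"
    using move_reply[OF t(3)] kcs(2) t(2) by (auto simp: answers_def)
  then show "\<exists>M'. move p N M' \<and> secure p M' b"
    using secure_reply[OF kcs(2) cs] by blast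
qed

text \<open>The letters name the owners of the two ends, with \<open>E\<close> for an end of the
  path. Their order A, I, E makes all these segments \<open>normal\<close>.\<close>

abbreviation AA :: "nat \<Rightarrow> seg" where "AA m \<equiv> (Some Admirable, m, Some Admirable)"
abbreviation AI :: "nat \<Rightarrow> seg" where "AI m \<equiv> (Some Admirable, m, Some Impish)"
abbreviation II :: "nat \<Rightarrow> seg" where "II m \<equiv> (Some Impish, m, Some Impish)"
abbreviation AE :: "nat \<Rightarrow> seg" where "AE m \<equiv> (Some Admirable, m, None)"
abbreviation IE :: "nat \<Rightarrow> seg" where "IE m \<equiv> (Some Impish, m, None)"
abbreviation EE :: "nat \<Rightarrow> seg" where "EE m \<equiv> (None, m, None)"

named_theorems known

text \<open>Just enough rewriting to break the second premise of \<open>holdsI\<close> into single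
  \<open>holds\<close> facts, which \<open>known\<close> then discharges.\<close>

lemmas parts_simps = list.pred_inject comp_apply snd_conv prod.case simp_thms

text \<open>
  The strategies below were found by a computer search. The entries of \<open>rs\<close> answer the opponent's
  moves in the order of \<open>attacks\<close>. In \<open>(k, cs)\<close>, the number \<open>k\<close> is the free vertex that is taken,
  counted from 0 through the whole list of segments, and \<open>cs\<close> groups the segments that remain into
  positions for which a guaranteed value is already known.
\<close>

section \<open>Impish moves second\<close>

lemma [known]: "holds Impish [II 2] 1"
  by (rule holdsI[where rs="
      [(0, [])]"],
    code_simp, simp only: parts_simps known)

text \<open>The critical attack is next to Admirable's own label and leads to A A I I with edges -1,
  1, -1. Bounds of this kind are negative but still useful inside larger sums.\<close>

lemma [known]: "holds Impish [AI 2] (-1)"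
  by (rule holdsI[where rs="
      [(0, []), (0, [])]"],
    code_simp, simp only: parts_simps known)

text \<open>A single free vertex between different labels contributes 0 whoever takes it: one of its
  edges counts 1, the other -1. It acts as a spare move that repairs the parity of another odd
  run.\<close>

lemma [known]: "holds Impish [AI 1, AI 1] 0"
  by (rule holdsI[where rs="
      [(0, [])]"],
    code_simp, simp only: parts_simps known)

lemma [known]: "holds Impish [AI 4] 1"
  by (rule holdsI[where rs="
      [(0, [([II 2], 1)]), (0, [([AI 2], -1)]), (0, [([AI 1, AI 1], 0)]), (0, [([AI 2], -1)])]"],
    code_simp, simp only: parts_simps known)

lemma [known]: "holds Impish [AA 1, AI 1] (-2)"
  by (rule holdsI[where rs="
      [(0, []), (0, [])]"],
    code_simp, simp only: parts_simps known)

lemma [known]: "holds Impish [AA 1, II 5] 0"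
  by (rule holdsI[where rs="
      [(2, [([II 2], 1), ([II 2], 1)]), (4, [([AI 4], 1)]), (1, [([AA 1, AI 1], -2),
      ([II 2], 1)]), (4, [([AI 2], -1), ([AI 2], -1)])]"],
    code_simp, simp only: parts_simps known)

lemma [known]: "holds Impish [AA 2] 1"
  by (rule holdsI[where rs="
      [(0, [])]"],
    code_simp, simp only: parts_simps known)

lemma [known]: "holds Impish [AA 3, AI 1] 0"
  by (rule holdsI[where rs="
      [(2, [([AA 2], 1)]), (0, [([AA 1, AI 1], -2)]), (0, [([AI 2], -1)])]"],
    code_simp, simp only: parts_simps known)

lemma [known]: "holds Impish [AA 4] (-1)"
  by (rule holdsI[where rs="
      [(0, [([AI 2], -1)]), (0, [([AA 2], 1)])]"],
    code_simp, simp only: parts_simps known)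

lemma [known]: "holds Impish [AI 1, AI 5] 0"
  by (rule holdsI[where rs="
      [(2, [([AI 2], -1), ([II 2], 1)]), (4, [([AI 4], 1)]), (1, [([AA 1, AI 1], -2),
      ([II 2], 1)]), (4, [([AA 2], 1), ([AI 2], -1)]), (3, [([AA 3, AI 1], 0)]),
      (4, [([AA 4], -1)])]"],
    code_simp, simp only: parts_simps known)

text \<open>Each player takes one of the two vertices; they count 2 and -2 and cancel.\<close>

lemma [known]: "holds Impish [II 1, II 1] 0"
  by (rule holdsI[where rs="
      [(0, [])]"],
    code_simp, simp only: parts_simps known)

lemma [known]: "holds Impish [AI 1, II 1] (-2)"
  by (rule holdsI[where rs="
      [(0, []), (0, [])]"],
    code_simp, simp only: parts_simps known)

lemma [known]: "holds Impish [AI 1, II 1, II 4] 1"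
  by (rule holdsI[where rs="
      [(2, [([II 1, II 1], 0), ([II 2], 1)]), (2, [([AI 1, II 1], -2), ([II 2], 1)]), (0, [([AI 1,
      II 1], -2), ([II 2], 1)]), (1, [([AI 1, AI 1], 0), ([II 1, II 1], 0)])]"],
    code_simp, simp only: parts_simps known)

lemma [known]: "holds Impish [II 4] (-1)"
  by (rule holdsI[where rs="
      [(0, [([II 2], 1)]), (0, [([AI 2], -1)])]"],
    code_simp, simp only: parts_simps known)

lemma [known]: "holds Impish [AI 1, AI 2, AI 2, II 1] 0"
  by (rule holdsI[where rs="
      [(0, [([II 1, II 1], 0), ([AI 2], -1)]), (2, [([AI 1, AI 1], 0), ([II 1, II 1], 0)]),
      (0, [([AI 1, II 1], -2), ([AI 2], -1)]), (0, [([AI 2], -1), ([AI 2], -1)])]"],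
    code_simp, simp only: parts_simps known)

lemma [known]: "holds Impish [AI 2, AI 2, II 4] 1"
  by (rule holdsI[where rs="
      [(1, [([AI 1, II 1, II 4], 1)]), (0, [([AI 2], -1), ([II 4], -1)]), (0, [([AI 2], -1),
      ([AI 2], -1), ([II 2], 1)]), (1, [([AI 1, AI 2, AI 2, II 1], 0)])]"],
    code_simp, simp only: parts_simps known)

lemma [known]: "holds Impish [AI 5, II 5] 2"
  by (rule holdsI[where rs="
      [(6, [([II 2], 1), ([II 2], 1), ([AI 4], 1)]), (1, [([AA 1, II 5], 0), ([II 2], 1)]),
      (6, [([AA 2], 1), ([AI 2], -1), ([II 2], 1), ([II 2], 1)]), (6, [([AA 3, AI 1], 0),
      ([II 2], 1), ([II 2], 1)]), (6, [([II 2], 1), ([II 2], 1), ([AA 4], -1)]),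
      (6, [([AI 2], -1), ([II 2], 1), ([AI 4], 1)]), (1, [([AI 1, AI 5], 0), ([II 2], 1)]),
      (4, [([AI 2, AI 2, II 4], 1)])]"],
    code_simp, simp only: parts_simps known)

lemma [known]: "holds Impish [II 6] 1"
  by (rule holdsI[where rs="
      [(0, [([II 4], -1)]), (0, [([AI 4], 1)]), (2, [([AI 2], -1), ([II 2], 1)])]"],
    code_simp, simp only: parts_simps known)

lemma [known]: "holds Impish [AI 3, II 1] 0"
  by (rule holdsI[where rs="
      [(0, [([II 1, II 1], 0)]), (0, [([AI 1, II 1], -2)]), (2, [([AA 2], 1)]),
      (0, [([II 2], 1)])]"],
    code_simp, simp only: parts_simps known)

lemma [known]: "holds Impish [AI 1, AI 6, II 1] 1"
  by (rule holdsI[where rs="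
      [(1, [([AI 1, II 1, II 4], 1)]), (0, [([AI 1, II 1, II 4], 1)]), (0, [([AI 1, II 1], -2),
      ([AI 4], 1)]), (2, [([AI 1, II 1], -2), ([AA 2], 1), ([II 2], 1)]), (3, [([AA 3, AI 1], 0),
      ([II 1, II 1], 0)]), (0, [([AI 1, AI 1], 0), ([AI 3, II 1], 0)]), (0, [([AI 1, II 1], -2),
      ([AI 4], 1)]), (2, [([AI 1, AI 1], 0), ([II 4], -1)])]"],
    code_simp, simp only: parts_simps known)

lemma [known]: "holds Impish [AI 1, II 9] 2"
  by (rule holdsI[where rs="
      [(2, [([II 2], 1), ([II 6], 1)]), (1, [([AI 1, AI 1], 0), ([II 6], 1)]), (1, [([AI 1,
      AI 1], 0), ([II 6], 1)]), (0, [([AI 1, AI 6, II 1], 1)]), (0, [([AI 1, AI 5], 0),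
      ([II 2], 1)]), (8, [([AI 4], 1), ([AI 4], 1)])]"],
    code_simp, simp only: parts_simps known)

lemma [known]: "holds Impish [II 1, II 7] 2"
  by (rule holdsI[where rs="
      [(0, [([II 6], 1)]), (1, [([AI 1, II 1, II 4], 1)]), (1, [([AI 1, II 1, II 4], 1)]),
      (0, [([II 1, II 1], 0), ([AI 4], 1)]), (0, [([AI 3, II 1], 0), ([II 2], 1)])]"],
    code_simp, simp only: parts_simps known)

lemma [known]: "holds Impish [AA 1, AI 3] 0"
  by (rule holdsI[where rs="
      [(0, [([II 2], 1)]), (2, [([AI 2], -1)]), (0, [([AA 1, AI 1], -2)]), (2, [([AA 2], 1)])]"],
    code_simp, simp only: parts_simps known)

lemma [known]: "holds Impish [AI 7, II 1] 0"
  by (rule holdsI[where rs="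
      [(1, [([AI 1, II 1, II 4], 1)]), (4, [([AA 1, AI 3], 0), ([II 1, II 1], 0)]),
      (6, [([AA 2], 1), ([AI 4], 1)]), (0, [([AI 3, II 1], 0), ([AI 2], -1)]), (4, [([II 1,
      II 1], 0), ([AA 4], -1)]), (0, [([AI 1, II 1], -2), ([AI 4], 1)]), (1, [([AI 1, II 1], -2),
      ([AI 4], 1)]), (0, [([II 6], 1)])]"],
    code_simp, simp only: parts_simps known)

lemma [known]: "holds Impish [AA 1, AA 1] 0"
  by (rule holdsI[where rs="
      [(0, [])]"],
    code_simp, simp only: parts_simps known)

lemma [known]: "holds Impish [AA 3, II 1, II 4] 1"
  by (rule holdsI[where rs="
      [(0, [([AI 1, II 1, II 4], 1)]), (4, [([AA 1, AA 1], 0), ([II 1, II 1], 0), ([II 2], 1)]),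
      (0, [([AI 2], -1), ([II 4], -1)]), (3, [([AI 3, II 1], 0), ([AI 2], -1)]), (1, [([AA 3,
      AI 1], 0), ([II 1, II 1], 0)])]"],
    code_simp, simp only: parts_simps known)

lemma [known]: "holds Impish [AA 6] 1"
  by (rule holdsI[where rs="
      [(0, [([AI 4], 1)]), (0, [([AA 4], -1)]), (0, [([AA 3, AI 1], 0)])]"],
    code_simp, simp only: parts_simps known)

lemma [known]: "holds Impish [AI 9, II 1] 2"
  by (rule holdsI[where rs="
      [(0, [([II 1, II 7], 2)]), (0, [([AI 7, II 1], 0)]), (0, [([AI 1, AI 6, II 1], 1)]),
      (3, [([AA 3, II 1, II 4], 1)]), (0, [([AI 3, II 1], 0), ([AI 4], 1)]), (0, [([AI 3,
      II 1], 0), ([AI 4], 1)]), (6, [([II 1, II 1], 0), ([AA 6], 1)]), (0, [([AI 1, AI 6,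
      II 1], 1)]), (0, [([AI 7, II 1], 0)]), (2, [([AI 2], -1), ([II 6], 1)])]"],
    code_simp, simp only: parts_simps known)

lemma [known]: "holds Impish [AI 8] 1"
  by (rule holdsI[where rs="
      [(0, [([II 6], 1)]), (1, [([AA 1, II 5], 0)]), (0, [([AI 1, AI 5], 0)]), (0, [([AI 2], -1),
      ([AI 4], 1)]), (4, [([II 2], 1), ([AA 4], -1)]), (0, [([AI 2], -1), ([AI 4], 1)]),
      (6, [([AA 6], 1)]), (1, [([AI 1, AI 5], 0)])]"],
    code_simp, simp only: parts_simps known)

text \<open>This arises from \<open>[AI 14]\<close> when Admirable labels the vertex next to her own
  label and Impish the one after it: the two edges settled by this cancel, so the full 3 is needed
  here.\<close>

lemma [known]: "holds Impish [II 12] 3"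
  by (rule holdsI[where rs="
      [(5, [([AI 5, II 5], 2)]), (1, [([AI 1, II 9], 2)]), (0, [([AI 9, II 1], 2)]),
      (0, [([II 2], 1), ([AI 8], 1)]), (4, [([AI 4], 1), ([II 6], 1)]), (5, [([AI 5, II 5], 2)])]"],
    code_simp, simp only: parts_simps known)

lemma [known]: "holds Impish [AA 3, II 1] (-2)"
  by (rule holdsI[where rs="
      [(2, [([AA 2], 1)]), (2, [([AA 1, AA 1], 0)]), (0, [([AI 2], -1)])]"],
    code_simp, simp only: parts_simps known)

lemma [known]: "holds Impish [AA 5, II 1] 0"
  by (rule holdsI[where rs="
      [(0, [([AI 3, II 1], 0)]), (0, [([AA 3, II 1], -2)]), (4, [([AA 2], 1), ([AA 2], 1)]),
      (0, [([AI 4], 1)])]"],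
    code_simp, simp only: parts_simps known)

lemma [known]: "holds Impish [AI 3, AI 3] 0"
  by (rule holdsI[where rs="
      [(0, [([AI 3, II 1], 0)]), (1, [([AA 1, AI 3], 0)]), (2, [([AA 2], 1), ([II 2], 1)])]"],
    code_simp, simp only: parts_simps known)

lemma [known]: "holds Impish [AI 12] 1"
  by (rule holdsI[where rs="
      [(1, [([AI 1, II 9], 2)]), (4, [([AA 1, AI 3], 0), ([II 6], 1)]), (4, [([AA 2], 1),
      ([AI 2], -1), ([II 6], 1)]), (0, [([AI 2], -1), ([AI 8], 1)]), (4, [([AA 4], -1),
      ([II 6], 1)]), (9, [([AA 5, II 1], 0), ([AI 4], 1)]), (6, [([II 4], -1), ([AA 6], 1)]),
      (1, [([AI 1, AI 5], 0), ([AI 4], 1)]), (3, [([AI 3, AI 3], 0), ([AI 4], 1)]),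
      (0, [([AI 2], -1), ([AI 8], 1)]), (1, [([AI 1, AI 1], 0), ([AI 8], 1)]), (2, [([AI 2], -1),
      ([AI 8], 1)])]"],
    code_simp, simp only: parts_simps known)

lemma [known]: "holds Impish [AA 3, AI 2, AI 2, II 1] 0"
  by (rule holdsI[where rs="
      [(0, [([AI 1, AI 2, AI 2, II 1], 0)]), (2, [([AA 1, AA 1], 0), ([II 1, II 1], 0),
      ([AI 2], -1)]), (4, [([AA 3, AI 1], 0), ([II 1, II 1], 0)]), (0, [([AA 3, II 1], -2),
      ([AI 2], -1)]), (3, [([AA 3, II 1], -2), ([AI 2], -1)])]"],
    code_simp, simp only: parts_simps known)

lemma [known]: "holds Impish [AA 3, AI 2, II 5] 1"
  by (rule holdsI[where rs="
      [(6, [([AA 2], 1), ([AI 2], -1), ([II 2], 1), ([II 2], 1)]), (0, [([AA 1, II 5], 0),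
      ([AI 2], -1)]), (6, [([AA 3, AI 1], 0), ([II 2], 1), ([II 2], 1)]), (1, [([AA 1, II 5], 0),
      ([AI 2], -1)]), (7, [([AA 3, II 1], -2), ([AI 4], 1)]), (7, [([AA 3, AI 1], 0), ([AI 3,
      II 1], 0)]), (0, [([AA 3, AI 2, AI 2, II 1], 0)])]"],
    code_simp, simp only: parts_simps known)

lemma [known]: "holds Impish [AA 3, AI 5] 0"
  by (rule holdsI[where rs="
      [(0, [([AI 1, AI 5], 0)]), (2, [([AA 1, AA 1], 0), ([II 4], -1)]), (4, [([AI 2], -1),
      ([AI 4], 1)]), (4, [([AA 1, AI 3], 0), ([AI 2], -1)]), (0, [([AA 3, AI 1], 0),
      ([AI 2], -1)]), (0, [([AA 3, AI 1], 0), ([AI 2], -1)]), (4, [([AI 2], -1), ([AA 4], -1)])]"],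
    code_simp, simp only: parts_simps known)

lemma [known]: "holds Impish [AA 3, II 9] 2"
  by (rule holdsI[where rs="
      [(0, [([AI 1, II 9], 2)]), (3, [([AA 1, AA 1], 0), ([II 1, II 7], 2)]), (8, [([AI 2], -1),
      ([AI 8], 1)]), (1, [([AA 3, AI 1], 0), ([II 6], 1)]), (2, [([AA 3, AI 2, II 5], 1)]),
      (0, [([II 2], 1), ([AA 3, AI 5], 0)]), (8, [([AI 2], -1), ([AI 4], 1), ([AI 4], 1)])]"],
    code_simp, simp only: parts_simps known)

lemma [known]: "holds Impish [AI 1, AI 9] 0"
  by (rule holdsI[where rs="
      [(2, [([AI 2], -1), ([II 6], 1)]), (8, [([AI 8], 1)]), (1, [([AA 1, AI 1], -2),
      ([II 6], 1)]), (3, [([AI 1, AI 1], 0), ([AA 2], 1), ([II 4], -1)]), (8, [([AA 3,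
      AI 5], 0)]), (8, [([AA 4], -1), ([AI 4], 1)]), (6, [([AI 1, AI 1], 0), ([AA 5, II 1], 0)]),
      (8, [([AI 2], -1), ([AA 6], 1)]), (1, [([AI 1, AI 1], 0), ([AI 1, AI 5], 0)]), (2, [([AI 1,
      AI 5], 0), ([AI 2], -1)])]"],
    code_simp, simp only: parts_simps known)

lemma [known]: "holds Impish [AA 7, AI 1] 0"
  by (rule holdsI[where rs="
      [(6, [([AA 6], 1)]), (1, [([AA 1, AI 1], -2), ([AI 4], 1)]), (6, [([AA 2], 1),
      ([AA 4], -1)]), (0, [([AA 3, AI 1], 0), ([AI 2], -1)]), (1, [([AI 1, AI 5], 0)])]"],
    code_simp, simp only: parts_simps known)

lemma [known]: "holds Impish [AI 3, AI 9] 2"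
  by (rule holdsI[where rs="
      [(0, [([AI 9, II 1], 2)]), (0, [([AI 1, AI 9], 0)]), (0, [([AI 1, AI 9], 0)]),
      (8, [([II 2], 1), ([AI 8], 1)]), (1, [([AA 1, AI 3], 0), ([II 6], 1)]), (9, [([AI 1, AI 6,
      II 1], 1), ([AA 2], 1)]), (8, [([II 2], 1), ([AA 3, AI 5], 0)]), (8, [([II 2], 1),
      ([AA 4], -1), ([AI 4], 1)]), (0, [([AI 3, AI 3], 0), ([AI 4], 1)]), (6, [([AI 3, II 1], 0),
      ([AA 6], 1)]), (8, [([AA 7, AI 1], 0), ([II 2], 1)]), (3, [([AI 3, AI 3], 0), ([AI 4], 1)])]"],
    code_simp, simp only: parts_simps known)

lemma [known]: "holds Impish [AA 7, AI 2, II 1] 1"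
  by (rule holdsI[where rs="
      [(6, [([II 1, II 1], 0), ([AA 6], 1)]), (0, [([AA 5, II 1], 0), ([AI 2], -1)]), (6, [([II 1,
      II 1], 0), ([AA 2], 1), ([AA 4], -1)]), (0, [([AA 3, AI 2, AI 2, II 1], 0)]), (1, [([AI 1,
      AI 6, II 1], 1)]), (4, [([AA 1, AI 3], 0), ([AI 3, II 1], 0)]), (8, [([AA 7, AI 1], 0)])]"],
    code_simp, simp only: parts_simps known)

lemma [known]: "holds Impish [AA 7, II 5] 2"
  by (rule holdsI[where rs="
      [(8, [([II 2], 1), ([II 2], 1), ([AA 6], 1)]), (1, [([AA 1, II 5], 0), ([AI 4], 1)]),
      (8, [([AA 2], 1), ([II 2], 1), ([II 2], 1), ([AA 4], -1)]), (0, [([AA 3, AI 2, II 5], 1)]),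
      (1, [([AA 7, AI 1], 0), ([II 2], 1)]), (1, [([AA 7, AI 1], 0), ([II 2], 1)]), (0, [([AA 7,
      AI 2, II 1], 1)])]"],
    code_simp, simp only: parts_simps known)

lemma [known]: "holds Impish [AI 5, AI 5] 0"
  by (rule holdsI[where rs="
      [(1, [([AI 1, AI 5], 0), ([II 2], 1)]), (4, [([AA 1, AI 3], 0), ([II 4], -1)]), (0, [([AI 1,
      AI 5], 0), ([AI 2], -1)]), (3, [([AA 3, AI 5], 0)]), (1, [([AI 1, AI 5], 0), ([AI 2], -1)])]"],
    code_simp, simp only: parts_simps known)

lemma [known]: "holds Impish [AI 2, AI 3, AI 5] 1"
  by (rule holdsI[where rs="
      [(1, [([AI 1, AI 5], 0), ([II 2], 1)]), (4, [([AA 1, AI 3], 0), ([II 4], -1)]), (4, [([AI 2,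
      AI 2, II 4], 1)]), (0, [([AI 1, AI 5], 0), ([AI 2], -1)]), (0, [([AI 1, AI 5], 0),
      ([AI 2], -1)]), (4, [([AI 3, II 1], 0), ([AI 4], 1)]), (0, [([AI 2], -1), ([AI 3,
      AI 3], 0)]), (2, [([AI 3, II 1], 0), ([AA 2], 1), ([AI 2], -1)]), (4, [([AA 3, AI 1], 0),
      ([AI 3, II 1], 0)]), (4, [([AI 3, II 1], 0), ([AA 4], -1)])]"],
    code_simp, simp only: parts_simps known)

lemma [known]: "holds Impish [AI 5, AI 7] 2"
  by (rule holdsI[where rs="
      [(4, [([AI 4], 1), ([II 6], 1)]), (4, [([AA 1, AI 3], 0), ([II 6], 1)]), (2, [([AI 7,
      II 1], 0), ([AA 2], 1)]), (4, [([AA 3, AI 1], 0), ([II 6], 1)]), (4, [([AA 4], -1),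
      ([II 6], 1)]), (0, [([AI 5, II 5], 2)]), (0, [([AI 5, AI 5], 0)]), (0, [([AI 1, AI 5], 0),
      ([AI 4], 1)]), (3, [([II 2], 1), ([AA 3, AI 5], 0)]), (0, [([AI 2, AI 3, AI 5], 1)]),
      (0, [([AI 1, AI 5], 0), ([AI 4], 1)]), (6, [([II 4], -1), ([AA 6], 1)])]"],
    code_simp, simp only: parts_simps known)

lemma [known]: "holds Impish [AA 9, II 1] 0"
  by (rule holdsI[where rs="
      [(0, [([AI 7, II 1], 0)]), (4, [([AA 1, AI 3], 0), ([AI 3, II 1], 0)]), (8, [([AA 2], 1),
      ([AA 6], 1)]), (0, [([AA 5, II 1], 0), ([AI 2], -1)]), (0, [([AI 3, II 1], 0),
      ([AA 4], -1)]), (0, [([AI 8], 1)])]"],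
    code_simp, simp only: parts_simps known)

lemma [known]: "holds Impish [AA 11, II 1] 2"
  by (rule holdsI[where rs="
      [(0, [([AI 9, II 1], 2)]), (0, [([AA 9, II 1], 0)]), (2, [([AI 7, II 1], 0), ([AA 2], 1)]),
      (0, [([AA 7, AI 2, II 1], 1)]), (0, [([AI 3, II 1], 0), ([AA 6], 1)]), (0, [([AA 5,
      II 1], 0), ([AI 4], 1)]), (1, [([AI 1, AI 9], 0)])]"],
    code_simp, simp only: parts_simps known)

lemma [known]: "holds Impish [AI 1, AI 2, AI 2, AI 3] 0"
  by (rule holdsI[where rs="
      [(0, [([AI 3, II 1], 0), ([AI 2], -1)]), (2, [([AI 1, AI 1], 0), ([AI 3, II 1], 0)]),
      (1, [([AA 1, AI 3], 0), ([AI 2], -1)]), (0, [([AI 1, AI 2, AI 2, II 1], 0)]), (0, [([AI 1,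
      AI 1], 0), ([AI 2], -1), ([AI 2], -1)]), (2, [([AA 2], 1), ([AI 2], -1), ([AI 2], -1)])]"],
    code_simp, simp only: parts_simps known)

lemma [known]: "holds Impish [AA 4, AI 1, II 5] 1"
  by (rule holdsI[where rs="
      [(6, [([AA 3, AI 1], 0), ([II 2], 1), ([II 2], 1)]), (3, [([AA 1, II 5], 0), ([AA 2], 1)]),
      (6, [([II 2], 1), ([II 2], 1), ([AA 4], -1)]), (8, [([AA 4], -1), ([AI 4], 1)]),
      (1, [([AI 1, AI 1], 0), ([II 2], 1), ([AA 4], -1)]), (4, [([AI 1, AI 2, AI 2, AI 3], 0)])]"],
    code_simp, simp only: parts_simps known)

lemma [known]: "holds Impish [AA 8, AI 1, II 1] 1"
  by (rule holdsI[where rs="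
      [(0, [([AI 1, AI 6, II 1], 1)]), (0, [([AI 1, II 1], -2), ([AA 6], 1)]), (7, [([AA 5,
      II 1], 0), ([AA 2], 1)]), (3, [([AA 3, AI 1], 0), ([AI 3, II 1], 0)]), (0, [([AI 7,
      II 1], 0)]), (2, [([AI 1, AI 5], 0), ([AI 2], -1)])]"],
    code_simp, simp only: parts_simps known)

lemma [known]: "holds Impish [AI 1, AI 11] 2"
  by (rule holdsI[where rs="
      [(1, [([AI 1, II 9], 2)]), (0, [([AI 1, II 9], 2)]), (0, [([AI 1, AI 9], 0)]),
      (10, [([AA 2], 1), ([AI 8], 1)]), (3, [([AA 3, AI 1], 0), ([II 6], 1)]), (4, [([AA 4, AI 1,
      II 5], 1)]), (0, [([AI 1, AI 5], 0), ([AI 4], 1)]), (10, [([AI 4], 1), ([AA 6], 1)]),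
      (7, [([AA 7, AI 1], 0), ([II 2], 1)]), (8, [([AA 8, AI 1, II 1], 1)]), (0, [([AI 1,
      AI 1], 0), ([AI 8], 1)]), (0, [([AI 1, AI 9], 0)])]"],
    code_simp, simp only: parts_simps known)

text \<open>On 16 vertices, Admirable has opened at one end and Impish has taken the other.\<close>

lemma [known]: "holds Impish [AI 14] 3"
  by (rule holdsI[where rs="
      [(0, [([II 12], 3)]), (0, [([AI 12], 1)]), (3, [([AI 1, II 9], 2), ([AA 2], 1)]),
      (3, [([AA 3, II 9], 2)]), (0, [([AI 3, AI 9], 2)]), (0, [([AI 4], 1), ([AI 8], 1)]),
      (6, [([AA 6], 1), ([II 6], 1)]), (7, [([AA 7, II 5], 2)]), (0, [([AI 5, AI 7], 2)]),
      (0, [([AI 4], 1), ([AI 8], 1)]), (0, [([AI 3, AI 9], 2)]), (11, [([AA 11, II 1], 2)]),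
      (0, [([AI 1, AI 11], 2)]), (0, [([AI 12], 1)])]"],
    code_simp, simp only: parts_simps known)

section \<open>Runs that reach an end of the path\<close>

lemma [known]: "holds Impish [AI 1, AE 1] (-1)"
  by (rule holdsI[where rs="
      [(0, []), (0, [])]"],
    code_simp, simp only: parts_simps known)

lemma [known]: "holds Impish [AE 1, IE 3] 0"
  by (rule holdsI[where rs="
      [(2, [([II 2], 1)]), (1, [([AI 1, AE 1], -1)]), (1, [([AI 1, AE 1], -1)]),
      (2, [([AI 2], -1)])]"],
    code_simp, simp only: parts_simps known)

lemma [known]: "holds Impish [IE 2] 0"
  by (rule holdsI[where rs="
      [(0, []), (0, [])]"],
    code_simp, simp only: parts_simps known)

lemma [known]: "holds Impish [II 1, IE 1] (-1)"
  by (rule holdsI[where rs="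
      [(0, []), (0, [])]"],
    code_simp, simp only: parts_simps known)

lemma [known]: "holds Impish [AI 1, AI 2, AI 2, IE 1] (-1)"
  by (rule holdsI[where rs="
      [(0, [([II 1, IE 1], -1), ([AI 2], -1)]), (2, [([AI 1, AI 1], 0), ([II 1, IE 1], -1)]),
      (2, [([AA 1, AI 1], -2), ([II 1, IE 1], -1)]), (0, [([AI 2], -1), ([AI 2], -1)])]"],
    code_simp, simp only: parts_simps known)

lemma [known]: "holds Impish [AI 1, AI 2, IE 5] 0"
  by (rule holdsI[where rs="
      [(4, [([AI 2], -1), ([II 2], 1), ([IE 2], 0)]), (4, [([AI 1, AI 1], 0), ([II 2], 1),
      ([IE 2], 0)]), (4, [([AA 1, AI 1], -2), ([II 2], 1), ([IE 2], 0)]), (1, [([AI 1, AI 1], 0),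
      ([AI 2], -1), ([IE 2], 0)]), (1, [([AI 1, AI 1], 0), ([AI 2], -1), ([IE 2], 0)]),
      (2, [([AI 1, AI 2, AI 2, IE 1], -1)]), (5, [([AI 1, AE 1], -1), ([AI 3, II 1], 0)]),
      (4, [([AI 2], -1), ([AI 4], 1)])]"],
    code_simp, simp only: parts_simps known)

lemma [known]: "holds Impish [AI 1, AE 5] (-1)"
  by (rule holdsI[where rs="
      [(2, [([AI 2], -1), ([IE 2], 0)]), (1, [([AI 1, AI 1], 0), ([IE 2], 0)]), (1, [([AA 1,
      AI 1], -2), ([IE 2], 0)]), (3, [([AI 1, AI 1], 0), ([AA 2], 1)]), (3, [([AA 3, AI 1], 0)]),
      (4, [([AA 4], -1)])]"],
    code_simp, simp only: parts_simps known)

lemma [known]: "holds Impish [AI 1, IE 1] (-1)"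
  by (rule holdsI[where rs="
      [(0, []), (0, [])]"],
    code_simp, simp only: parts_simps known)

lemma [known]: "holds Impish [AI 3, IE 1] (-1)"
  by (rule holdsI[where rs="
      [(0, [([II 1, IE 1], -1)]), (0, [([AI 1, IE 1], -1)]), (2, [([AA 2], 1)]),
      (0, [([II 2], 1)])]"],
    code_simp, simp only: parts_simps known)

lemma [known]: "holds Impish [AA 4, AI 1, AI 2, IE 1] (-1)"
  by (rule holdsI[where rs="
      [(4, [([AA 3, AI 1], 0), ([II 1, IE 1], -1)]), (0, [([AI 1, IE 1], -1), ([AA 2], 1),
      ([AI 2], -1)]), (4, [([II 1, IE 1], -1), ([AA 4], -1)]), (1, [([AI 1, AI 1], 0), ([AI 3,
      IE 1], -1)]), (0, [([AI 1, IE 1], -1), ([AA 4], -1)]), (4, [([AI 2], -1), ([AA 4], -1)])]"],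
    code_simp, simp only: parts_simps known)

lemma [known]: "holds Impish [AI 1, AI 2, AE 7] 0"
  by (rule holdsI[where rs="
      [(6, [([AI 2], -1), ([IE 2], 0), ([AI 4], 1)]), (6, [([AI 1, AI 1], 0), ([IE 2], 0),
      ([AI 4], 1)]), (6, [([AA 1, AI 1], -2), ([IE 2], 0), ([AI 4], 1)]), (0, [([AI 1, AI 2,
      IE 5], 0)]), (0, [([AI 1, AE 5], -1), ([AI 2], -1)]), (3, [([AI 1, AI 1], 0), ([AA 2], 1),
      ([AI 2], -1), ([IE 2], 0)]), (3, [([AA 3, AI 1], 0), ([AI 2], -1), ([IE 2], 0)]),
      (4, [([AA 4, AI 1, AI 2, IE 1], -1)]), (7, [([AI 1, AE 1], -1), ([AA 5, II 1], 0)]),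
      (6, [([AI 2], -1), ([AA 6], 1)])]"],
    code_simp, simp only: parts_simps known)

lemma [known]: "holds Impish [AE 6] 0"
  by (rule holdsI[where rs="
      [(4, [([AI 4], 1)]), (4, [([AA 1, AI 3], 0)]), (2, [([AA 2], 1), ([IE 2], 0)]), (4, [([AA 3,
      AI 1], 0)]), (4, [([AA 4], -1)]), (0, [([AI 4], 1)])]"],
    code_simp, simp only: parts_simps known)

lemma [known]: "holds Impish [AE 2] 0"
  by (rule holdsI[where rs="
      [(0, []), (0, [])]"],
    code_simp, simp only: parts_simps known)

lemma [known]: "holds Impish [AA 1, AE 1] (-1)"
  by (rule holdsI[where rs="
      [(0, []), (0, [])]"],
    code_simp, simp only: parts_simps known)

lemma [known]: "holds Impish [AE 1, AE 3] 0"
  by (rule holdsI[where rs="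
      [(0, [([IE 2], 0)]), (2, [([AE 2], 0)]), (1, [([AA 1, AE 1], -1)]), (2, [([AA 2], 1)])]"],
    code_simp, simp only: parts_simps known)

lemma [known]: "holds Impish [AI 1, AE 3] (-1)"
  by (rule holdsI[where rs="
      [(0, [([IE 2], 0)]), (2, [([AE 2], 0)]), (0, [([AI 1, AE 1], -1)]), (2, [([AA 2], 1)])]"],
    code_simp, simp only: parts_simps known)

lemma [known]: "holds Impish [AI 1, AI 2, AI 2, AE 1, IE 2] (-1)"
  by (rule holdsI[where rs="
      [(4, [([AI 2], -1), ([AI 2], -1), ([IE 2], 0)]), (4, [([AI 1, AI 1], 0), ([AI 2], -1),
      ([IE 2], 0)]), (0, [([AI 1, AE 1], -1), ([AI 2], -1), ([IE 2], 0)]), (6, [([AI 1, AI 2,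
      AI 2, II 1], 0)]), (0, [([AI 1, AE 1], -1), ([AI 2], -1), ([AI 2], -1)]), (6, [([AI 1,
      AI 1], 0), ([AI 2], -1), ([AI 2], -1)])]"],
    code_simp, simp only: parts_simps known)

lemma [known]: "holds Impish [AI 1, AE 1, AE 3, II 5] 0"
  by (rule holdsI[where rs="
      [(6, [([AE 1, AE 3], 0), ([II 2], 1), ([II 2], 1)]), (6, [([AI 1, AE 3], -1), ([II 2], 1),
      ([II 2], 1)]), (6, [([AI 1, AE 1], -1), ([AE 2], 0), ([II 2], 1), ([II 2], 1)]),
      (1, [([AA 1, II 5], 0), ([AI 1, AE 1], -1)]), (6, [([AI 1, AE 1], -1), ([AA 2], 1),
      ([II 2], 1), ([II 2], 1)]), (4, [([AE 1, AE 3], 0), ([AI 4], 1)]), (1, [([AI 1, AI 1], 0),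
      ([AE 1, AE 3], 0), ([II 2], 1)]), (6, [([AI 1, AI 2, AI 2, AE 1, IE 2], -1)])]"],
    code_simp, simp only: parts_simps known)

lemma [known]: "holds Impish [AI 1, AE 1, IE 10] 1"
  by (rule holdsI[where rs="
      [(7, [([AE 1, IE 3], 0), ([II 6], 1)]), (10, [([AI 1, II 9], 2)]), (5, [([AI 1, AI 5], 0),
      ([AE 1, IE 3], 0)]), (5, [([AI 1, AI 1], 0), ([AE 1, IE 3], 0), ([AI 4], 1)]), (10, [([AI 1,
      AI 2, AE 7], 0)]), (0, [([AI 1, AE 1], -1), ([II 2], 1), ([AE 6], 0)]), (10, [([AI 1,
      AE 5], -1), ([AI 4], 1)]), (5, [([AI 1, AI 5], 0), ([AE 1, IE 3], 0)]), (0, [([AI 1, AE 1,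
      AE 3, II 5], 0)]), (0, [([AI 1, AE 1], -1), ([AE 2], 0), ([II 6], 1)]), (8, [([AI 1,
      AE 1], -1), ([AI 8], 1)]), (10, [([AI 1, AI 9], 0)])]"],
    code_simp, simp only: parts_simps known)

lemma [known]: "holds Impish [AE 1, IE 1] (-2)"
  by (rule holdsI[where rs="
      [(0, []), (0, [])]"],
    code_simp, simp only: parts_simps known)

lemma [known]: "holds Impish [AE 1, II 1] (-3)"
  by (rule holdsI[where rs="
      [(0, []), (0, [])]"],
    code_simp, simp only: parts_simps known)

lemma [known]: "holds Impish [AE 3, II 1] (-1)"
  by (rule holdsI[where rs="
      [(0, [([II 1, IE 1], -1)]), (0, [([AE 1, II 1], -3)]), (2, [([AA 2], 1)]),
      (0, [([IE 2], 0)])]"],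
    code_simp, simp only: parts_simps known)

lemma [known]: "holds Impish [AI 1, AE 1, II 1, IE 5] 0"
  by (rule holdsI[where rs="
      [(3, [([AE 1, IE 3], 0), ([II 1, II 1], 0)]), (6, [([AI 1, II 1, II 4], 1)]), (4, [([AI 1,
      AE 1], -1), ([II 2], 1), ([IE 2], 0)]), (3, [([AI 1, AE 1], -1), ([AI 3, II 1], 0)]),
      (5, [([AI 1, AI 1], 0), ([AE 3, II 1], -1)]), (0, [([AI 1, AE 1], -1), ([II 1, II 1], 0),
      ([AE 2], 0)]), (3, [([AI 1, AE 1], -1), ([AI 3, II 1], 0)]), (5, [([AI 1, II 1], -2),
      ([AI 4], 1)])]"],
    code_simp, simp only: parts_simps known)

text \<open>Each player takes one of the two end vertices, for -1 and 1. These are the leftovers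
  when an opening has an odd number of free vertices on both sides.\<close>

lemma Impish_AE1_AE1 [known]: "holds Impish [AE 1, AE 1] 0"
  by (rule holdsI[where rs="
      [(0, [])]"],
    code_simp, simp only: parts_simps known)

lemma [known]: "holds Impish [AE 1, AE 5] 0"
  by (rule holdsI[where rs="
      [(4, [([AI 4], 1)]), (0, [([AE 1, IE 3], 0)]), (0, [([AE 1, AE 3], 0)]), (4, [([AA 2], 1),
      ([AE 2], 0)]), (1, [([AI 1, AI 1], 0), ([AE 1, AE 1], 0)]), (4, [([AA 4], -1)])]"],
    code_simp, simp only: parts_simps known)

lemma [known]: "holds Impish [AE 1, II 1, II 4] 0"
  by (rule holdsI[where rs="
      [(2, [([II 1, II 1], 0), ([II 2], 1)]), (0, [([II 4], -1)]), (3, [([AI 3, II 1], 0)]),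
      (1, [([AI 1, AE 1], -1), ([II 1, II 1], 0)])]"],
    code_simp, simp only: parts_simps known)

lemma [known]: "holds Impish [AE 1, II 1, IE 8] 1"
  by (rule holdsI[where rs="
      [(8, [([II 1, II 7], 2)]), (5, [([AE 1, IE 3], 0), ([II 4], -1)]), (3, [([AE 1, IE 3], 0),
      ([AI 3, II 1], 0)]), (1, [([AI 1, AE 1, II 1, IE 5], 0)]), (0, [([AE 1, AE 5], 0), ([II 1,
      II 1], 0)]), (3, [([AE 1, IE 3], 0), ([AI 3, II 1], 0)]), (7, [([AE 3, II 1], -1),
      ([AI 4], 1)]), (0, [([AE 1, II 1, II 4], 0), ([AE 2], 0)]), (1, [([AI 1, II 1, II 4], 1),
      ([AE 1, AE 1], 0)]), (7, [([AI 7, II 1], 0)])]"],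
    code_simp, simp only: parts_simps known)

lemma [known]: "holds Impish [AI 1, II 1, IE 4] 0"
  by (rule holdsI[where rs="
      [(2, [([II 1, II 1], 0), ([IE 2], 0)]), (2, [([AI 1, II 1], -2), ([IE 2], 0)]), (3, [([AE 3,
      II 1], -1)]), (1, [([AI 1, AI 1], 0), ([II 1, IE 1], -1)]), (0, [([AI 1, AE 1], -1), ([II 1,
      II 1], 0)]), (3, [([AI 3, II 1], 0)])]"],
    code_simp, simp only: parts_simps known)

lemma [known]: "holds Impish [AE 4] 0"
  by (rule holdsI[where rs="
      [(0, [([IE 2], 0)]), (0, [([AE 2], 0)]), (2, [([AA 2], 1)]), (0, [([AI 2], -1)])]"],
    code_simp, simp only: parts_simps known)

lemma [known]: "holds Impish [II 1, IE 7] 1"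
  by (rule holdsI[where rs="
      [(4, [([IE 2], 0), ([II 4], -1)]), (3, [([AI 3, II 1], 0), ([IE 2], 0)]), (1, [([AI 1, II 1,
      IE 4], 0)]), (0, [([II 1, II 1], 0), ([AE 4], 0)]), (0, [([AE 3, II 1], -1), ([II 2], 1)]),
      (4, [([II 1, IE 1], -1), ([AI 4], 1)]), (0, [([AE 1, II 1, II 4], 0)]), (1, [([AI 1, II 1,
      II 4], 1)])]"],
    code_simp, simp only: parts_simps known)

lemma [known]: "holds Impish [AA 3, AE 1] (-1)"
  by (rule holdsI[where rs="
      [(2, [([AA 2], 1)]), (0, [([AA 1, AE 1], -1)]), (0, [([AI 2], -1)])]"],
    code_simp, simp only: parts_simps known)

lemma [known]: "holds Impish [AA 3, AE 1, II 1, IE 5] 0"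
  by (rule holdsI[where rs="
      [(0, [([AI 1, AE 1, II 1, IE 5], 0)]), (5, [([AA 1, AA 1], 0), ([AE 1, IE 3], 0), ([II 1,
      II 1], 0)]), (8, [([AA 3, II 1, II 4], 1)]), (6, [([AA 3, AE 1], -1), ([II 2], 1),
      ([IE 2], 0)]), (7, [([AA 3, II 1], -2), ([AE 4], 0)]), (7, [([AA 3, AI 1], 0), ([AE 3,
      II 1], -1)]), (0, [([AA 3, AE 1], -1), ([II 1, II 1], 0), ([AE 2], 0)]), (3, [([AA 3,
      AE 1], -1), ([AI 3, II 1], 0)]), (7, [([AA 3, II 1], -2), ([AI 4], 1)])]"],
    code_simp, simp only: parts_simps known)

lemma [known]: "holds Impish [AI 6, AE 1, II 1] 0"
  by (rule holdsI[where rs="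
      [(0, [([AE 1, II 1, II 4], 0)]), (0, [([AE 1, II 1], -3), ([AI 4], 1)]), (5, [([AI 3,
      II 1], 0), ([AA 2], 1)]), (3, [([AA 3, AE 1], -1), ([II 1, II 1], 0)]), (0, [([AI 1,
      AE 1], -1), ([AI 3, II 1], 0)]), (5, [([AA 5, II 1], 0)]), (1, [([AI 1, II 1, II 4], 1)]),
      (1, [([AI 1, AE 1], -1), ([II 4], -1)])]"],
    code_simp, simp only: parts_simps known)

lemma [known]: "holds Impish [AE 1, AE 10, II 1] 1"
  by (rule holdsI[where rs="
      [(9, [([AI 9, II 1], 2)]), (0, [([AE 1, II 1, IE 8], 1)]), (1, [([AA 1, AE 1], -1), ([II 1,
      IE 7], 1)]), (3, [([AI 1, AE 1, II 1, IE 5], 0), ([AA 2], 1)]), (3, [([AA 3, AE 1, II 1,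
      IE 5], 0)]), (0, [([AE 1, AE 5], 0), ([AI 3, II 1], 0)]), (9, [([AA 5, II 1], 0),
      ([AE 4], 0)]), (9, [([AE 3, II 1], -1), ([AA 6], 1)]), (0, [([AI 6, AE 1, II 1], 0),
      ([AE 2], 0)]), (0, [([AE 1, AE 1], 0), ([AI 7, II 1], 0)]), (9, [([AA 9, II 1], 0)]),
      (9, [([AE 1, IE 1], -2), ([AI 8], 1)])]"],
    code_simp, simp only: parts_simps known)

lemma [known]: "holds Impish [AI 3, AE 1] (-1)"
  by (rule holdsI[where rs="
      [(2, [([AI 2], -1)]), (0, [([AI 1, AE 1], -1)]), (2, [([AA 2], 1)]), (0, [([II 2], 1)])]"],
    code_simp, simp only: parts_simps known)

lemma [known]: "holds Impish [AE 1, AE 9] 0"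
  by (rule holdsI[where rs="
      [(8, [([AI 8], 1)]), (4, [([AE 1, IE 3], 0), ([AI 4], 1)]), (4, [([AA 1, AI 3], 0), ([AE 1,
      IE 3], 0)]), (8, [([AA 2], 1), ([AE 6], 0)]), (0, [([AE 1, AE 5], 0), ([AI 2], -1)]),
      (8, [([AA 4], -1), ([AE 4], 0)]), (0, [([AE 1, AE 3], 0), ([AI 4], 1)]), (8, [([AE 2], 0),
      ([AA 6], 1)]), (1, [([AI 1, AI 5], 0), ([AE 1, AE 1], 0)]), (3, [([AI 3, AE 1], -1),
      ([AI 4], 1)])]"],
    code_simp, simp only: parts_simps known)

lemma [known]: "holds Impish [AE 3, II 1, II 4] 0"
  by (rule holdsI[where rs="
      [(1, [([AI 1, II 1, II 4], 1)]), (0, [([AE 1, II 1, II 4], 0)]), (0, [([AI 1, II 1,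
      II 4], 1)]), (0, [([IE 2], 0), ([II 4], -1)]), (0, [([AE 3, II 1], -1), ([II 2], 1)]),
      (1, [([AI 1, AE 3], -1), ([II 1, II 1], 0)])]"],
    code_simp, simp only: parts_simps known)

lemma [known]: "holds Impish [AI 5, AE 1, AE 3, II 1] 0"
  by (rule holdsI[where rs="
      [(4, [([AE 3, II 1], -1), ([AI 4], 1)]), (0, [([AI 3, AE 1], -1), ([AE 3, II 1], -1)]),
      (4, [([AE 3, II 1], -1), ([AA 2], 1), ([AI 2], -1)]), (4, [([AA 3, AI 1], 0), ([AE 3,
      II 1], -1)]), (4, [([AE 3, II 1], -1), ([AA 4], -1)]), (0, [([AE 3, II 1, II 4], 0)]),
      (2, [([AE 1, II 1, II 4], 0), ([AE 2], 0)]), (2, [([AA 1, AE 1], -1), ([AE 1, II 1,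
      II 4], 0)]), (2, [([AE 1, II 1, II 4], 0), ([AA 2], 1)]), (0, [([AE 1, AE 3], 0),
      ([II 4], -1)])]"],
    code_simp, simp only: parts_simps known)

lemma [known]: "holds Impish [AI 5, AE 1] (-1)"
  by (rule holdsI[where rs="
      [(4, [([AI 4], 1)]), (0, [([AI 3, AE 1], -1)]), (4, [([AA 2], 1), ([AI 2], -1)]),
      (3, [([AA 3, AE 1], -1)]), (4, [([AA 4], -1)]), (0, [([II 4], -1)])]"],
    code_simp, simp only: parts_simps known)

lemma [known]: "holds Impish [AI 5, AE 1, IE 6] 1"
  by (rule holdsI[where rs="
      [(7, [([AE 1, IE 3], 0), ([II 2], 1), ([AI 4], 1)]), (7, [([AA 1, AI 3], 0), ([AE 1,
      IE 3], 0), ([II 2], 1)]), (7, [([AE 1, IE 3], 0), ([AA 2], 1), ([AI 2], -1), ([II 2], 1)]),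
      (7, [([AA 3, AI 1], 0), ([AE 1, IE 3], 0), ([II 2], 1)]), (7, [([AE 1, IE 3], 0),
      ([II 2], 1), ([AA 4], -1)]), (10, [([AI 5, II 5], 2)]), (5, [([AE 1, AE 5], 0),
      ([II 4], -1)]), (10, [([AI 1, AI 5], 0), ([AE 4], 0)]), (0, [([AI 5, AE 1, AE 3,
      II 1], 0)]), (0, [([AI 5, AE 1], -1), ([AE 2], 0), ([II 2], 1)]), (4, [([AI 5, AE 1], -1),
      ([AI 4], 1)]), (10, [([AI 5, AI 5], 0)])]"],
    code_simp, simp only: parts_simps known)

lemma [known]: "holds Impish [AI 2, AI 2, AE 1, II 1] (-1)"
  by (rule holdsI[where rs="
      [(1, [([AI 1, AE 1], -1), ([II 1, II 1], 0)]), (0, [([AE 1, II 1], -3), ([AI 2], -1)]),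
      (0, [([II 1, II 1], 0), ([AI 2], -1)]), (4, [([AI 2], -1), ([AI 2], -1)])]"],
    code_simp, simp only: parts_simps known)

lemma [known]: "holds Impish [AI 2, AI 2, AE 1, IE 5] 0"
  by (rule holdsI[where rs="
      [(3, [([AI 1, AI 2, IE 5], 0)]), (6, [([AA 1, AE 1], -1), ([AI 2], -1), ([II 2], 1),
      ([IE 2], 0)]), (8, [([AI 2, AI 2, II 4], 1)]), (8, [([AI 2], -1), ([AI 2], -1),
      ([AE 4], 0)]), (1, [([AI 1, AI 2, AI 2, AE 1, IE 2], -1)]), (0, [([AI 2, AI 2, AE 1,
      II 1], -1), ([AE 2], 0)]), (4, [([AE 1, AE 1], 0), ([AI 3, II 1], 0), ([AI 2], -1)]),
      (8, [([AI 2], -1), ([AI 2], -1), ([AI 4], 1)])]"],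
    code_simp, simp only: parts_simps known)

lemma [known]: "holds Impish [AE 1, II 5] (-1)"
  by (rule holdsI[where rs="
      [(2, [([II 2], 1), ([II 2], 1)]), (4, [([AI 4], 1)]), (0, [([AI 3, AE 1], -1)]),
      (4, [([AI 2], -1), ([AI 2], -1)])]"],
    code_simp, simp only: parts_simps known)

lemma [known]: "holds Impish [AE 1, AE 6, II 5] 1"
  by (rule holdsI[where rs="
      [(8, [([II 2], 1), ([II 2], 1), ([AE 6], 0)]), (8, [([AE 1, AE 5], 0), ([II 2], 1),
      ([II 2], 1)]), (5, [([AA 1, II 5], 0), ([AE 4], 0)]), (0, [([AI 1, AE 1, AE 3, II 5], 0)]),
      (8, [([AA 3, AE 1], -1), ([AE 2], 0), ([II 2], 1), ([II 2], 1)]), (8, [([AE 1, AE 1], 0),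
      ([II 2], 1), ([II 2], 1), ([AA 4], -1)]), (0, [([AE 1, II 5], -1), ([AI 4], 1)]),
      (4, [([AI 4], 1), ([AE 6], 0)]), (1, [([AI 1, AE 1], -1), ([II 2], 1), ([AE 6], 0)]),
      (5, [([AI 2, AI 2, AE 1, IE 5], 0)])]"],
    code_simp, simp only: parts_simps known)

lemma [known]: "holds Impish [AI 9, AE 1, IE 2] 1"
  by (rule holdsI[where rs="
      [(8, [([IE 2], 0), ([AI 8], 1)]), (1, [([AA 1, AE 1], -1), ([IE 2], 0), ([II 6], 1)]),
      (10, [([AI 6, AE 1, II 1], 0), ([AA 2], 1)]), (8, [([IE 2], 0), ([AA 3, AI 5], 0)]),
      (8, [([IE 2], 0), ([AA 4], -1), ([AI 4], 1)]), (0, [([AI 3, AE 1], -1), ([IE 2], 0),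
      ([AI 4], 1)]), (8, [([AI 2], -1), ([IE 2], 0), ([AA 6], 1)]), (8, [([AA 7, AI 1], 0),
      ([IE 2], 0)]), (3, [([AI 3, AE 1], -1), ([IE 2], 0), ([AI 4], 1)]), (10, [([AI 9,
      II 1], 2)]), (3, [([AE 1, AE 1], 0), ([AI 2], -1), ([II 6], 1)]), (10, [([AI 1, AI 9], 0)])]"],
    code_simp, simp only: parts_simps known)

lemma [known]: "holds Impish [AE 1, II 9] 1"
  by (rule holdsI[where rs="
      [(1, [([II 1, II 7], 2)]), (8, [([AI 8], 1)]), (1, [([AI 1, AE 1], -1), ([II 6], 1)]),
      (0, [([AI 6, AE 1, II 1], 0)]), (0, [([AI 5, AE 1], -1), ([II 2], 1)]), (8, [([AI 4], 1),
      ([AI 4], 1)])]"],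
    code_simp, simp only: parts_simps known)

text \<open>Admirable has opened at the second of 16 vertices and Impish has answered next to her on
  the long side. The runs 1 and 13 are odd, so neither has a guarantee of its own.\<close>

lemma [known]: "holds Impish [AE 1, IE 13] 2"
  by (rule holdsI[where rs="
      [(12, [([II 12], 3)]), (8, [([AE 1, IE 3], 0), ([AI 8], 1)]), (1, [([AI 1, AE 1,
      IE 10], 1)]), (0, [([AE 1, AE 10, II 1], 1)]), (0, [([AE 1, AE 9], 0), ([II 2], 1)]),
      (8, [([AE 1, IE 3], 0), ([AI 4], 1), ([AI 4], 1)]), (5, [([AI 5, AE 1, IE 6], 1)]),
      (0, [([AE 1, AE 6, II 5], 1)]), (0, [([AE 1, AE 5], 0), ([II 6], 1)]), (12, [([AE 4], 0),
      ([AI 8], 1)]), (9, [([AI 9, AE 1, IE 2], 1)]), (0, [([AE 1, II 9], 1), ([AE 2], 0)]),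
      (1, [([AI 1, II 9], 2), ([AE 1, AE 1], 0)]), (12, [([AI 12], 1)])]"],
    code_simp, simp only: parts_simps known)

lemma [known]: "holds Impish [AI 1, II 4, IE 1] 0"
  by (rule holdsI[where rs="
      [(1, [([II 1, IE 1], -1), ([II 2], 1)]), (3, [([AI 3, IE 1], -1)]), (1, [([AI 1, AI 1], 0),
      ([II 1, IE 1], -1)]), (0, [([II 4], -1)])]"],
    code_simp, simp only: parts_simps known)

lemma [known]: "holds Impish [AI 1, AI 6, IE 1] 0"
  by (rule holdsI[where rs="
      [(3, [([AI 3, IE 1], -1), ([II 2], 1)]), (0, [([AI 1, II 4, IE 1], 0)]), (0, [([AI 1,
      IE 1], -1), ([AI 4], 1)]), (5, [([AI 3, IE 1], -1), ([AA 2], 1)]), (3, [([AA 3, AI 1], 0),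
      ([II 1, IE 1], -1)]), (0, [([AI 1, AI 1], 0), ([AI 3, IE 1], -1)]), (0, [([AI 1, IE 1], -1),
      ([AI 4], 1)]), (2, [([AI 1, AI 1], 0), ([II 4], -1)])]"],
    code_simp, simp only: parts_simps known)

lemma [known]: "holds Impish [AI 1, IE 9] 1"
  by (rule holdsI[where rs="
      [(1, [([II 1, IE 7], 1)]), (2, [([AI 1, AI 2, IE 5], 0)]), (5, [([AI 1, AI 1], 0),
      ([IE 2], 0), ([AI 4], 1)]), (2, [([AI 1, AI 2, IE 5], 0)]), (0, [([AI 1, AE 5], -1),
      ([II 2], 1)]), (8, [([AI 4], 1), ([AE 4], 0)]), (5, [([AI 1, AI 5], 0), ([IE 2], 0)]),
      (6, [([AI 1, AI 6, IE 1], 0)]), (0, [([AI 1, AE 1], -1), ([II 6], 1)]), (8, [([AI 8], 1)])]"],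
    code_simp, simp only: parts_simps known)

lemma [known]: "holds Impish [AE 7, II 1] (-1)"
  by (rule holdsI[where rs="
      [(1, [([AI 1, II 1, IE 4], 0)]), (4, [([AA 1, AI 3], 0), ([II 1, IE 1], -1)]),
      (6, [([AA 2], 1), ([AE 4], 0)]), (0, [([AE 3, II 1], -1), ([AI 2], -1)]), (4, [([II 1,
      IE 1], -1), ([AA 4], -1)]), (5, [([AA 5, II 1], 0)]), (6, [([AA 6], 1)]), (4, [([IE 2], 0),
      ([AI 4], 1)])]"],
    code_simp, simp only: parts_simps known)

lemma [known]: "holds Impish [AA 3, II 1, IE 4] 0"
  by (rule holdsI[where rs="
      [(0, [([AI 1, II 1, IE 4], 0)]), (4, [([AA 1, AA 1], 0), ([II 1, II 1], 0), ([IE 2], 0)]),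
      (4, [([AA 3, II 1], -2), ([IE 2], 0)]), (3, [([AE 3, II 1], -1), ([AI 2], -1)]),
      (1, [([AA 3, AI 1], 0), ([II 1, IE 1], -1)]), (0, [([AA 3, AE 1], -1), ([II 1, II 1], 0)]),
      (3, [([AI 3, II 1], 0), ([AI 2], -1)])]"],
    code_simp, simp only: parts_simps known)

lemma [known]: "holds Impish [AE 9, II 1] 1"
  by (rule holdsI[where rs="
      [(0, [([II 1, IE 7], 1)]), (0, [([AE 7, II 1], -1)]), (3, [([AI 1, II 1, IE 4], 0),
      ([AA 2], 1)]), (3, [([AA 3, II 1, IE 4], 0)]), (0, [([AI 3, II 1], 0), ([AE 4], 0)]),
      (5, [([AA 5, II 1], 0), ([IE 2], 0)]), (6, [([II 1, IE 1], -1), ([AA 6], 1)]), (0, [([AI 6,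
      AE 1, II 1], 0)]), (0, [([AI 7, II 1], 0)]), (8, [([AI 8], 1)])]"],
    code_simp, simp only: parts_simps known)

lemma [known]: "holds Impish [AE 8] 0"
  by (rule holdsI[where rs="
      [(4, [([IE 2], 0), ([AI 4], 1)]), (0, [([AE 6], 0)]), (0, [([AI 1, AE 5], -1)]),
      (0, [([AI 2], -1), ([AE 4], 0)]), (4, [([IE 2], 0), ([AA 4], -1)]), (0, [([AE 2], 0),
      ([AI 4], 1)]), (6, [([AA 6], 1)]), (1, [([AI 1, AI 5], 0)])]"],
    code_simp, simp only: parts_simps known)

lemma [known]: "holds Impish [AI 2, AE 2, II 4] 0"
  by (rule holdsI[where rs="
      [(1, [([AI 1, II 4, IE 1], 0)]), (0, [([AE 2], 0), ([II 4], -1)]), (1, [([AE 1, II 1,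
      II 4], 0)]), (0, [([AI 2], -1), ([II 4], -1)]), (3, [([AI 3, II 1], 0), ([AE 2], 0)]),
      (5, [([AI 1, AI 2, AI 2, IE 1], -1)])]"],
    code_simp, simp only: parts_simps known)

lemma [known]: "holds Impish [AI 5, IE 5] 1"
  by (rule holdsI[where rs="
      [(6, [([II 2], 1), ([IE 2], 0), ([AI 4], 1)]), (6, [([AA 1, AI 3], 0), ([II 2], 1),
      ([IE 2], 0)]), (0, [([AI 1, AI 2, IE 5], 0)]), (0, [([AI 1, AI 2, IE 5], 0)]), (1, [([AI 1,
      AI 2, IE 5], 0)]), (1, [([AI 1, AI 5], 0), ([IE 2], 0)]), (1, [([AI 1, AI 5], 0),
      ([IE 2], 0)]), (4, [([AI 2, AE 2, II 4], 0)]), (0, [([AI 5, AE 1], -1), ([II 2], 1)]),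
      (1, [([AI 1, AI 5], 0), ([II 2], 1)])]"],
    code_simp, simp only: parts_simps known)

lemma [known]: "holds Impish [II 4, IE 4] 1"
  by (rule holdsI[where rs="
      [(1, [([AI 1, II 1, IE 4], 0)]), (1, [([AI 1, II 1, IE 4], 0)]), (0, [([IE 2], 0),
      ([II 4], -1)]), (1, [([AI 1, II 4, IE 1], 0)]), (0, [([AE 1, II 1, II 4], 0)]),
      (0, [([II 2], 1), ([II 4], -1)])]"],
    code_simp, simp only: parts_simps known)

lemma [known]: "holds Impish [IE 4] 0"
  by (rule holdsI[where rs="
      [(0, [([IE 2], 0)]), (0, [([AE 2], 0)]), (2, [([AI 2], -1)]), (0, [([II 2], 1)])]"],
    code_simp, simp only: parts_simps known)

lemma [known]: "holds Impish [AI 1, AI 3, IE 4] 0"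
  by (rule holdsI[where rs="
      [(0, [([II 2], 1), ([IE 4], 0)]), (0, [([AI 1, II 1, IE 4], 0)]), (0, [([AI 1, AI 1], 0),
      ([IE 4], 0)]), (2, [([AA 2], 1), ([IE 4], 0)]), (4, [([AI 1, AE 3], -1), ([II 2], 1)]),
      (1, [([AI 1, AI 1], 0), ([AI 3, IE 1], -1)]), (0, [([AI 1, AE 1], -1), ([AI 3, II 1], 0)]),
      (3, [([AI 3, AI 3], 0)])]"],
    code_simp, simp only: parts_simps known)

lemma [known]: "holds Impish [AI 6, IE 4] 1"
  by (rule holdsI[where rs="
      [(0, [([II 4, IE 4], 1)]), (0, [([AI 4], 1), ([IE 4], 0)]), (2, [([AA 2], 1), ([II 2], 1),
      ([IE 4], 0)]), (3, [([AA 3, II 1, IE 4], 0)]), (0, [([AI 1, AI 3, IE 4], 0)]), (6, [([AA 5,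
      II 1], 0), ([IE 2], 0)]), (1, [([AI 1, AI 6, IE 1], 0)]), (1, [([AI 1, AI 6, IE 1], 0)]),
      (0, [([AI 6, AE 1, II 1], 0)]), (1, [([AI 1, AI 6, II 1], 1)])]"],
    code_simp, simp only: parts_simps known)

lemma [known]: "holds Impish [II 7, IE 1] 1"
  by (rule holdsI[where rs="
      [(1, [([AI 1, II 4, IE 1], 0)]), (1, [([AI 1, II 4, IE 1], 0)]), (0, [([II 1, IE 1], -1),
      ([AI 4], 1)]), (0, [([AI 3, IE 1], -1), ([II 2], 1)]), (0, [([II 6], 1)])]"],
    code_simp, simp only: parts_simps known)

lemma [known]: "holds Impish [AI 7, IE 1] (-1)"
  by (rule holdsI[where rs="
      [(1, [([AI 1, II 4, IE 1], 0)]), (4, [([AA 1, AI 3], 0), ([II 1, IE 1], -1)]),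
      (6, [([AA 2], 1), ([AI 4], 1)]), (0, [([AI 3, IE 1], -1), ([AI 2], -1)]), (4, [([II 1,
      IE 1], -1), ([AA 4], -1)]), (0, [([AI 1, IE 1], -1), ([AI 4], 1)]), (6, [([AA 6], 1)]),
      (0, [([II 6], 1)])]"],
    code_simp, simp only: parts_simps known)

lemma [known]: "holds Impish [AA 3, II 4, IE 1] 0"
  by (rule holdsI[where rs="
      [(0, [([AI 1, II 4, IE 1], 0)]), (3, [([AA 1, AA 1], 0), ([II 1, IE 1], -1), ([II 2], 1)]),
      (3, [([AI 3, IE 1], -1), ([AI 2], -1)]), (1, [([AA 3, AI 1], 0), ([II 1, IE 1], -1)]),
      (0, [([AI 2], -1), ([II 4], -1)])]"],
    code_simp, simp only: parts_simps known)

lemma [known]: "holds Impish [AI 9, IE 1] 1"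
  by (rule holdsI[where rs="
      [(0, [([II 7, IE 1], 1)]), (0, [([AI 7, IE 1], -1)]), (0, [([AI 1, AI 6, IE 1], 0)]),
      (3, [([AA 3, II 4, IE 1], 0)]), (0, [([AI 3, IE 1], -1), ([AI 4], 1)]), (0, [([AI 3,
      IE 1], -1), ([AI 4], 1)]), (6, [([II 1, IE 1], -1), ([AA 6], 1)]), (0, [([AI 1, AI 6,
      IE 1], 0)]), (0, [([AI 7, IE 1], -1)]), (2, [([AI 2], -1), ([II 6], 1)])]"],
    code_simp, simp only: parts_simps known)

text \<open>For the opening at the third of 16 vertices this bound is combined with 0 for
  \<open>[AE 2]\<close> and 1 for the edge between the two labels.\<close>

lemma [known]: "holds Impish [IE 12] 2"
  by (rule holdsI[where rs="
      [(8, [([IE 2], 0), ([AI 8], 1)]), (1, [([AI 1, IE 9], 1)]), (0, [([AE 9, II 1], 1)]),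
      (0, [([II 2], 1), ([AE 8], 0)]), (8, [([IE 2], 0), ([AI 4], 1), ([AI 4], 1)]), (5, [([AI 5,
      IE 5], 1)]), (6, [([AI 6, IE 4], 1)]), (0, [([AE 4], 0), ([II 6], 1)]), (8, [([IE 2], 0),
      ([AI 8], 1)]), (9, [([AI 9, IE 1], 1)]), (0, [([AE 1, II 9], 1)]), (1, [([AI 1, II 9], 2)])]"],
    code_simp, simp only: parts_simps known)

lemma [known]: "holds Impish [AI 1, AI 2, IE 2, IE 3] 0"
  by (rule holdsI[where rs="
      [(6, [([AI 2], -1), ([II 2], 1), ([IE 2], 0)]), (6, [([AI 1, AI 1], 0), ([II 2], 1),
      ([IE 2], 0)]), (6, [([AA 1, AI 1], -2), ([II 2], 1), ([IE 2], 0)]), (1, [([AE 1, IE 3], 0),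
      ([AI 2], -1)]), (6, [([AI 1, AI 1], 0), ([AI 2], -1), ([II 2], 1)]), (2, [([AI 2], -1),
      ([AE 2], 0), ([IE 2], 0)]), (1, [([AI 1, AI 1], 0), ([AI 2], -1), ([IE 2], 0)]),
      (6, [([AI 1, AI 2, AI 2, II 1], 0)])]"],
    code_simp, simp only: parts_simps known)

lemma [known]: "holds Impish [AI 1, IE 2, IE 7] 1"
  by (rule holdsI[where rs="
      [(1, [([II 1, IE 7], 1)]), (3, [([AI 1, AE 1, II 1, IE 5], 0)]), (8, [([AI 1, AI 1], 0),
      ([II 6], 1)]), (6, [([IE 2], 0), ([AE 6], 0)]), (5, [([AI 1, AI 1], 0), ([IE 2], 0),
      ([AI 4], 1)]), (2, [([AI 1, AI 2, IE 2, IE 3], 0)]), (0, [([AI 1, AE 3], -1), ([II 2], 1),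
      ([IE 2], 0)]), (6, [([AE 2], 0), ([IE 2], 0), ([AI 4], 1)]), (5, [([AI 1, AI 5], 0),
      ([IE 2], 0)]), (8, [([AI 1, AI 6, II 1], 1)])]"],
    code_simp, simp only: parts_simps known)

lemma [known]: "holds Impish [AI 1, II 1, IE 2, IE 2] 0"
  by (rule holdsI[where rs="
      [(2, [([II 1, II 1], 0), ([IE 2], 0)]), (0, [([IE 2], 0), ([IE 2], 0)]), (0, [([AI 1,
      II 1], -2), ([IE 2], 0)]), (4, [([AI 1, AI 1], 0), ([II 1, II 1], 0)])]"],
    code_simp, simp only: parts_simps known)

lemma [known]: "holds Impish [II 1, IE 2, IE 5] 1"
  by (rule holdsI[where rs="
      [(4, [([II 2], 1), ([IE 2], 0), ([IE 2], 0)]), (3, [([AE 1, IE 3], 0), ([II 1, II 1], 0)]),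
      (6, [([AI 1, II 1, II 4], 1)]), (6, [([II 1, II 1], 0), ([AE 4], 0)]), (1, [([AI 1, II 1,
      IE 2, IE 2], 0)]), (0, [([II 1, II 1], 0), ([AE 2], 0), ([IE 2], 0)]), (3, [([AI 3,
      II 1], 0), ([IE 2], 0)]), (6, [([II 1, II 1], 0), ([AI 4], 1)])]"],
    code_simp, simp only: parts_simps known)

lemma [known]: "holds Impish [AE 5, II 1] (-1)"
  by (rule holdsI[where rs="
      [(3, [([AI 3, II 1], 0)]), (0, [([AE 3, II 1], -1)]), (4, [([AA 2], 1), ([AE 2], 0)]),
      (3, [([AA 3, II 1], -2)]), (0, [([AI 3, II 1], 0)]), (0, [([IE 4], 0)])]"],
    code_simp, simp only: parts_simps known)

lemma [known]: "holds Impish [AA 3, II 1, IE 2, IE 2] 0"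
  by (rule holdsI[where rs="
      [(0, [([AI 1, II 1, IE 2, IE 2], 0)]), (4, [([AA 1, AA 1], 0), ([II 1, II 1], 0),
      ([IE 2], 0)]), (4, [([AA 3, II 1], -2), ([IE 2], 0)]), (0, [([AA 3, II 1], -2),
      ([IE 2], 0)]), (6, [([AA 3, AI 1], 0), ([II 1, II 1], 0)])]"],
    code_simp, simp only: parts_simps known)

lemma [known]: "holds Impish [AE 7, II 1, IE 2] 1"
  by (rule holdsI[where rs="
      [(0, [([II 1, IE 2, IE 5], 1)]), (0, [([AE 5, II 1], -1), ([IE 2], 0)]), (8, [([II 1,
      II 1], 0), ([AA 2], 1), ([AE 4], 0)]), (3, [([AA 3, II 1, IE 2, IE 2], 0)]), (0, [([AI 3,
      II 1], 0), ([AE 2], 0), ([IE 2], 0)]), (5, [([AA 5, II 1], 0), ([IE 2], 0)]), (8, [([II 1,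
      II 1], 0), ([AA 6], 1)]), (8, [([AE 7, II 1], -1)]), (0, [([AE 7, II 1], -1)]), (7, [([AI 1,
      AI 6, II 1], 1)])]"],
    code_simp, simp only: parts_simps known)

lemma [known]: "holds Impish [AI 1, AI 3, II 4] 1"
  by (rule holdsI[where rs="
      [(0, [([II 2], 1), ([II 4], -1)]), (0, [([AI 1, II 1, II 4], 1)]), (0, [([AI 1, AI 1], 0),
      ([II 4], -1)]), (2, [([AA 2], 1), ([II 4], -1)]), (3, [([AI 3, AI 3], 0)]), (1, [([AI 1,
      AI 1], 0), ([AI 3, II 1], 0)])]"],
    code_simp, simp only: parts_simps known)

lemma [known]: "holds Impish [II 4, IE 2, IE 2] 1"
  by (rule holdsI[where rs="
      [(4, [([AI 3, II 1], 0), ([IE 2], 0)]), (1, [([AI 1, II 1, IE 2, IE 2], 0)]),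
      (0, [([IE 2], 0), ([II 4], -1)]), (6, [([AI 1, II 1, II 4], 1)])]"],
    code_simp, simp only: parts_simps known)

lemma [known]: "holds Impish [AE 4, II 4, IE 2] 1"
  by (rule holdsI[where rs="
      [(0, [([II 4, IE 2, IE 2], 1)]), (0, [([AE 2], 0), ([IE 2], 0), ([II 4], -1)]),
      (2, [([AA 2], 1), ([IE 2], 0), ([II 4], -1)]), (8, [([AA 3, II 1, II 4], 1)]), (8, [([AI 3,
      II 1], 0), ([AE 4], 0)]), (3, [([AI 1, AI 2, IE 2, IE 3], 0)]), (0, [([AE 4], 0),
      ([II 4], -1)]), (4, [([AI 1, AI 3, II 4], 1)])]"],
    code_simp, simp only: parts_simps known)

lemma [known]: "holds Impish [AI 2, AI 2, IE 2, IE 2] 0"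
  by (rule holdsI[where rs="
      [(1, [([AI 1, II 1, IE 2, IE 2], 0)]), (0, [([AI 2], -1), ([IE 2], 0), ([IE 2], 0)]),
      (0, [([AI 2], -1), ([AI 2], -1), ([IE 2], 0)]), (6, [([AI 1, AI 2, AI 2, II 1], 0)])]"],
    code_simp, simp only: parts_simps known)

lemma [known]: "holds Impish [AE 3, II 5, IE 2] 1"
  by (rule holdsI[where rs="
      [(4, [([AE 2], 0), ([II 2], 1), ([II 2], 1), ([IE 2], 0)]), (0, [([AE 1, II 5], -1),
      ([IE 2], 0)]), (4, [([AA 2], 1), ([II 2], 1), ([II 2], 1), ([IE 2], 0)]), (8, [([AE 3,
      II 1], -1), ([AI 4], 1)]), (1, [([AI 1, AE 3], -1), ([II 2], 1), ([IE 2], 0)]), (4, [([AI 2,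
      AI 2, IE 2, IE 2], 0)]), (1, [([AE 1, II 5], -1), ([IE 2], 0)]), (6, [([AI 1, AE 3], -1),
      ([II 2], 1), ([II 2], 1)])]"],
    code_simp, simp only: parts_simps known)

lemma [known]: "holds Impish [IE 2, IE 10] 2"
  by (rule holdsI[where rs="
      [(2, [([AE 1, II 1, IE 8], 1)]), (10, [([AI 1, II 9], 2)]), (10, [([AE 9, II 1], 1)]),
      (1, [([AI 1, IE 2, IE 7], 1)]), (0, [([AE 7, II 1, IE 2], 1)]), (0, [([II 2], 1),
      ([IE 2], 0), ([AE 6], 0)]), (8, [([IE 2], 0), ([AI 4], 1), ([AI 4], 1)]), (0, [([AE 4, II 4,
      IE 2], 1)]), (0, [([AE 3, II 5, IE 2], 1)]), (0, [([AE 2], 0), ([IE 2], 0), ([II 6], 1)]),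
      (8, [([IE 2], 0), ([AI 8], 1)]), (10, [([AI 9, II 1], 2)])]"],
    code_simp, simp only: parts_simps known)

lemma [known]: "holds Impish [AE 10] 0"
  by (rule holdsI[where rs="
      [(8, [([AI 8], 1)]), (0, [([AE 8], 0)]), (6, [([AA 2], 1), ([IE 2], 0), ([AI 4], 1)]),
      (0, [([AI 2], -1), ([AE 6], 0)]), (8, [([AA 4], -1), ([AI 4], 1)]), (0, [([AI 4], 1),
      ([AE 4], 0)]), (6, [([IE 2], 0), ([AA 6], 1)]), (8, [([AA 7, AI 1], 0)]), (3, [([AI 3,
      AE 1], -1), ([AI 4], 1)]), (0, [([AI 8], 1)])]"],
    code_simp, simp only: parts_simps known)

lemma [known]: "holds Impish [AA 1, IE 3] (-1)"
  by (rule holdsI[where rs="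
      [(2, [([II 2], 1)]), (2, [([AE 2], 0)]), (2, [([AI 1, AE 1], -1)]), (2, [([AI 2], -1)])]"],
    code_simp, simp only: parts_simps known)

lemma [known]: "holds Impish [AA 3, AI 2, IE 2, IE 3] 0"
  by (rule holdsI[where rs="
      [(0, [([AI 1, AI 2, IE 2, IE 3], 0)]), (0, [([AA 1, IE 3], -1), ([AI 2], -1), ([IE 2], 0)]),
      (1, [([AI 1, AI 2, IE 2, IE 3], 0)]), (1, [([AA 1, IE 3], -1), ([AI 2], -1), ([IE 2], 0)]),
      (5, [([AA 3, AI 1], 0), ([AE 1, IE 3], 0)]), (8, [([AA 3, AI 1], 0), ([AI 2], -1),
      ([II 2], 1)]), (5, [([AA 3, II 1], -2), ([AE 2], 0), ([IE 2], 0)]), (1, [([AA 3, AI 1], 0),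
      ([AI 2], -1), ([IE 2], 0)]), (8, [([AA 3, AI 2, AI 2, II 1], 0)])]"],
    code_simp, simp only: parts_simps known)

lemma [known]: "holds Impish [AA 3, AE 3] (-1)"
  by (rule holdsI[where rs="
      [(0, [([AI 1, AE 3], -1)]), (2, [([AA 1, AA 1], 0), ([IE 2], 0)]), (1, [([AA 3, AI 1], 0)]),
      (0, [([AA 3, AE 1], -1)]), (0, [([AA 3, AI 1], 0)])]"],
    code_simp, simp only: parts_simps known)

lemma [known]: "holds Impish [AA 3, II 5, IE 2] 0"
  by (rule holdsI[where rs="
      [(4, [([AA 2], 1), ([II 2], 1), ([II 2], 1), ([IE 2], 0)]), (0, [([AA 1, II 5], 0),
      ([IE 2], 0)]), (8, [([AA 3, II 1], -2), ([AI 4], 1)]), (8, [([AA 3, AI 1], 0), ([AI 3,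
      II 1], 0)]), (8, [([AA 3, AI 2, AI 2, II 1], 0)]), (1, [([AE 1, II 5], -1), ([AI 2], -1)]),
      (6, [([AA 3, AI 1], 0), ([II 2], 1), ([II 2], 1)])]"],
    code_simp, simp only: parts_simps known)

lemma [known]: "holds Impish [AA 3, IE 2, IE 7] 1"
  by (rule holdsI[where rs="
      [(0, [([AI 1, IE 2, IE 7], 1)]), (3, [([AA 1, AA 1], 0), ([II 1, IE 7], 1)]), (5, [([AA 3,
      AE 1, II 1, IE 5], 0)]), (10, [([AA 3, AI 1], 0), ([II 6], 1)]), (6, [([AI 2], -1),
      ([IE 2], 0), ([AE 6], 0)]), (5, [([AA 3, AI 1], 0), ([IE 2], 0), ([AI 4], 1)]), (2, [([AA 3,
      AI 2, IE 2, IE 3], 0)]), (0, [([II 2], 1), ([IE 2], 0), ([AA 3, AE 3], -1)]), (5, [([AA 3,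
      AI 1], 0), ([IE 2], 0), ([AI 4], 1)]), (5, [([IE 2], 0), ([AA 3, AI 5], 0)]), (0, [([AA 3,
      II 5, IE 2], 0)])]"],
    code_simp, simp only: parts_simps known)

lemma [known]: "holds Impish [AI 1, AE 7] (-1)"
  by (rule holdsI[where rs="
      [(4, [([IE 2], 0), ([AI 4], 1)]), (6, [([AE 6], 0)]), (0, [([AI 1, AE 5], -1)]),
      (6, [([AA 2], 1), ([AE 4], 0)]), (6, [([AA 3, AE 3], -1)]), (6, [([AE 2], 0),
      ([AA 4], -1)]), (0, [([AI 1, AE 1], -1), ([AI 4], 1)]), (6, [([AA 6], 1)])]"],
    code_simp, simp only: parts_simps known)

lemma [known]: "holds Impish [AI 3, AE 7, IE 2] 1"
  by (rule holdsI[where rs="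
      [(0, [([AE 7, II 1, IE 2], 1)]), (0, [([AI 1, AE 7], -1), ([IE 2], 0)]), (0, [([AI 1,
      AE 7], -1), ([IE 2], 0)]), (6, [([II 2], 1), ([IE 2], 0), ([AE 6], 0)]), (5, [([AA 1,
      AI 3], 0), ([IE 2], 0), ([AI 4], 1)]), (10, [([AI 3, II 1], 0), ([AA 2], 1), ([AE 4], 0)]),
      (6, [([II 2], 1), ([IE 2], 0), ([AA 3, AE 3], -1)]), (6, [([AE 2], 0), ([II 2], 1),
      ([IE 2], 0), ([AA 4], -1)]), (0, [([AI 3, AE 1], -1), ([IE 2], 0), ([AI 4], 1)]),
      (10, [([AI 3, II 1], 0), ([AA 6], 1)]), (7, [([AE 1, IE 3], 0), ([AI 3, AI 3], 0)]),
      (1, [([AI 1, AE 7], -1), ([II 2], 1)])]"],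
    code_simp, simp only: parts_simps known)

lemma [known]: "holds Impish [AA 7, IE 2, IE 3] 1"
  by (rule holdsI[where rs="
      [(10, [([II 2], 1), ([IE 2], 0), ([AA 6], 1)]), (1, [([AA 1, IE 3], -1), ([IE 2], 0),
      ([AI 4], 1)]), (10, [([AA 2], 1), ([II 2], 1), ([IE 2], 0), ([AA 4], -1)]), (0, [([AA 3,
      AI 2, IE 2, IE 3], 0)]), (2, [([AI 1, AI 5], 0), ([AE 1, IE 3], 0)]), (10, [([AA 7,
      AI 1], 0), ([II 2], 1)]), (1, [([AA 7, AI 1], 0), ([IE 2], 0)]), (1, [([AA 7, AI 1], 0),
      ([IE 2], 0)]), (10, [([AA 7, AI 2, II 1], 1)])]"],
    code_simp, simp only: parts_simps known)

lemma [known]: "holds Impish [AI 5, AE 3] (-1)"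
  by (rule holdsI[where rs="
      [(4, [([IE 2], 0), ([AI 4], 1)]), (4, [([AA 1, AI 3], 0), ([IE 2], 0)]), (0, [([AI 1,
      AE 3], -1), ([AI 2], -1)]), (3, [([AA 3, AE 3], -1)]), (4, [([IE 2], 0), ([AA 4], -1)]),
      (1, [([AI 1, AI 5], 0)]), (0, [([AI 5, AE 1], -1)]), (0, [([AI 1, AI 5], 0)])]"],
    code_simp, simp only: parts_simps known)

lemma [known]: "holds Impish [AA 4, AE 3, II 1, IE 2] 0"
  by (rule holdsI[where rs="
      [(3, [([AA 3, II 1, IE 2, IE 2], 0)]), (0, [([AE 3, II 1], -1), ([AA 2], 1), ([IE 2], 0)]),
      (2, [([AI 3, II 1], 0), ([AE 2], 0), ([IE 2], 0)]), (2, [([AA 1, AE 1], -1), ([AI 3,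
      II 1], 0), ([IE 2], 0)]), (8, [([II 1, II 1], 0), ([AA 2], 1), ([AA 4], -1)]), (8, [([AE 3,
      II 1], -1), ([AA 4], -1)]), (0, [([AE 3, II 1], -1), ([AA 4], -1)]), (1, [([AI 1,
      AE 3], -1), ([AI 3, II 1], 0)])]"],
    code_simp, simp only: parts_simps known)

lemma [known]: "holds Impish [AI 7, AE 3, IE 2] 1"
  by (rule holdsI[where rs="
      [(0, [([AE 3, II 5, IE 2], 1)]), (0, [([IE 2], 0), ([AI 5, AE 3], -1)]), (0, [([AI 1,
      AE 3], -1), ([IE 2], 0), ([AI 4], 1)]), (3, [([II 2], 1), ([IE 2], 0), ([AA 3, AE 3], -1)]),
      (4, [([AA 4, AE 3, II 1, IE 2], 0)]), (0, [([AI 1, AE 3], -1), ([IE 2], 0), ([AI 4], 1)]),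
      (10, [([AE 3, II 1], -1), ([AA 6], 1)]), (2, [([AE 2], 0), ([IE 2], 0), ([II 6], 1)]),
      (2, [([AA 1, AE 1], -1), ([IE 2], 0), ([II 6], 1)]), (10, [([AI 7, II 1], 0), ([AA 2], 1)]),
      (1, [([AE 1, AE 3], 0), ([II 6], 1)]), (1, [([AI 1, AE 3], -1), ([II 6], 1)])]"],
    code_simp, simp only: parts_simps known)

text \<open>This belongs to the opening at the fourth of 16 vertices. Impish has answered on the
  short side, which leaves both runs even; they are nevertheless bounded as one group.\<close>

lemma [known]: "holds Impish [AE 12, IE 2] 2"
  by (rule holdsI[where rs="
      [(0, [([IE 2, IE 10], 2)]), (0, [([IE 2], 0), ([AE 10], 0)]), (12, [([AE 9, II 1], 1),
      ([AA 2], 1)]), (3, [([AA 3, IE 2, IE 7], 1)]), (0, [([AI 3, AE 7, IE 2], 1)]),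
      (0, [([IE 2], 0), ([AI 4], 1), ([AE 6], 0)]), (10, [([IE 2], 0), ([AI 4], 1), ([AA 6], 1)]),
      (7, [([AA 7, IE 2, IE 3], 1)]), (0, [([AI 7, AE 3, IE 2], 1)]), (0, [([AE 2], 0),
      ([IE 2], 0), ([AI 8], 1)]), (0, [([AI 9, AE 1, IE 2], 1)]), (12, [([AA 11, II 1], 2)]),
      (2, [([AI 1, AE 1, IE 10], 1)]), (12, [([AI 1, AI 11], 2)])]"],
    code_simp, simp only: parts_simps known)

lemma [known]: "holds Impish [IE 10] 0"
  by (rule holdsI[where rs="
      [(4, [([AI 4], 1), ([IE 4], 0)]), (0, [([AE 8], 0)]), (0, [([AE 7, II 1], -1)]),
      (0, [([II 2], 1), ([AE 6], 0)]), (1, [([AI 1, AE 5], -1), ([II 2], 1)]), (6, [([AI 1,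
      AI 5], 0), ([IE 2], 0)]), (7, [([AI 1, AI 6, IE 1], 0)]), (7, [([AI 7, IE 1], -1)]),
      (8, [([AI 8], 1)]), (2, [([AI 2], -1), ([II 6], 1)])]"],
    code_simp, simp only: parts_simps known)

lemma [known]: "holds Impish [AI 1, IE 7] (-1)"
  by (rule holdsI[where rs="
      [(2, [([II 2], 1), ([IE 4], 0)]), (6, [([AE 6], 0)]), (0, [([AI 1, AE 5], -1)]),
      (6, [([AI 2], -1), ([AE 4], 0)]), (0, [([AI 1, AE 3], -1), ([II 2], 1)]), (6, [([AE 2], 0),
      ([AI 4], 1)]), (6, [([AI 5, AE 1], -1)]), (1, [([AI 1, AI 1], 0), ([II 4], -1)])]"],
    code_simp, simp only: parts_simps known)

lemma [known]: "holds Impish [AI 1, AE 4, II 1, IE 2] 0"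
  by (rule holdsI[where rs="
      [(6, [([II 1, II 1], 0), ([AE 4], 0)]), (0, [([AI 1, II 1, IE 2, IE 2], 0)]), (0, [([AI 1,
      II 1], -2), ([AE 2], 0), ([IE 2], 0)]), (2, [([AI 1, II 1], -2), ([AA 2], 1), ([IE 2], 0)]),
      (6, [([AA 3, AI 1], 0), ([II 1, II 1], 0)]), (0, [([IE 2], 0), ([AE 4], 0)]), (0, [([AI 1,
      II 1], -2), ([AE 4], 0)]), (5, [([AI 1, AI 1], 0), ([AI 3, II 1], 0)])]"],
    code_simp, simp only: parts_simps known)

lemma [known]: "holds Impish [AI 1, AE 4, AE 4, II 1] 0"
  by (rule holdsI[where rs="
      [(3, [([AI 3, II 1], 0), ([AE 4], 0)]), (0, [([AI 1, AE 4, II 1, IE 2], 0)]), (0, [([AI 1,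
      II 1], -2), ([AE 2], 0), ([AE 4], 0)]), (2, [([AI 1, II 1], -2), ([AA 2], 1), ([AE 4], 0)]),
      (7, [([AA 3, AI 1], 0), ([AI 3, II 1], 0)]), (0, [([AE 4], 0), ([AE 4], 0)])]"],
    code_simp, simp only: parts_simps known)

lemma [known]: "holds Impish [AI 1, AE 4, II 5] 0"
  by (rule holdsI[where rs="
      [(6, [([II 2], 1), ([II 2], 1), ([AE 4], 0)]), (6, [([AI 1, AE 3], -1), ([II 2], 1),
      ([II 2], 1)]), (3, [([AA 1, II 5], 0), ([AE 2], 0)]), (3, [([AE 1, II 5], -1),
      ([AA 2], 1)]), (6, [([AA 3, AI 1], 0), ([II 2], 1), ([II 2], 1)]), (4, [([AI 4], 1),
      ([AE 4], 0)]), (1, [([AI 1, AI 1], 0), ([II 2], 1), ([AE 4], 0)]), (8, [([AI 1, AI 2, AI 2,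
      AI 3], 0)])]"],
    code_simp, simp only: parts_simps known)

lemma [known]: "holds Impish [AI 1, AE 4, IE 7] 1"
  by (rule holdsI[where rs="
      [(1, [([AI 1, IE 2, IE 7], 1)]), (0, [([AI 1, IE 2, IE 7], 1)]), (0, [([AI 1, IE 7], -1),
      ([AE 2], 0)]), (2, [([AI 1, IE 7], -1), ([AA 2], 1)]), (10, [([AA 3, AI 1], 0),
      ([II 6], 1)]), (6, [([AE 4], 0), ([AE 6], 0)]), (5, [([AI 1, AI 1], 0), ([AI 4], 1),
      ([AE 4], 0)]), (0, [([AI 1, AE 4, AE 4, II 1], 0)]), (0, [([AI 1, AE 3], -1), ([II 2], 1),
      ([AE 4], 0)]), (6, [([AE 2], 0), ([AI 4], 1), ([AE 4], 0)]), (5, [([AI 1, AI 5], 0),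
      ([AE 4], 0)]), (0, [([AI 1, AE 4, II 5], 0)])]"],
    code_simp, simp only: parts_simps known)

lemma [known]: "holds Impish [IE 6] 0"
  by (rule holdsI[where rs="
      [(0, [([IE 4], 0)]), (0, [([AE 4], 0)]), (0, [([AE 3, II 1], -1)]), (3, [([AI 3,
      IE 1], -1)]), (4, [([AI 4], 1)]), (0, [([II 4], -1)])]"],
    code_simp, simp only: parts_simps known)

lemma [known]: "holds Impish [AI 1, AI 2, II 5] 1"
  by (rule holdsI[where rs="
      [(4, [([AI 2], -1), ([II 2], 1), ([II 2], 1)]), (4, [([AI 1, AI 1], 0), ([II 2], 1),
      ([II 2], 1)]), (1, [([AA 1, II 5], 0)]), (4, [([AI 2], -1), ([AI 4], 1)]), (5, [([AI 1,
      AI 1], 0), ([AI 3, II 1], 0)]), (0, [([AI 1, AI 2, AI 2, II 1], 0)])]"],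
    code_simp, simp only: parts_simps known)

lemma [known]: "holds Impish [AI 1, IE 3] (-1)"
  by (rule holdsI[where rs="
      [(0, [([IE 2], 0)]), (2, [([AE 2], 0)]), (0, [([AI 1, AE 1], -1)]), (2, [([AI 2], -1)])]"],
    code_simp, simp only: parts_simps known)

lemma [known]: "holds Impish [AI 1, IE 3, IE 6] 1"
  by (rule holdsI[where rs="
      [(2, [([II 2], 1), ([IE 6], 0)]), (2, [([AE 2], 0), ([IE 6], 0)]), (1, [([AI 1, AI 1], 0),
      ([IE 6], 0)]), (8, [([AI 1, AI 2, II 5], 1)]), (8, [([AI 1, AE 5], -1), ([II 2], 1)]),
      (8, [([AI 1, AI 1], 0), ([II 2], 1), ([AE 4], 0)]), (2, [([AI 1, AI 2, IE 2, IE 3], 0)]),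
      (0, [([AI 1, IE 3], -1), ([AE 2], 0), ([II 2], 1)]), (5, [([AE 1, IE 3], 0), ([AI 4], 1)]),
      (8, [([AI 1, AI 5], 0), ([II 2], 1)])]"],
    code_simp, simp only: parts_simps known)

lemma [known]: "holds Impish [AI 1, II 1, IE 1, IE 3] 0"
  by (rule holdsI[where rs="
      [(4, [([II 1, IE 1], -1), ([II 2], 1)]), (1, [([AI 1, IE 3], -1)]), (3, [([AI 1, IE 1], -1),
      ([II 1, II 1], 0)]), (2, [([II 1, IE 1], -1), ([AE 2], 0)]), (1, [([AI 1, AI 1], 0), ([II 1,
      IE 1], -1)]), (0, [([AI 1, IE 1], -1), ([II 1, II 1], 0)])]"],
    code_simp, simp only: parts_simps known)

lemma [known]: "holds Impish [IE 1, IE 1] 0"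
  by (rule holdsI[where rs="
      [(0, [])]"],
    code_simp, simp only: parts_simps known)

lemma [known]: "holds Impish [AE 3, IE 1] 0"
  by (rule holdsI[where rs="
      [(0, [([IE 1, IE 1], 0)]), (0, [([AE 1, IE 1], -2)]), (2, [([AA 2], 1)]),
      (0, [([IE 2], 0)])]"],
    code_simp, simp only: parts_simps known)

lemma [known]: "holds Impish [II 1, II 4, IE 1] 0"
  by (rule holdsI[where rs="
      [(4, [([II 4], -1)]), (4, [([AI 3, II 1], 0)]), (1, [([AI 1, IE 1], -1), ([II 1,
      II 1], 0)]), (2, [([II 1, II 1], 0), ([II 2], 1)])]"],
    code_simp, simp only: parts_simps known)

lemma [known]: "holds Impish [II 1, IE 1, IE 6] 1"
  by (rule holdsI[where rs="
      [(0, [([IE 6], 0)]), (2, [([II 1, II 1], 0), ([IE 4], 0)]), (0, [([II 1, IE 1], -1),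
      ([IE 4], 0)]), (1, [([AI 1, II 1, IE 1, IE 3], 0)]), (0, [([II 1, II 1], 0), ([AE 3,
      IE 1], 0)]), (3, [([AI 3, II 1], 0), ([IE 1, IE 1], 0)]), (4, [([II 1, IE 1], -1),
      ([AI 4], 1)]), (0, [([II 1, II 4, IE 1], 0)])]"],
    code_simp, simp only: parts_simps known)

lemma [known]: "holds Impish [AE 1, II 1, IE 6] (-1)"
  by (rule holdsI[where rs="
      [(2, [([II 1, II 1], 0), ([IE 4], 0)]), (0, [([IE 6], 0)]), (5, [([AE 5, II 1], -1)]),
      (5, [([AI 1, II 1], -2), ([AE 4], 0)]), (5, [([AE 3, II 1], -1), ([AI 2], -1)]),
      (5, [([AI 3, II 1], 0), ([AE 2], 0)]), (4, [([AE 1, II 1], -3), ([AI 4], 1)]), (0, [([AE 1,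
      II 1, II 4], 0)])]"],
    code_simp, simp only: parts_simps known)

lemma [known]: "holds Impish [AE 3, AE 3] 0"
  by (rule holdsI[where rs="
      [(0, [([AE 3, IE 1], 0)]), (0, [([AE 1, AE 3], 0)]), (0, [([AI 1, AE 3], -1)])]"],
    code_simp, simp only: parts_simps known)

lemma [known]: "holds Impish [AE 3, II 1, IE 6] 1"
  by (rule holdsI[where rs="
      [(0, [([II 1, IE 1, IE 6], 1)]), (0, [([AE 1, II 1, IE 6], -1)]), (4, [([II 1, II 1], 0),
      ([AA 2], 1), ([IE 4], 0)]), (0, [([IE 2], 0), ([IE 6], 0)]), (5, [([AE 5, II 1], -1),
      ([IE 2], 0)]), (5, [([AI 1, AE 4, II 1, IE 2], 0)]), (0, [([II 1, II 1], 0), ([AE 3,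
      AE 3], 0)]), (3, [([AI 3, II 1], 0), ([AE 3, IE 1], 0)]), (4, [([AE 3, II 1], -1),
      ([AI 4], 1)]), (0, [([AE 3, II 1, II 4], 0)])]"],
    code_simp, simp only: parts_simps known)

lemma [known]: "holds Impish [AI 2, AE 3, AE 4, II 1] 0"
  by (rule holdsI[where rs="
      [(1, [([AI 1, AE 4, II 1, IE 2], 0)]), (0, [([AE 3, II 1], -1), ([AE 4], 0)]), (2, [([II 1,
      II 1], 0), ([AE 2], 0), ([AE 4], 0)]), (2, [([AA 1, AE 1], -1), ([II 1, II 1], 0),
      ([AE 4], 0)]), (2, [([II 1, II 1], 0), ([AA 2], 1), ([AE 4], 0)]), (3, [([II 1, II 1], 0),
      ([AE 3, AE 3], 0)]), (0, [([AE 3, II 1], -1), ([AI 2], -1), ([AE 2], 0)]), (2, [([AE 3,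
      II 1], -1), ([AA 2], 1), ([AI 2], -1)]), (3, [([II 1, II 1], 0), ([AA 3, AE 3], -1)]),
      (0, [([AE 3, II 1], -1), ([AE 4], 0)])]"],
    code_simp, simp only: parts_simps known)

lemma [known]: "holds Impish [AI 2, AE 4, IE 6] 1"
  by (rule holdsI[where rs="
      [(1, [([AI 1, IE 3, IE 6], 1)]), (0, [([AE 4], 0), ([IE 6], 0)]), (3, [([AE 3, II 1,
      IE 6], 1)]), (0, [([AI 2], -1), ([AE 2], 0), ([IE 6], 0)]), (2, [([AA 2], 1), ([AI 2], -1),
      ([IE 6], 0)]), (10, [([AA 3, AI 2, II 5], 1)]), (5, [([AE 5, II 1], -1), ([AE 4], 0)]),
      (5, [([AI 1, AE 4, AE 4, II 1], 0)]), (0, [([AI 2, AE 3, AE 4, II 1], 0)]), (5, [([AI 3,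
      II 1], 0), ([AE 2], 0), ([AE 4], 0)]), (4, [([AI 2], -1), ([AI 4], 1), ([AE 4], 0)]),
      (10, [([AI 2, AI 3, AI 5], 1)])]"],
    code_simp, simp only: parts_simps known)

lemma [known]: "holds Impish [AA 3, AI 3, II 4] 1"
  by (rule holdsI[where rs="
      [(0, [([AI 1, AI 3, II 4], 1)]), (0, [([AA 1, AI 3], 0), ([II 4], -1)]), (0, [([AA 3, II 1,
      II 4], 1)]), (0, [([AA 3, AI 1], 0), ([II 4], -1)]), (0, [([AA 3, AI 1], 0), ([II 4], -1)]),
      (3, [([AI 2], -1), ([AI 3, AI 3], 0)]), (1, [([AA 3, AI 1], 0), ([AI 3, II 1], 0)])]"],
    code_simp, simp only: parts_simps known)

lemma [known]: "holds Impish [AE 4, AE 4, II 4] 1"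
  by (rule holdsI[where rs="
      [(0, [([AE 4, II 4, IE 2], 1)]), (0, [([AE 2], 0), ([AE 4], 0), ([II 4], -1)]),
      (2, [([AA 2], 1), ([AE 4], 0), ([II 4], -1)]), (6, [([AA 3, AI 3, II 4], 1)]),
      (0, [([II 2], 1), ([AE 4], 0), ([AE 4], 0)]), (1, [([AI 1, AE 4, AE 4, II 1], 0)])]"],
    code_simp, simp only: parts_simps known)

lemma [known]: "holds Impish [AE 3, AE 4, II 5] 1"
  by (rule holdsI[where rs="
      [(8, [([AE 2], 0), ([II 2], 1), ([II 2], 1), ([AE 4], 0)]), (0, [([AE 1, II 5], -1),
      ([AE 4], 0)]), (0, [([AI 1, AE 4, II 5], 0)]), (0, [([AE 3, II 5, IE 2], 1)]), (1, [([AA 1,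
      II 5], 0), ([AE 3, IE 1], 0)]), (0, [([AI 1, AE 1, AE 3, II 5], 0)]), (3, [([AA 3, II 5,
      IE 2], 0)]), (4, [([IE 2], 0), ([AI 4], 1), ([AE 4], 0)]), (1, [([AI 1, AE 3], -1),
      ([II 2], 1), ([AE 4], 0)]), (0, [([AI 2, AE 3, AE 4, II 1], 0)])]"],
    code_simp, simp only: parts_simps known)

text \<open>From here on, the groups of two runs with 14 free vertices in total belong to the
  openings at the fifth to eighth of 16 vertices.\<close>

lemma [known]: "holds Impish [AE 4, IE 10] 2"
  by (rule holdsI[where rs="
      [(0, [([IE 2, IE 10], 2)]), (0, [([AE 2], 0), ([IE 10], 0)]), (2, [([AA 2], 1),
      ([IE 10], 0)]), (12, [([AA 3, II 9], 2)]), (8, [([AE 4], 0), ([AI 8], 1)]), (1, [([AI 1,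
      AE 4, IE 7], 1)]), (2, [([AI 2, AE 4, IE 6], 1)]), (0, [([II 2], 1), ([AE 4], 0),
      ([AE 6], 0)]), (4, [([AI 4], 1), ([AE 4], 0), ([IE 4], 0)]), (0, [([AE 4, AE 4, II 4], 1)]),
      (0, [([AE 3, AE 4, II 5], 1)]), (0, [([AE 2], 0), ([AE 4], 0), ([II 6], 1)]),
      (8, [([AE 4], 0), ([AI 8], 1)]), (12, [([AI 3, AI 9], 2)])]"],
    code_simp, simp only: parts_simps known)

lemma [known]: "holds Impish [AI 1, AI 2, IE 1, IE 4] 0"
  by (rule holdsI[where rs="
      [(0, [([II 1, IE 1], -1), ([IE 4], 0)]), (5, [([AI 1, AI 1], 0), ([IE 1, IE 1], 0),
      ([II 2], 1)]), (0, [([AI 1, IE 1], -1), ([IE 4], 0)]), (0, [([AI 2], -1), ([IE 4], 0)]),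
      (3, [([AE 3, IE 1], 0), ([AI 2], -1)]), (4, [([AI 1, AI 1], 0), ([II 1, IE 1], -1),
      ([AE 2], 0)]), (2, [([AI 1, AI 2, AI 2, IE 1], -1)]), (4, [([AI 1, IE 1], -1), ([AI 3,
      II 1], 0)])]"],
    code_simp, simp only: parts_simps known)

lemma [known]: "holds Impish [AI 1, IE 1, IE 8] 1"
  by (rule holdsI[where rs="
      [(2, [([II 1, IE 1, IE 6], 1)]), (7, [([AI 1, IE 1], -1), ([II 6], 1)]), (0, [([AI 1,
      IE 1], -1), ([IE 6], 0)]), (5, [([AI 1, AI 1], 0), ([IE 1, IE 1], 0), ([AI 4], 1)]),
      (2, [([AI 1, AI 2, IE 1, IE 4], 0)]), (0, [([AI 1, IE 1], -1), ([II 2], 1), ([AE 4], 0)]),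
      (7, [([AE 3, IE 1], 0), ([AI 4], 1)]), (5, [([AI 1, AI 5], 0), ([IE 1, IE 1], 0)]),
      (6, [([AI 1, AI 6, IE 1], 0)]), (0, [([AI 1, IE 1], -1), ([II 6], 1)])]"],
    code_simp, simp only: parts_simps known)

lemma [known]: "holds Impish [IE 8] 0"
  by (rule holdsI[where rs="
      [(0, [([IE 6], 0)]), (0, [([AE 6], 0)]), (0, [([AE 5, II 1], -1)]), (0, [([II 2], 1),
      ([AE 4], 0)]), (4, [([IE 2], 0), ([AI 4], 1)]), (6, [([AI 1, AI 5], 0)]), (0, [([AE 1,
      II 5], -1)]), (0, [([II 6], 1)])]"],
    code_simp, simp only: parts_simps known)

lemma [known]: "holds Impish [AI 1, IE 4, IE 5] 1"
  by (rule holdsI[where rs="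
      [(1, [([II 1, IE 2, IE 5], 1)]), (2, [([AI 1, AI 2, IE 5], 0)]), (6, [([AI 1, AI 1], 0),
      ([AE 2], 0), ([II 2], 1), ([IE 2], 0)]), (2, [([AI 1, AI 2, IE 5], 0)]), (8, [([AI 1, AI 3,
      II 4], 1)]), (4, [([AE 4], 0), ([IE 4], 0)]), (1, [([AI 1, AI 1], 0), ([IE 2], 0),
      ([IE 4], 0)]), (0, [([AI 1, II 1, IE 4], 0), ([AE 2], 0)]), (3, [([AI 1, AI 3, IE 4], 0)]),
      (4, [([AI 4], 1), ([IE 4], 0)])]"],
    code_simp, simp only: parts_simps known)

lemma [known]: "holds Impish [II 1, IE 3, IE 4] 1"
  by (rule holdsI[where rs="
      [(0, [([IE 2], 0), ([IE 4], 0)]), (0, [([II 1, IE 1], -1), ([IE 4], 0)]), (1, [([AI 1, II 1,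
      IE 4], 0)]), (0, [([II 1, II 1], 0), ([IE 4], 0)]), (1, [([AI 1, II 1, IE 1, IE 3], 0)]),
      (1, [([AI 1, II 1, IE 1, IE 3], 0)]), (0, [([AE 1, IE 3], 0), ([II 1, II 1], 0)]),
      (6, [([AI 3, II 1], 0), ([II 2], 1)])]"],
    code_simp, simp only: parts_simps known)

lemma [known]: "holds Impish [AE 5, II 1, IE 4] 1"
  by (rule holdsI[where rs="
      [(0, [([II 1, IE 3, IE 4], 1)]), (0, [([AE 3, II 1], -1), ([IE 4], 0)]), (0, [([AI 1, II 1,
      IE 4], 0), ([AE 2], 0)]), (3, [([AA 3, II 1, IE 4], 0)]), (0, [([AI 3, II 1], 0),
      ([IE 4], 0)]), (6, [([AE 5, II 1], -1), ([IE 2], 0)]), (0, [([AE 5, II 1], -1),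
      ([IE 2], 0)]), (3, [([AI 1, II 1, IE 4], 0), ([AE 2], 0)]), (0, [([AE 1, AE 5], 0), ([II 1,
      II 1], 0)]), (0, [([AE 5, II 1], -1), ([II 2], 1)])]"],
    code_simp, simp only: parts_simps known)

lemma [known]: "holds Impish [IE 4, IE 8] 2"
  by (rule holdsI[where rs="
      [(4, [([AE 3, II 1, IE 6], 1)]), (1, [([AI 1, IE 1, IE 8], 1)]), (0, [([AE 1, II 1,
      IE 8], 1)]), (0, [([II 2], 1), ([IE 8], 0)]), (8, [([AE 7, II 1, IE 2], 1)]), (1, [([AI 1,
      IE 4, IE 5], 1)]), (0, [([AE 5, II 1, IE 4], 1)]), (0, [([II 2], 1), ([AE 4], 0),
      ([IE 4], 0)]), (4, [([IE 2], 0), ([AI 4], 1), ([IE 4], 0)]), (0, [([AE 2], 0), ([II 4,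
      IE 4], 1)]), (6, [([AI 6, IE 4], 1)]), (0, [([IE 4], 0), ([II 6], 1)])]"],
    code_simp, simp only: parts_simps known)

lemma [known]: "holds Impish [AA 4, AE 1, II 1, IE 4] 0"
  by (rule holdsI[where rs="
      [(3, [([AA 3, II 1, IE 4], 0)]), (0, [([AE 1, II 1], -3), ([AA 2], 1), ([IE 4], 0)]),
      (0, [([AI 3, II 1], 0), ([IE 4], 0)]), (4, [([AA 4], -1), ([IE 4], 0)]), (7, [([AE 3,
      II 1], -1), ([AA 4], -1)]), (3, [([AI 1, AE 1], -1), ([AI 3, II 1], 0), ([AE 2], 0)]),
      (0, [([AE 1, AE 1], 0), ([II 1, II 1], 0), ([AA 4], -1)]), (7, [([AI 3, II 1], 0),
      ([AA 4], -1)])]"],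
    code_simp, simp only: parts_simps known)

lemma [known]: "holds Impish [AI 2, AE 6, IE 4] 1"
  by (rule holdsI[where rs="
      [(1, [([AI 1, IE 4, IE 5], 1)]), (0, [([IE 4], 0), ([AE 6], 0)]), (5, [([AE 5, II 1,
      IE 4], 1)]), (0, [([AI 2], -1), ([AE 4], 0), ([IE 4], 0)]), (5, [([AE 3, II 1], -1),
      ([AA 2], 1), ([IE 4], 0)]), (5, [([AA 3, II 1, IE 4], 0), ([AE 2], 0)]), (5, [([AA 4, AE 1,
      II 1, IE 4], 0)]), (5, [([AA 5, II 1], 0), ([IE 4], 0)]), (3, [([AE 3, II 1], -1),
      ([AE 6], 0)]), (5, [([AI 1, AI 2, IE 5], 0), ([AE 2], 0)]), (5, [([AI 2, AI 2, AE 1,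
      IE 5], 0)]), (3, [([AI 3, II 1], 0), ([AE 6], 0)])]"],
    code_simp, simp only: parts_simps known)

lemma [known]: "holds Impish [AI 3, AE 5, IE 4] 1"
  by (rule holdsI[where rs="
      [(0, [([AE 5, II 1, IE 4], 1)]), (0, [([AI 1, AE 5], -1), ([IE 4], 0)]), (0, [([AI 1,
      AE 5], -1), ([IE 4], 0)]), (4, [([II 2], 1), ([AE 4], 0), ([IE 4], 0)]), (1, [([AA 1,
      AI 3], 0), ([IE 2], 0), ([IE 4], 0)]), (0, [([AI 1, AI 3, IE 4], 0), ([AE 2], 0)]),
      (4, [([AA 3, AE 1], -1), ([II 2], 1), ([IE 4], 0)]), (4, [([II 2], 1), ([AA 4], -1),
      ([IE 4], 0)]), (9, [([AE 3, IE 1], 0), ([AI 3, AI 3], 0)]), (3, [([AI 1, AE 5], -1),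
      ([AE 2], 0), ([II 2], 1)]), (0, [([AE 1, AE 5], 0), ([AI 3, II 1], 0)]), (6, [([AI 3,
      AI 3], 0), ([IE 4], 0)])]"],
    code_simp, simp only: parts_simps known)

lemma [known]: "holds Impish [AI 7, AE 1, IE 4] 1"
  by (rule holdsI[where rs="
      [(6, [([AI 6, IE 4], 1)]), (0, [([AI 5, AE 1], -1), ([IE 4], 0)]), (6, [([AA 2], 1),
      ([AI 4], 1), ([IE 4], 0)]), (3, [([AA 3, AE 1], -1), ([II 2], 1), ([IE 4], 0)]),
      (4, [([AA 4, AE 1, II 1, IE 4], 0)]), (0, [([AI 1, AE 1], -1), ([AI 4], 1), ([IE 4], 0)]),
      (6, [([IE 4], 0), ([AA 6], 1)]), (0, [([IE 4], 0), ([II 6], 1)]), (3, [([AE 1, AE 3], 0),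
      ([II 6], 1)]), (3, [([AI 1, AE 1], -1), ([AE 2], 0), ([II 6], 1)]), (0, [([AE 1, AE 1], 0),
      ([AI 7, II 1], 0)]), (3, [([AI 3, AE 1], -1), ([II 6], 1)])]"],
    code_simp, simp only: parts_simps known)

lemma [known]: "holds Impish [AE 10, IE 4] 2"
  by (rule holdsI[where rs="
      [(0, [([IE 4, IE 8], 2)]), (0, [([IE 4], 0), ([AE 8], 0)]), (10, [([AE 7, II 1, IE 2], 1),
      ([AA 2], 1)]), (0, [([AI 2, AE 6, IE 4], 1)]), (0, [([AI 3, AE 5, IE 4], 1)]),
      (0, [([AI 4], 1), ([AE 4], 0), ([IE 4], 0)]), (6, [([IE 2], 0), ([IE 4], 0), ([AA 6], 1)]),
      (0, [([AE 2], 0), ([AI 6, IE 4], 1)]), (0, [([AI 7, AE 1, IE 4], 1)]), (0, [([IE 4], 0),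
      ([AI 8], 1)]), (0, [([IE 2], 0), ([AE 10], 0)]), (3, [([AI 1, IE 9], 1), ([AE 2], 0)]),
      (0, [([AE 1, AE 10, II 1], 1)]), (0, [([II 2], 1), ([AE 10], 0)])]"],
    code_simp, simp only: parts_simps known)

lemma [known]: "holds Impish [AA 3, IE 1] (-1)"
  by (rule holdsI[where rs="
      [(2, [([AA 2], 1)]), (2, [([AA 1, AA 1], 0)]), (0, [([AI 2], -1)])]"],
    code_simp, simp only: parts_simps known)

lemma [known]: "holds Impish [AA 3, AI 2, AI 2, IE 1] (-1)"
  by (rule holdsI[where rs="
      [(0, [([AI 1, AI 2, AI 2, IE 1], -1)]), (2, [([AA 1, AA 1], 0), ([II 1, IE 1], -1),
      ([AI 2], -1)]), (4, [([AA 3, AI 1], 0), ([II 1, IE 1], -1)]), (0, [([AA 3, IE 1], -1),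
      ([AI 2], -1)]), (3, [([AA 3, II 1], -2), ([AI 2], -1)])]"],
    code_simp, simp only: parts_simps known)

lemma [known]: "holds Impish [AA 3, AI 2, IE 1, IE 4] 0"
  by (rule holdsI[where rs="
      [(0, [([AI 1, AI 2, IE 1, IE 4], 0)]), (2, [([AA 1, AA 1], 0), ([II 1, IE 1], -1),
      ([IE 4], 0)]), (1, [([AI 1, AI 2, IE 1, IE 4], 0)]), (0, [([AA 3, IE 1], -1), ([IE 4], 0)]),
      (3, [([AA 3, II 1, IE 4], 0)]), (6, [([AA 3, II 1], -2), ([AE 3, IE 1], 0)]), (6, [([AA 3,
      AI 1], 0), ([II 1, IE 1], -1), ([AE 2], 0)]), (2, [([AA 3, AI 2, AI 2, IE 1], -1)]),
      (6, [([AI 3, II 1], 0), ([AA 3, IE 1], -1)])]"],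
    code_simp, simp only: parts_simps known)

lemma [known]: "holds Impish [AA 3, AE 1, II 5, IE 1] 0"
  by (rule holdsI[where rs="
      [(5, [([AE 1, IE 1], -2), ([AA 2], 1), ([II 2], 1), ([II 2], 1)]), (5, [([AA 1, AA 1], 0),
      ([AE 1, IE 1], -2), ([II 2], 1), ([II 2], 1)]), (5, [([AA 3, IE 1], -1), ([II 2], 1),
      ([II 2], 1)]), (7, [([AA 3, IE 1], -1), ([AI 4], 1)]), (7, [([AA 3, AI 1], 0), ([AI 3,
      IE 1], -1)]), (7, [([AA 3, AI 2, AI 2, IE 1], -1)]), (0, [([AE 1, II 5], -1),
      ([AI 2], -1)])]"],
    code_simp, simp only: parts_simps known)

lemma [known]: "holds Impish [AA 3, IE 1, IE 8] 1"
  by (rule holdsI[where rs="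
      [(0, [([AI 1, IE 1, IE 8], 1)]), (4, [([AA 1, AA 1], 0), ([II 1, IE 1, IE 6], 1)]),
      (0, [([AI 2], -1), ([IE 8], 0)]), (5, [([IE 1, IE 1], 0), ([AA 3, AI 5], 0)]), (5, [([AA 3,
      AI 1], 0), ([IE 1, IE 1], 0), ([AI 4], 1)]), (2, [([AA 3, AI 2, IE 1, IE 4], 0)]),
      (0, [([AA 3, IE 1], -1), ([II 2], 1), ([AE 4], 0)]), (7, [([AE 3, IE 1], 0), ([AI 2], -1),
      ([AI 4], 1)]), (5, [([IE 1, IE 1], 0), ([AA 3, AI 5], 0)]), (0, [([AA 3, AE 1, II 5,
      IE 1], 0)]), (0, [([AA 3, IE 1], -1), ([II 6], 1)])]"],
    code_simp, simp only: parts_simps known)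

lemma [known]: "holds Impish [AI 3, AE 1, IE 8] 1"
  by (rule holdsI[where rs="
      [(0, [([AE 1, II 1, IE 8], 1)]), (0, [([AI 1, AE 1], -1), ([IE 8], 0)]), (2, [([AA 2], 1),
      ([IE 8], 0)]), (0, [([II 2], 1), ([IE 8], 0)]), (0, [([AI 3, AE 1], -1), ([IE 6], 0)]),
      (7, [([AI 1, AE 1], -1), ([II 2], 1), ([AE 6], 0)]), (0, [([AE 1, AE 5], 0), ([AI 3,
      II 1], 0)]), (10, [([AI 3, AI 3], 0), ([AE 4], 0)]), (7, [([AE 1, AE 3], 0), ([II 2], 1),
      ([AI 4], 1)]), (7, [([AI 5, AE 1], -1), ([AE 2], 0), ([II 2], 1)]), (8, [([AI 1, AI 6,
      II 1], 1), ([AE 1, AE 1], 0)]), (0, [([AI 3, AE 1], -1), ([II 6], 1)])]"],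
    code_simp, simp only: parts_simps known)

lemma [known]: "holds Impish [AI 1, IE 5] (-1)"
  by (rule holdsI[where rs="
      [(0, [([IE 4], 0)]), (4, [([AE 4], 0)]), (0, [([AI 1, AE 3], -1)]), (4, [([AI 2], -1),
      ([AE 2], 0)]), (4, [([AI 3, AE 1], -1)]), (4, [([AI 4], 1)])]"],
    code_simp, simp only: parts_simps known)

lemma [known]: "holds Impish [AA 4, AI 1, IE 5] 0"
  by (rule holdsI[where rs="
      [(0, [([AI 1, AI 2, IE 5], 0)]), (0, [([AI 1, IE 5], -1), ([AA 2], 1)]), (1, [([AI 1, AI 2,
      IE 5], 0)]), (8, [([AA 4], -1), ([AE 4], 0)]), (1, [([AI 1, AI 1], 0), ([IE 2], 0),
      ([AA 4], -1)]), (2, [([AA 4, AI 1, AI 2, IE 1], -1)]), (0, [([AI 1, AE 1], -1), ([II 2], 1),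
      ([AA 4], -1)]), (8, [([AA 4], -1), ([AI 4], 1)])]"],
    code_simp, simp only: parts_simps known)

lemma [known]: "holds Impish [AI 1, AE 6, IE 5] 1"
  by (rule holdsI[where rs="
      [(8, [([II 2], 1), ([IE 2], 0), ([AE 6], 0)]), (0, [([AI 1, IE 4, IE 5], 1)]), (0, [([AI 1,
      IE 5], -1), ([AE 4], 0)]), (2, [([AI 1, IE 5], -1), ([AA 2], 1), ([IE 2], 0)]), (0, [([AI 1,
      AI 2, IE 5], 0), ([AE 2], 0)]), (4, [([AA 4, AI 1, IE 5], 0)]), (0, [([AI 1, IE 5], -1),
      ([AI 4], 1)]), (4, [([AE 4], 0), ([AE 6], 0)]), (1, [([AI 1, AI 1], 0), ([IE 2], 0),
      ([AE 6], 0)]), (5, [([AI 1, AI 2, IE 5], 0), ([AE 2], 0)]), (0, [([AI 1, AE 1], -1),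
      ([II 2], 1), ([AE 6], 0)]), (4, [([AI 4], 1), ([AE 6], 0)])]"],
    code_simp, simp only: parts_simps known)

lemma [known]: "holds Impish [AE 6, IE 8] 2"
  by (rule holdsI[where rs="
      [(0, [([IE 4, IE 8], 2)]), (0, [([AE 4], 0), ([IE 8], 0)]), (2, [([AA 2], 1), ([IE 2], 0),
      ([IE 8], 0)]), (3, [([AA 3, IE 1, IE 8], 1)]), (0, [([AI 3, AE 1, IE 8], 1)]),
      (0, [([AI 4], 1), ([IE 8], 0)]), (10, [([AI 3, AE 7, IE 2], 1)]), (1, [([AI 1, AE 6,
      IE 5], 1)]), (2, [([AI 2, AE 6, IE 4], 1)]), (0, [([II 2], 1), ([AE 4], 0), ([AE 6], 0)]),
      (4, [([IE 2], 0), ([AI 4], 1), ([AE 6], 0)]), (7, [([AE 2], 0), ([AI 5, IE 5], 1)]),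
      (0, [([AE 1, AE 6, II 5], 1)]), (12, [([AI 5, AI 7], 2)])]"],
    code_simp, simp only: parts_simps known)

lemma [known]: "holds Impish [AI 1, AI 2, AE 3, IE 4] 0"
  by (rule holdsI[where rs="
      [(0, [([AE 3, II 1], -1), ([IE 4], 0)]), (2, [([AI 1, AI 1], 0), ([IE 2], 0), ([IE 4], 0)]),
      (0, [([AI 1, AE 3], -1), ([IE 4], 0)]), (3, [([AI 1, II 1, IE 4], 0), ([AE 2], 0)]),
      (0, [([AI 1, AE 1], -1), ([AI 2], -1), ([IE 4], 0)]), (2, [([AA 2], 1), ([AI 2], -1),
      ([IE 4], 0)]), (3, [([AI 2], -1), ([AE 3, AE 3], 0)]), (4, [([AI 1, AI 1], 0), ([AE 3,
      II 1], -1), ([AE 2], 0)]), (6, [([AI 1, AI 2, AI 2, AE 1, IE 2], -1)]), (4, [([AI 1,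
      AE 3], -1), ([AI 3, II 1], 0)])]"],
    code_simp, simp only: parts_simps known)

lemma [known]: "holds Impish [AI 2, AI 2, AI 2, AI 2] 0"
  by (rule holdsI[where rs="
      [(1, [([AI 1, AI 2, AI 2, II 1], 0)]), (0, [([AI 2], -1), ([AI 2], -1), ([AI 2], -1)])]"],
    code_simp, simp only: parts_simps known)

lemma [known]: "holds Impish [AI 2, AE 3, II 5] 0"
  by (rule holdsI[where rs="
      [(3, [([AI 1, AI 2, II 5], 1)]), (1, [([AA 1, II 5], 0), ([IE 2], 0)]), (1, [([AI 1, AI 2,
      II 5], 1)]), (0, [([AE 1, II 5], -1), ([AI 2], -1)]), (0, [([AI 1, AI 2, II 5], 1)]),
      (4, [([AE 3, II 1], -1), ([AI 4], 1)]), (4, [([AI 1, AE 3], -1), ([AI 3, II 1], 0)]),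
      (8, [([AI 2, AI 2, AI 2, AI 2], 0)])]"],
    code_simp, simp only: parts_simps known)

lemma [known]: "holds Impish [AI 2, AE 3, IE 7] 1"
  by (rule holdsI[where rs="
      [(1, [([AI 1, IE 2, IE 7], 1)]), (9, [([AA 1, II 5], 0), ([AE 3, IE 1], 0)]), (2, [([II 1,
      IE 7], 1), ([AE 2], 0)]), (2, [([AA 1, AE 1], -1), ([II 1, IE 7], 1)]), (2, [([II 1,
      IE 7], 1), ([AA 2], 1)]), (6, [([AE 3, II 1], -1), ([AE 6], 0)]), (1, [([AI 1, AI 2, AE 3,
      IE 4], 0)]), (0, [([AI 2, AE 3, AE 4, II 1], 0)]), (6, [([AI 3, II 1], 0), ([AE 3,
      AE 3], 0)]), (6, [([AE 3, II 1], -1), ([AE 2], 0), ([AI 4], 1)]), (6, [([AI 5, AE 1, AE 3,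
      II 1], 0)]), (0, [([AI 2, AE 3, II 5], 0)])]"],
    code_simp, simp only: parts_simps known)

lemma [known]: "holds Impish [IE 6, IE 6] 2"
  by (rule holdsI[where rs="
      [(0, [([IE 4], 0), ([IE 6], 0)]), (1, [([AI 1, IE 3, IE 6], 1)]), (0, [([AE 3, II 1,
      IE 6], 1)]), (0, [([AE 2], 0), ([II 2], 1), ([IE 6], 0)]), (4, [([AI 4], 1), ([IE 6], 0)]),
      (10, [([AI 5, II 5], 2)])]"],
    code_simp, simp only: parts_simps known)

lemma [known]: "holds Impish [AI 3, AE 3, IE 6] 1"
  by (rule holdsI[where rs="
      [(0, [([AE 3, II 1, IE 6], 1)]), (0, [([AI 1, AE 3], -1), ([IE 6], 0)]), (0, [([AI 1,
      AE 3], -1), ([IE 6], 0)]), (2, [([AE 2], 0), ([II 2], 1), ([IE 6], 0)]), (0, [([AI 3,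
      AE 1], -1), ([IE 6], 0)]), (2, [([AA 2], 1), ([II 2], 1), ([IE 6], 0)]), (3, [([AE 3,
      IE 1], 0), ([AI 3, AI 3], 0)]), (5, [([AI 1, AE 3], -1), ([II 2], 1), ([AE 4], 0)]),
      (0, [([AI 3, II 1], 0), ([AE 3, AE 3], 0)]), (3, [([AE 3, IE 1], 0), ([AI 3, AI 3], 0)]),
      (5, [([AE 1, AE 3], 0), ([II 2], 1), ([AI 4], 1)]), (5, [([II 2], 1), ([AI 5, AE 3], -1)])]"],
    code_simp, simp only: parts_simps known)

lemma [known]: "holds Impish [AE 8, IE 6] 2"
  by (rule holdsI[where rs="
      [(0, [([IE 6, IE 6], 2)]), (0, [([AE 6], 0), ([IE 6], 0)]), (2, [([AA 2], 1), ([IE 4], 0),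
      ([IE 6], 0)]), (0, [([AI 2, AE 4, IE 6], 1)]), (0, [([AI 3, AE 3, IE 6], 1)]),
      (0, [([AE 2], 0), ([AI 4], 1), ([IE 6], 0)]), (6, [([AA 6], 1), ([IE 6], 0)]), (12, [([AA 7,
      II 5], 2)]), (0, [([IE 4], 0), ([AE 8], 0)]), (5, [([AI 1, AE 4, IE 7], 1)]), (5, [([AI 2,
      AE 3, IE 7], 1)]), (0, [([AE 2], 0), ([II 2], 1), ([AE 8], 0)]), (4, [([AI 4], 1),
      ([AE 8], 0)]), (12, [([AI 5, AI 7], 2)])]"],
    code_simp, simp only: parts_simps known)

text \<open>Unless Admirable opens at an end, Impish answers next to her: the edge between the
  labels is worth 1 and the remaining runs are worth 2. From the third vertex on he chooses the side
  with the odd run, so that two even runs remain.\<close>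

lemma Impish_EE16 [known]: "holds Impish [EE 16] 3"
  by (rule holdsI[where rs="
      [(14, [([AI 14], 3)]), (1, [([AE 1, IE 13], 2)]), (2, [([AE 2], 0), ([IE 12], 2)]),
      (0, [([AE 12, IE 2], 2)]), (4, [([AE 4, IE 10], 2)]), (0, [([AE 10, IE 4], 2)]),
      (6, [([AE 6, IE 8], 2)]), (0, [([AE 8, IE 6], 2)])]"],
    code_simp, simp only: parts_simps known)

text \<open>A neutral filler: its guarantee 1 exactly pays for the edge by which it is
  attached.\<close>

lemma Impish_EE2 [known]: "holds Impish [EE 2] 1"
  by (rule holdsI[where rs="
      [(0, [])]"],
    code_simp, simp only: parts_simps known)

section \<open>Admirable moves second\<close>

lemma [known]: "holds Admirable [AI 1, II 1] (-2)"
  by (rule holdsI[where rs="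
      [(0, []), (0, [])]"],
    code_simp, simp only: parts_simps known)

lemma [known]: "holds Admirable [AI 1, AI 1] 0"
  by (rule holdsI[where rs="
      [(0, [])]"],
    code_simp, simp only: parts_simps known)

lemma [known]: "holds Admirable [II 1, II 1] 0"
  by (rule holdsI[where rs="
      [(0, [])]"],
    code_simp, simp only: parts_simps known)

lemma [known]: "holds Admirable [AI 1, AI 2, II 1] (-1)"
  by (rule holdsI[where rs="
      [(0, [([AI 1, II 1], -2)]), (1, [([II 1, II 1], 0)]), (0, [([AI 1, II 1], -2)]),
      (1, [([AI 1, AI 1], 0)])]"],
    code_simp, simp only: parts_simps known)

lemma [known]: "holds Admirable [AI 2, AI 2] (-2)"
  by (rule holdsI[where rs="
      [(1, [([AI 1, II 1], -2)]), (1, [([AI 1, AI 1], 0)])]"],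
    code_simp, simp only: parts_simps known)

lemma [known]: "holds Admirable [AI 1, AI 2, AI 2, II 1] 0"
  by (rule holdsI[where rs="
      [(0, [([AI 1, AI 2, II 1], -1)]), (2, [([AI 1, AI 1], 0), ([II 1, II 1], 0)]), (0, [([AI 1,
      AI 2, II 1], -1)]), (0, [([AI 2, AI 2], -2)])]"],
    code_simp, simp only: parts_simps known)

lemma [known]: "holds Admirable [AI 2, AI 2, II 4] (-1)"
  by (rule holdsI[where rs="
      [(4, [([AI 1, AI 2, AI 2, II 1], 0)]), (4, [([AI 1, AI 1], 0), ([AI 2, AI 2], -2)]),
      (1, [([AI 1, AI 1], 0), ([AI 2, AI 2], -2)]), (1, [([AI 1, AI 2, AI 2, II 1], 0)])]"],
    code_simp, simp only: parts_simps known)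

lemma [known]: "holds Admirable [AI 1, II 3] 0"
  by (rule holdsI[where rs="
      [(1, [([AI 1, AI 1], 0)]), (0, [([AI 1, AI 1], 0)]), (2, [([II 1, II 1], 0)])]"],
    code_simp, simp only: parts_simps known)

text \<open>The worst attack is next to Admirable's label: it produces A I A I, where all three
  edges count 1.\<close>

lemma [known]: "holds Admirable [AI 2] (-3)"
  by (rule holdsI[where rs="
      [(0, []), (0, [])]"],
    code_simp, simp only: parts_simps known)

lemma [known]: "holds Admirable [II 2] (-1)"
  by (rule holdsI[where rs="
      [(0, [])]"],
    code_simp, simp only: parts_simps known)

lemma [known]: "holds Admirable [AI 1, II 5] (-2)"
  by (rule holdsI[where rs="
      [(2, [([AI 2, AI 2], -2)]), (1, [([AI 1, AI 1], 0), ([AI 2], -3)]), (0, [([AI 1,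
      II 3], 0)]), (0, [([AI 1, AI 1], 0), ([II 2], -1)])]"],
    code_simp, simp only: parts_simps known)

lemma [known]: "holds Admirable [AI 2, II 1, II 5] (-3)"
  by (rule holdsI[where rs="
      [(4, [([II 1, II 1], 0), ([AI 2, AI 2], -2)]), (1, [([AI 1, II 5], -2)]), (0, [([AI 1,
      II 5], -2)]), (1, [([AI 1, AI 2, AI 2, II 1], 0)]), (1, [([II 1, II 1], 0), ([AI 2,
      AI 2], -2)]), (4, [([AI 1, II 1], -2), ([II 2], -1), ([II 2], -1)])]"],
    code_simp, simp only: parts_simps known)

lemma [known]: "holds Admirable [AA 2] (-1)"
  by (rule holdsI[where rs="
      [(0, [])]"],
    code_simp, simp only: parts_simps known)

lemma [known]: "holds Admirable [AI 2, II 4] (-2)"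
  by (rule holdsI[where rs="
      [(2, [([AI 1, AI 2, II 1], -1)]), (2, [([AI 1, AI 1], 0), ([AI 2], -3)]), (3, [([AI 1,
      II 3], 0)]), (3, [([AI 1, II 1], -2), ([II 2], -1)])]"],
    code_simp, simp only: parts_simps known)

lemma [known]: "holds Admirable [AI 5, II 1] (-2)"
  by (rule holdsI[where rs="
      [(1, [([AI 1, AI 2, II 1], -1)]), (4, [([AI 1, II 3], 0)]), (0, [([AI 1, II 1], -2),
      ([II 2], -1)]), (0, [([II 1, II 1], 0), ([AI 2], -3)]), (2, [([AI 1, II 1], -2),
      ([AA 2], -1)]), (2, [([AA 2], -1), ([AI 2], -3)])]"],
    code_simp, simp only: parts_simps known)

lemma [known]: "holds Admirable [AA 3, AI 1] 0"
  by (rule holdsI[where rs="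
      [(0, [([AI 1, AI 1], 0)]), (0, [([AI 1, AI 1], 0)]), (0, [([AA 2], -1)])]"],
    code_simp, simp only: parts_simps known)

lemma [known]: "holds Admirable [AI 5, II 5] (-2)"
  by (rule holdsI[where rs="
      [(6, [([AI 2, AI 2, II 4], -1)]), (6, [([AI 1, II 3], 0), ([AI 2, AI 2], -2)]), (0, [([AI 1,
      II 5], -2), ([II 2], -1)]), (0, [([AI 2, II 1, II 5], -3)]), (2, [([AI 1, II 5], -2),
      ([AA 2], -1)]), (6, [([AA 2], -1), ([AI 2, II 4], -2)]), (2, [([AI 1, AI 1], 0), ([AI 5,
      II 1], -2)]), (7, [([AA 3, AI 1], 0), ([II 2], -1), ([II 2], -1)])]"],
    code_simp, simp only: parts_simps known)

lemma [known]: "holds Admirable [AA 3, II 1] (-2)"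
  by (rule holdsI[where rs="
      [(0, [([AI 1, II 1], -2)]), (0, [([AI 1, II 1], -2)]), (0, [([AA 2], -1)])]"],
    code_simp, simp only: parts_simps known)

lemma [known]: "holds Admirable [AA 4, AI 2] (-2)"
  by (rule holdsI[where rs="
      [(0, [([AI 2, AI 2], -2)]), (0, [([AI 2, AI 2], -2)]), (1, [([AA 3, II 1], -2)]),
      (1, [([AA 3, AI 1], 0)])]"],
    code_simp, simp only: parts_simps known)

lemma [known]: "holds Admirable [AI 2, AI 6] (-2)"
  by (rule holdsI[where rs="
      [(1, [([AI 5, II 1], -2)]), (4, [([AA 3, AI 1], 0), ([AI 2], -3)]), (5, [([AI 1,
      II 5], -2)]), (0, [([AI 2, II 4], -2)]), (0, [([AI 1, II 3], 0), ([AI 2], -3)]),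
      (0, [([AI 2, AI 2], -2), ([II 2], -1)]), (2, [([AI 1, AI 2, II 1], -1), ([AA 2], -1)]),
      (2, [([AA 2], -1), ([AI 2, AI 2], -2)])]"],
    code_simp, simp only: parts_simps known)

lemma [known]: "holds Admirable [AI 4] (-1)"
  by (rule holdsI[where rs="
      [(1, [([AI 1, AI 1], 0)]), (0, [([II 2], -1)]), (0, [([AI 1, II 1], -2)]),
      (0, [([AI 2], -3)])]"],
    code_simp, simp only: parts_simps known)

lemma [known]: "holds Admirable [AI 6, AI 6] (-2)"
  by (rule holdsI[where rs="
      [(5, [([AI 5, II 5], -2)]), (8, [([AA 3, AI 1], 0), ([AI 2, II 4], -2)]), (9, [([AI 1,
      II 3], 0), ([AA 4, AI 2], -2)]), (0, [([AI 2, AI 6], -2), ([II 2], -1)]), (5, [([AI 5,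
      II 1], -2), ([AI 4], -1)]), (2, [([AA 2], -1), ([AI 2, AI 6], -2)])]"],
    code_simp, simp only: parts_simps known)

lemma [known]: "holds Admirable [AI 1, AI 7] (-2)"
  by (rule holdsI[where rs="
      [(2, [([AA 2], -1), ([AI 4], -1)]), (1, [([AI 1, AI 1], 0), ([AI 4], -1)]), (0, [([AI 1,
      II 5], -2)]), (6, [([AI 2, II 4], -2)]), (0, [([AI 1, II 3], 0), ([AI 2], -3)]),
      (6, [([II 2], -1), ([AI 4], -1)]), (6, [([AI 5, II 1], -2)]), (3, [([AA 3, AI 1], 0),
      ([AI 2], -3)])]"],
    code_simp, simp only: parts_simps known)

lemma [known]: "holds Admirable [AI 2, AI 3, II 1] (-3)"
  by (rule holdsI[where rs="
      [(1, [([II 1, II 1], 0), ([AI 2], -3)]), (1, [([AI 1, AI 2, II 1], -1)]), (2, [([AI 1,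
      II 1], -2), ([II 2], -1)]), (0, [([II 1, II 1], 0), ([AI 2], -3)]), (4, [([AI 2,
      AI 2], -2)]), (2, [([AI 2, AI 2], -2)])]"],
    code_simp, simp only: parts_simps known)

lemma [known]: "holds Admirable [AI 3, AI 5] (-2)"
  by (rule holdsI[where rs="
      [(2, [([II 2], -1), ([AI 4], -1)]), (0, [([AI 5, II 1], -2)]), (2, [([AI 2], -3),
      ([AI 4], -1)]), (4, [([AI 2, II 4], -2)]), (4, [([AI 1, II 3], 0), ([AI 2], -3)]),
      (4, [([AI 2, AI 2], -2), ([II 2], -1)]), (0, [([AI 2, AI 3, II 1], -3)]), (4, [([AI 2], -3),
      ([AI 4], -1)])]"],
    code_simp, simp only: parts_simps known)

lemma [known]: "holds Admirable [AA 6] (-1)"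
  by (rule holdsI[where rs="
      [(0, [([AI 4], -1)]), (0, [([AI 4], -1)]), (2, [([AI 2, AI 2], -2)])]"],
    code_simp, simp only: parts_simps known)

lemma [known]: "holds Admirable [AI 3, II 3] (-2)"
  by (rule holdsI[where rs="
      [(0, [([AI 1, II 3], 0)]), (1, [([AI 1, II 3], 0)]), (0, [([AI 1, II 3], 0)]),
      (2, [([AI 2], -3), ([II 2], -1)]), (2, [([II 1, II 1], 0), ([AI 2], -3)])]"],
    code_simp, simp only: parts_simps known)

lemma [known]: "holds Admirable [AI 6] (-3)"
  by (rule holdsI[where rs="
      [(0, [([AI 4], -1)]), (2, [([AI 1, AI 1], 0), ([AI 2], -3)]), (0, [([AI 1, II 3], 0)]),
      (0, [([AI 2], -3), ([II 2], -1)]), (4, [([AI 4], -1)]), (0, [([AI 4], -1)])]"],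
    code_simp, simp only: parts_simps known)

text \<open>On 16 vertices, Impish has opened at one end and Admirable has taken the other.\<close>

lemma [known]: "holds Admirable [AI 14] (-3)"
  by (rule holdsI[where rs="
      [(6, [([AI 6, AI 6], -2)]), (5, [([AI 1, AI 7], -2), ([AI 4], -1)]), (6, [([AI 2,
      AI 6], -2), ([AI 4], -1)]), (7, [([AI 3, AI 5], -2), ([AI 4], -1)]), (5, [([AI 1,
      AI 7], -2), ([AI 4], -1)]), (8, [([AI 3, AI 5], -2), ([AI 4], -1)]), (6, [([AI 6,
      AI 6], -2)]), (8, [([AI 1, AI 7], -2), ([AI 4], -1)]), (2, [([AA 2], -1), ([AI 5,
      II 5], -2)]), (6, [([AI 2, II 4], -2), ([AA 6], -1)]), (6, [([AI 3, II 3], -2),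
      ([AA 6], -1)]), (6, [([II 2], -1), ([AI 4], -1), ([AA 6], -1)]), (6, [([AI 5, II 1], -2),
      ([AA 6], -1)]), (6, [([AA 6], -1), ([AI 6], -3)])]"],
    code_simp, simp only: parts_simps known)

section \<open>Runs that reach an end of the path\<close>

lemma Admirable_AE2 [known]: "holds Admirable [AE 2] (-2)"
  by (rule holdsI[where rs="
      [(0, []), (0, [])]"],
    code_simp, simp only: parts_simps known)

lemma [known]: "holds Admirable [IE 1, IE 1] 0"
  by (rule holdsI[where rs="
      [(0, [])]"],
    code_simp, simp only: parts_simps known)

lemma [known]: "holds Admirable [AI 1, IE 1] (-1)"
  by (rule holdsI[where rs="
      [(0, []), (0, [])]"],
    code_simp, simp only: parts_simps known)

lemma [known]: "holds Admirable [AA 3, AI 2, II 1] (-1)"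
  by (rule holdsI[where rs="
      [(0, [([AI 1, AI 2, II 1], -1)]), (0, [([AI 1, AI 2, II 1], -1)]), (1, [([II 1, II 1], 0),
      ([AA 2], -1)]), (0, [([AA 3, II 1], -2)]), (3, [([AA 3, AI 1], 0)])]"],
    code_simp, simp only: parts_simps known)

lemma [known]: "holds Admirable [AA 3, IE 1] (-1)"
  by (rule holdsI[where rs="
      [(0, [([AI 1, IE 1], -1)]), (0, [([AI 1, IE 1], -1)]), (0, [([AA 2], -1)])]"],
    code_simp, simp only: parts_simps known)

lemma [known]: "holds Admirable [AI 2, AI 2, II 1, IE 1] (-1)"
  by (rule holdsI[where rs="
      [(1, [([AI 1, IE 1], -1), ([II 1, II 1], 0)]), (4, [([AI 1, AI 2, II 1], -1)]), (4, [([AI 2,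
      AI 2], -2)]), (0, [([AI 1, AI 2, II 1], -1)])]"],
    code_simp, simp only: parts_simps known)

lemma [known]: "holds Admirable [AA 4, AI 2, II 1, IE 1] (-1)"
  by (rule holdsI[where rs="
      [(0, [([AI 2, AI 2, II 1, IE 1], -1)]), (0, [([AI 2, AI 2, II 1, IE 1], -1)]), (1, [([II 1,
      II 1], 0), ([AA 3, IE 1], -1)]), (1, [([AI 1, II 1], -2), ([AA 3, IE 1], -1)]), (6, [([AA 4,
      AI 2], -2)]), (0, [([AA 3, AI 2, II 1], -1)])]"],
    code_simp, simp only: parts_simps known)

lemma [known]: "holds Admirable [II 6] (-1)"
  by (rule holdsI[where rs="
      [(0, [([AI 4], -1)]), (2, [([AI 1, AI 2, II 1], -1)]), (0, [([AI 1, II 3], 0)])]"],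
    code_simp, simp only: parts_simps known)

lemma [known]: "holds Admirable [AI 2, AI 2, AI 2] (-1)"
  by (rule holdsI[where rs="
      [(1, [([AI 1, AI 2, II 1], -1)]), (0, [([AI 2, AI 2], -2)])]"],
    code_simp, simp only: parts_simps known)

lemma [known]: "holds Admirable [II 3, IE 1] (-1)"
  by (rule holdsI[where rs="
      [(2, [([II 2], -1)]), (2, [([II 1, II 1], 0)]), (1, [([AI 1, AI 1], 0)])]"],
    code_simp, simp only: parts_simps known)

lemma [known]: "holds Admirable [AI 2, AI 7, IE 1] (-2)"
  by (rule holdsI[where rs="
      [(5, [([AA 4, AI 2, II 1, IE 1], -1)]), (8, [([AI 1, AI 7], -2)]), (6, [([AI 1, IE 1], -1),
      ([II 6], -1)]), (3, [([AI 1, IE 1], -1), ([AI 2, AI 2, AI 2], -1)]), (8, [([AI 2, AI 2,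
      II 4], -1)]), (0, [([II 3, IE 1], -1), ([AI 2, AI 2], -2)]), (6, [([AI 1, IE 1], -1),
      ([II 2], -1), ([AI 4], -1)]), (6, [([AI 1, IE 1], -1), ([AI 5, II 1], -2)]), (8, [([AI 2,
      AI 6], -2)]), (0, [([AI 1, AI 7], -2)])]"],
    code_simp, simp only: parts_simps known)

lemma [known]: "holds Admirable [II 4] (-3)"
  by (rule holdsI[where rs="
      [(0, [([AI 2], -3)]), (0, [([II 2], -1)])]"],
    code_simp, simp only: parts_simps known)

lemma [known]: "holds Admirable [AA 1, AE 1] (-1)"
  by (rule holdsI[where rs="
      [(0, []), (0, [])]"],
    code_simp, simp only: parts_simps known)

lemma [known]: "holds Admirable [AI 5, AE 1] (-3)"
  by (rule holdsI[where rs="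
      [(4, [([II 4], -3)]), (4, [([AI 1, II 3], 0)]), (4, [([AI 2], -3), ([II 2], -1)]),
      (1, [([AA 1, AE 1], -1), ([AI 1, II 1], -2)]), (4, [([AI 4], -1)]), (0, [([AI 4], -1)])]"],
    code_simp, simp only: parts_simps known)

lemma [known]: "holds Admirable [AE 1, IE 1] (-2)"
  by (rule holdsI[where rs="
      [(0, []), (0, [])]"],
    code_simp, simp only: parts_simps known)

lemma [known]: "holds Admirable [II 1, IE 1] (-1)"
  by (rule holdsI[where rs="
      [(0, []), (0, [])]"],
    code_simp, simp only: parts_simps known)

lemma [known]: "holds Admirable [AI 2, AE 1, IE 1] (-1)"
  by (rule holdsI[where rs="
      [(1, [([II 1, IE 1], -1)]), (0, [([AE 1, IE 1], -2)]), (0, [([AI 1, IE 1], -1)]),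
      (2, [([AI 2], -3)])]"],
    code_simp, simp only: parts_simps known)

lemma [known]: "holds Admirable [AE 1, II 10, IE 1] (-3)"
  by (rule holdsI[where rs="
      [(2, [([AI 2, AI 7, IE 1], -2)]), (4, [([AE 1, IE 1], -2), ([AI 4], -1), ([AI 4], -1)]),
      (3, [([AI 2, AE 1, IE 1], -1), ([AI 5, II 1], -2)]), (4, [([AI 2, AE 1, IE 1], -1),
      ([II 2], -1), ([AI 4], -1)]), (9, [([II 3, IE 1], -1), ([II 6], -1)]), (1, [([AI 1,
      II 5], -2), ([AI 2, AE 1, IE 1], -1)]), (5, [([AI 5, AE 1], -3), ([AI 4], -1)])]"],
    code_simp, simp only: parts_simps known)

lemma [known]: "holds Admirable [AI 1, AE 2, IE 1] (-1)"
  by (rule holdsI[where rs="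
      [(0, [([AE 1, IE 1], -2)]), (1, [([IE 1, IE 1], 0)]), (0, [([AI 1, IE 1], -1)]),
      (0, [([AE 2], -2)])]"],
    code_simp, simp only: parts_simps known)

lemma [known]: "holds Admirable [AI 2, AE 2, II 1, IE 1] (-2)"
  by (rule holdsI[where rs="
      [(1, [([AE 1, IE 1], -2), ([II 1, II 1], 0)]), (0, [([II 1, IE 1], -1), ([AE 2], -2)]),
      (1, [([AI 1, II 1], -2), ([IE 1, IE 1], 0)]), (4, [([AI 1, AI 2, II 1], -1)]), (0, [([AI 1,
      AE 2, IE 1], -1)]), (0, [([AI 1, II 1], -2), ([AE 2], -2)])]"],
    code_simp, simp only: parts_simps known)

lemma [known]: "holds Admirable [AI 3, AE 2, IE 1] (-3)"
  by (rule holdsI[where rs="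
      [(2, [([AE 1, IE 1], -2), ([II 2], -1)]), (0, [([II 1, IE 1], -1), ([AE 2], -2)]),
      (0, [([AI 1, AE 2, IE 1], -1)]), (1, [([IE 1, IE 1], 0), ([AI 2], -3)]), (1, [([AI 1,
      IE 1], -1), ([AI 2], -3)]), (0, [([AI 2], -3), ([AE 2], -2)])]"],
    code_simp, simp only: parts_simps known)

text \<open>Impish has opened at the second of 16 vertices; Admirable's answer leaves two free
  vertices at the far end.\<close>

lemma [known]: "holds Admirable [AI 11, AE 2, IE 1] (-3)"
  by (rule holdsI[where rs="
      [(10, [([AE 1, II 10, IE 1], -3)]), (2, [([AI 1, AE 2, IE 1], -1), ([AI 1, AI 7], -2)]),
      (3, [([AI 1, AE 2, IE 1], -1), ([AI 2, AI 6], -2)]), (4, [([AI 1, AE 2, IE 1], -1), ([AI 3,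
      AI 5], -2)]), (10, [([AE 1, IE 1], -2), ([AI 4], -1), ([II 6], -1)]), (10, [([AE 1,
      IE 1], -2), ([AI 5, II 5], -2)]), (7, [([AI 1, AE 2, IE 1], -1), ([AI 2, AI 6], -2)]),
      (8, [([AI 1, AE 2, IE 1], -1), ([AI 1, AI 7], -2)]), (6, [([AI 1, AE 2, IE 1], -1),
      ([II 2], -1), ([AA 6], -1)]), (6, [([AI 2, AE 2, II 1, IE 1], -2), ([AA 6], -1)]),
      (6, [([AI 3, AE 2, IE 1], -3), ([AA 6], -1)]), (7, [([IE 1, IE 1], 0), ([AI 4], -1),
      ([AA 6], -1)]), (7, [([AI 1, IE 1], -1), ([AI 4], -1), ([AA 6], -1)]), (6, [([AE 2], -2),
      ([AI 4], -1), ([AA 6], -1)])]"],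
    code_simp, simp only: parts_simps known)

lemma [known]: "holds Admirable [AI 1, AE 1] (-1)"
  by (rule holdsI[where rs="
      [(0, []), (0, [])]"],
    code_simp, simp only: parts_simps known)

lemma [known]: "holds Admirable [AI 1, IE 3] (-1)"
  by (rule holdsI[where rs="
      [(1, [([AI 1, AE 1], -1)]), (0, [([AI 1, AE 1], -1)]), (2, [([II 1, IE 1], -1)]),
      (2, [([II 2], -1)])]"],
    code_simp, simp only: parts_simps known)

lemma [known]: "holds Admirable [IE 2] (-2)"
  by (rule holdsI[where rs="
      [(0, []), (0, [])]"],
    code_simp, simp only: parts_simps known)

lemma [known]: "holds Admirable [AI 1, AI 3] (-2)"
  by (rule holdsI[where rs="
      [(0, [([AI 2], -3)]), (2, [([II 2], -1)]), (0, [([AI 1, II 1], -2)]), (2, [([AI 2], -3)])]"],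
    code_simp, simp only: parts_simps known)

lemma [known]: "holds Admirable [AE 4, IE 2] (-2)"
  by (rule holdsI[where rs="
      [(4, [([AI 1, IE 3], -1)]), (2, [([AI 1, AI 1], 0), ([IE 2], -2)]), (0, [([AI 1, IE 1], -1),
      ([IE 2], -2)]), (4, [([AI 1, AI 3], -2)]), (3, [([AE 1, IE 1], -2), ([AA 2], -1)]),
      (4, [([AA 3, II 1], -2)])]"],
    code_simp, simp only: parts_simps known)

lemma Admirable_AE4 [known]: "holds Admirable [AE 4] (-2)"
  by (rule holdsI[where rs="
      [(1, [([AI 1, AE 1], -1)]), (0, [([IE 2], -2)]), (0, [([AI 1, IE 1], -1)]),
      (0, [([AI 2], -3)])]"],
    code_simp, simp only: parts_simps known)

lemma [known]: "holds Admirable [AI 1, AE 4, II 1] (-2)"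
  by (rule holdsI[where rs="
      [(3, [([AA 3, II 1], -2)]), (2, [([AI 1, AI 2, II 1], -1)]), (2, [([AI 1, AI 1], 0), ([AI 1,
      II 1], -2)]), (2, [([AI 1, AI 2, II 1], -1)]), (0, [([AI 1, AI 2, II 1], -1)]),
      (0, [([AE 4], -2)])]"],
    code_simp, simp only: parts_simps known)

lemma [known]: "holds Admirable [AI 7, AE 1, IE 2] (-3)"
  by (rule holdsI[where rs="
      [(6, [([IE 2], -2), ([II 6], -1)]), (6, [([AI 1, II 5], -2), ([IE 2], -2)]), (6, [([AI 2,
      II 4], -2), ([IE 2], -2)]), (6, [([IE 2], -2), ([AI 3, II 3], -2)]), (6, [([II 2], -1),
      ([IE 2], -2), ([AI 4], -1)]), (6, [([AI 5, II 1], -2), ([IE 2], -2)]), (6, [([IE 2], -2),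
      ([AI 6], -3)]), (8, [([AI 1, AI 7], -2)]), (1, [([AE 1, IE 1], -2), ([AI 6], -3)]),
      (2, [([AA 1, AE 1], -1), ([AI 5, II 1], -2)])]"],
    code_simp, simp only: parts_simps known)

lemma [known]: "holds Admirable [AI 1, AI 2, IE 1, IE 2] (-2)"
  by (rule holdsI[where rs="
      [(0, [([AI 1, IE 1], -1), ([IE 2], -2)]), (4, [([AI 1, AI 1], 0), ([II 1, IE 1], -1)]),
      (0, [([AI 1, IE 1], -1), ([IE 2], -2)]), (1, [([AI 1, AI 1], 0), ([IE 2], -2)]),
      (1, [([IE 1, IE 1], 0), ([AI 2], -3)]), (4, [([AI 1, AI 2, II 1], -1)])]"],
    code_simp, simp only: parts_simps known)

lemma [known]: "holds Admirable [AA 4, AI 1, IE 1, IE 2] (-2)"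
  by (rule holdsI[where rs="
      [(0, [([AI 1, AI 2, IE 1, IE 2], -2)]), (0, [([AI 1, AI 2, IE 1, IE 2], -2)]), (0, [([AA 3,
      IE 1], -1), ([IE 2], -2)]), (0, [([AA 3, AI 1], 0), ([IE 2], -2)]), (1, [([AI 1, IE 1], -1),
      ([AA 3, IE 1], -1)]), (1, [([AI 1, II 1], -2), ([AA 3, IE 1], -1)])]"],
    code_simp, simp only: parts_simps known)

lemma [known]: "holds Admirable [II 1, IE 1, IE 2] (-1)"
  by (rule holdsI[where rs="
      [(0, [([IE 2], -2)]), (2, [([AI 1, II 1], -2)]), (1, [([IE 1, IE 1], 0)]), (2, [([II 1,
      II 1], 0)])]"],
    code_simp, simp only: parts_simps known)

lemma [known]: "holds Admirable [AI 1, AI 2, AI 2, IE 1, IE 2] (-1)"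
  by (rule holdsI[where rs="
      [(0, [([AI 1, AI 2, IE 1, IE 2], -2)]), (2, [([AI 1, AI 1], 0), ([II 1, IE 1, IE 2], -1)]),
      (0, [([AI 1, AI 2, IE 1, IE 2], -2)]), (6, [([AI 1, AI 1], 0), ([AI 2, AI 2], -2)]),
      (1, [([IE 1, IE 1], 0), ([AI 2, AI 2], -2)]), (1, [([AI 2, AI 2, II 1, IE 1], -1)])]"],
    code_simp, simp only: parts_simps known)

lemma [known]: "holds Admirable [AA 4, AI 1, AI 2, IE 1, IE 2] (-1)"
  by (rule holdsI[where rs="
      [(0, [([AI 1, AI 2, AI 2, IE 1, IE 2], -1)]), (0, [([AI 1, AI 2, AI 2, IE 1, IE 2], -1)]),
      (4, [([AA 4, AI 1, IE 1, IE 2], -2)]), (1, [([AA 3, AI 1], 0), ([II 1, IE 1, IE 2], -1)]),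
      (0, [([AA 4, AI 1, IE 1, IE 2], -2)]), (8, [([AI 1, AI 1], 0), ([AA 4, AI 2], -2)]),
      (5, [([IE 1, IE 1], 0), ([AA 4, AI 2], -2)]), (5, [([AA 4, AI 2, II 1, IE 1], -1)])]"],
    code_simp, simp only: parts_simps known)

lemma [known]: "holds Admirable [AA 4, AI 1, AI 2, II 1] 0"
  by (rule holdsI[where rs="
      [(0, [([AI 1, AI 2, AI 2, II 1], 0)]), (0, [([AI 1, AI 2, AI 2, II 1], 0)]), (0, [([AA 3,
      AI 2, II 1], -1)]), (1, [([AA 3, AI 1], 0), ([II 1, II 1], 0)]), (1, [([AI 1, AI 1], 0),
      ([AA 3, II 1], -2)]), (4, [([AA 4, AI 2], -2)])]"],
    code_simp, simp only: parts_simps known)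

lemma [known]: "holds Admirable [AI 1, AE 1, IE 2] (-1)"
  by (rule holdsI[where rs="
      [(0, [([IE 2], -2)]), (2, [([AI 1, AI 1], 0)]), (1, [([AE 1, IE 1], -2)]), (2, [([AI 1,
      II 1], -2)])]"],
    code_simp, simp only: parts_simps known)

lemma [known]: "holds Admirable [AI 1, AI 7, AE 2, IE 2] (-2)"
  by (rule holdsI[where rs="
      [(7, [([AI 7, AE 1, IE 2], -3)]), (7, [([AI 1, AE 1, IE 2], -1), ([II 6], -1)]),
      (7, [([AI 1, AE 1, IE 2], -1), ([AI 1, II 5], -2)]), (7, [([AI 1, AE 1, IE 2], -1), ([AI 2,
      II 4], -2)]), (7, [([AI 1, AE 1, IE 2], -1), ([AI 3, II 3], -2)]), (7, [([AI 1, AE 1,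
      IE 2], -1), ([II 2], -1), ([AI 4], -1)]), (7, [([AI 1, AE 1, IE 2], -1), ([AI 5,
      II 1], -2)]), (7, [([AI 1, AE 1, IE 2], -1), ([AI 6], -3)]), (6, [([AA 4, AI 1, AI 2, IE 1,
      IE 2], -1)]), (10, [([AI 1, AI 1], 0), ([AI 1, AI 7], -2)]), (2, [([AI 1, AE 2, IE 1], -1),
      ([AI 6], -3)]), (6, [([AA 4, AI 1, AI 2, II 1], 0), ([AE 2], -2)])]"],
    code_simp, simp only: parts_simps known)

lemma [known]: "holds Admirable [IE 2, IE 2] (-2)"
  by (rule holdsI[where rs="
      [(0, [([IE 2], -2)]), (2, [([AI 1, II 1], -2)])]"],
    code_simp, simp only: parts_simps known)

lemma [known]: "holds Admirable [AI 1, AI 3, IE 2] (-2)"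
  by (rule holdsI[where rs="
      [(4, [([AI 1, AI 3], -2)]), (4, [([AI 1, AI 1], 0), ([II 2], -1)]), (4, [([AI 1, AI 1], 0),
      ([AI 1, II 1], -2)]), (0, [([AI 1, AI 1], 0), ([IE 2], -2)]), (0, [([AI 1, AI 3], -2)]),
      (2, [([AI 1, AI 2, II 1], -1)])]"],
    code_simp, simp only: parts_simps known)

text \<open>Against openings at the third to sixth of 16 vertices Admirable leaves exactly one free
  vertex between the two labels. This vertex is worth 0 to both players and provides a spare
  move.\<close>

lemma [known]: "holds Admirable [AI 1, AE 11, IE 2] (-3)"
  by (rule holdsI[where rs="
      [(6, [([AE 4, IE 2], -2), ([AA 6], -1)]), (7, [([AI 1, AI 7, AE 2, IE 2], -2)]),
      (5, [([AI 1, AI 1], 0), ([AE 4, IE 2], -2), ([AI 4], -1)]), (8, [([AI 1, AE 1, IE 2], -1),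
      ([AI 2, AI 6], -2)]), (8, [([AI 1, AE 1, IE 2], -1), ([AI 3, AI 5], -2)]), (5, [([AI 1,
      AI 1], 0), ([AE 4, IE 2], -2), ([AI 4], -1)]), (8, [([AI 1, AE 1, IE 2], -1), ([AI 3,
      AI 5], -2)]), (8, [([AI 1, AE 1, IE 2], -1), ([AI 2, AI 6], -2)]), (12, [([AI 1, IE 3], -1),
      ([AI 1, AI 7], -2)]), (0, [([AI 1, AI 7], -2), ([IE 2, IE 2], -2)]), (4, [([AA 4, AI 1,
      IE 1, IE 2], -2), ([AI 4], -1)]), (6, [([AI 1, AI 3, IE 2], -2), ([AA 6], -1)]),
      (8, [([AI 1, IE 1], -1), ([AE 4], -2), ([AA 6], -1)]), (8, [([AI 1, AE 4, II 1], -2),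
      ([AA 6], -1)])]"],
    code_simp, simp only: parts_simps known)

lemma [known]: "holds Admirable [AE 3, IE 3] (-2)"
  by (rule holdsI[where rs="
      [(1, [([AI 1, IE 3], -1)]), (1, [([AI 1, IE 3], -1)]), (0, [([AI 1, IE 3], -1)]),
      (2, [([AE 2], -2), ([IE 2], -2)]), (2, [([II 1, IE 1], -1), ([AE 2], -2)]),
      (2, [([AE 2], -2), ([II 2], -1)])]"],
    code_simp, simp only: parts_simps known)

lemma [known]: "holds Admirable [AI 1, AE 3] (-1)"
  by (rule holdsI[where rs="
      [(0, [([AE 2], -2)]), (1, [([AI 1, AI 1], 0)]), (0, [([AI 1, IE 1], -1)]), (0, [([AI 1,
      AI 1], 0)])]"],
    code_simp, simp only: parts_simps known)

lemma [known]: "holds Admirable [AE 1, AE 1] 0"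
  by (rule holdsI[where rs="
      [(0, [])]"],
    code_simp, simp only: parts_simps known)

lemma [known]: "holds Admirable [AI 1, AI 2, AI 7] (-1)"
  by (rule holdsI[where rs="
      [(0, [([AI 1, AI 7], -2)]), (6, [([AA 4, AI 1, AI 2, II 1], 0)]), (0, [([AI 1, AI 7], -2)]),
      (7, [([AI 1, AI 1], 0), ([II 6], -1)]), (7, [([AI 1, AI 1], 0), ([AI 1, II 5], -2)]),
      (6, [([AI 2, AI 2, II 4], -1)]), (7, [([AI 1, AI 3], -2), ([AI 1, II 3], 0)]), (7, [([AI 1,
      AI 1], 0), ([II 2], -1), ([AI 4], -1)]), (7, [([AI 1, AI 1], 0), ([AI 5, II 1], -2)]),
      (6, [([AI 2, AI 6], -2)])]"],
    code_simp, simp only: parts_simps known)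

lemma [known]: "holds Admirable [AI 1, AI 7, AE 1, IE 3] (-2)"
  by (rule holdsI[where rs="
      [(9, [([AI 1, AI 7], -2), ([AE 1, AE 1], 0)]), (7, [([AI 1, IE 3], -1), ([II 6], -1)]),
      (7, [([AI 1, IE 3], -1), ([AI 1, II 5], -2)]), (7, [([AI 1, IE 3], -1), ([AI 2,
      II 4], -2)]), (1, [([AA 1, AE 1], -1), ([AI 1, II 3], 0), ([AI 1, IE 3], -1)]), (7, [([AI 1,
      IE 3], -1), ([II 2], -1), ([AI 4], -1)]), (7, [([AI 1, IE 3], -1), ([AI 5, II 1], -2)]),
      (7, [([AI 1, IE 3], -1), ([AI 6], -3)]), (10, [([AI 1, AI 2, AI 7], -1)]), (2, [([AI 7,
      AE 1, IE 2], -3)]), (10, [([AI 1, AI 7], -2), ([II 1, IE 1], -1)]), (10, [([AI 1,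
      AI 7], -2), ([II 2], -1)])]"],
    code_simp, simp only: parts_simps known)

lemma [known]: "holds Admirable [IE 1, IE 3] (-2)"
  by (rule holdsI[where rs="
      [(0, [([AE 2], -2)]), (2, [([IE 2], -2)]), (0, [([IE 1, IE 1], 0)]), (2, [([II 2], -1)])]"],
    code_simp, simp only: parts_simps known)

lemma [known]: "holds Admirable [AI 1, AI 2, IE 3] (-2)"
  by (rule holdsI[where rs="
      [(0, [([AI 1, IE 3], -1)]), (4, [([AI 1, AI 2, II 1], -1)]), (0, [([AI 1, IE 3], -1)]),
      (3, [([AI 1, AI 1], 0), ([IE 2], -2)]), (1, [([AI 1, AI 2, II 1], -1)]), (3, [([AI 1,
      AI 1], 0), ([II 2], -1)])]"],
    code_simp, simp only: parts_simps known)

lemma [known]: "holds Admirable [AI 1, AE 10, IE 3] (-3)"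
  by (rule holdsI[where rs="
      [(6, [([AE 3, IE 3], -2), ([AA 6], -1)]), (7, [([AI 1, AI 7, AE 1, IE 3], -2)]),
      (5, [([AI 1, AE 3], -1), ([AI 1, IE 3], -1), ([AI 4], -1)]), (8, [([AI 1, IE 3], -1),
      ([AI 2, AI 6], -2)]), (8, [([AI 1, IE 3], -1), ([AI 3, AI 5], -2)]), (5, [([AI 1,
      AE 3], -1), ([AI 1, IE 3], -1), ([AI 4], -1)]), (8, [([AI 1, IE 3], -1), ([AI 3,
      AI 5], -2)]), (8, [([AI 1, IE 3], -1), ([AI 2, AI 6], -2)]), (7, [([AI 1, AI 7, AE 1,
      IE 3], -2)]), (6, [([AI 1, AI 1], 0), ([IE 1, IE 3], -2), ([AA 6], -1)]), (6, [([AI 1, AI 2,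
      IE 3], -2), ([AA 6], -1)]), (9, [([AI 1, AE 3], -1), ([IE 2], -2), ([AA 6], -1)]),
      (9, [([AI 1, AE 3], -1), ([II 1, IE 1], -1), ([AA 6], -1)]), (9, [([AI 1, AE 3], -1),
      ([II 2], -1), ([AA 6], -1)])]"],
    code_simp, simp only: parts_simps known)

lemma [known]: "holds Admirable [AE 1, II 1] (-3)"
  by (rule holdsI[where rs="
      [(0, []), (0, [])]"],
    code_simp, simp only: parts_simps known)

lemma [known]: "holds Admirable [AI 1, AE 2, II 1] (-2)"
  by (rule holdsI[where rs="
      [(0, [([AE 1, II 1], -3)]), (1, [([II 1, IE 1], -1)]), (0, [([AI 1, II 1], -2)]),
      (0, [([AE 2], -2)])]"],
    code_simp, simp only: parts_simps known)

lemma [known]: "holds Admirable [AE 2, IE 4] (-2)"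
  by (rule holdsI[where rs="
      [(2, [([AI 1, AE 2, IE 1], -1)]), (1, [([AI 1, AE 3], -1)]), (1, [([AI 1, AE 1], -1),
      ([AE 2], -2)]), (2, [([AI 1, AE 2, II 1], -2)]), (3, [([AE 1, IE 1], -2), ([II 2], -1)]),
      (1, [([AI 1, AI 1], 0), ([AE 2], -2)])]"],
    code_simp, simp only: parts_simps known)

lemma [known]: "holds Admirable [AI 1, AE 2, II 1, IE 2] (-2)"
  by (rule holdsI[where rs="
      [(4, [([AI 1, AE 2, II 1], -2)]), (1, [([II 1, IE 1, IE 2], -1)]), (4, [([AI 1, AI 1], 0),
      ([AI 1, II 1], -2)]), (0, [([AE 2], -2), ([IE 2], -2)]), (1, [([II 1, IE 1], -1),
      ([AE 2], -2)]), (1, [([II 1, II 1], 0), ([AE 2], -2)])]"],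
    code_simp, simp only: parts_simps known)

lemma [known]: "holds Admirable [AI 1, AE 5, IE 4] (-3)"
  by (rule holdsI[where rs="
      [(2, [([AA 2], -1), ([AE 2, IE 4], -2)]), (1, [([AI 1, AI 1], 0), ([AE 2, IE 4], -2)]),
      (1, [([AI 1, AI 1], 0), ([AE 2, IE 4], -2)]), (7, [([AI 1, AE 1, IE 2], -1), ([AI 2,
      AI 2], -2)]), (6, [([AI 1, AE 2, IE 1], -1), ([AI 1, AI 3], -2)]), (5, [([AI 1, AE 3], -1),
      ([AI 4], -1)]), (4, [([AI 1, IE 3], -1), ([AE 4], -2)]), (6, [([AI 1, AE 2, II 1,
      IE 2], -2), ([AA 2], -1)]), (4, [([AI 1, IE 1], -1), ([II 2], -1), ([AE 4], -2)]),
      (4, [([AI 1, II 3], 0), ([AE 4], -2)])]"],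
    code_simp, simp only: parts_simps known)

lemma [known]: "holds Admirable [AI 1, AI 2, AE 1, AE 5, II 1] (-1)"
  by (rule holdsI[where rs="
      [(6, [([AE 1, AE 1], 0), ([AA 3, AI 2, II 1], -1)]), (6, [([AA 3, AI 1], 0), ([AE 1,
      AE 1], 0), ([II 1, II 1], 0)]), (6, [([AI 1, AI 1], 0), ([AE 1, AE 1], 0), ([AA 3,
      II 1], -2)]), (7, [([AA 4, AI 1, AI 2, II 1], 0)]), (2, [([AI 1, AI 2, AI 2, II 1], 0),
      ([AE 1, AE 1], 0)]), (7, [([AI 1, AI 2, II 1], -1), ([AI 1, IE 3], -1)]), (7, [([AI 1, AI 2,
      AI 2, II 1], 0), ([IE 2], -2)]), (0, [([AI 1, AI 2, II 1], -1), ([AI 2, AE 1, IE 1], -1)]),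
      (7, [([AI 1, AI 2, II 1], -1), ([AI 4], -1)]), (7, [([AA 3, AI 1], 0), ([AE 1, AE 1], 0),
      ([AI 2], -3)])]"],
    code_simp, simp only: parts_simps known)

lemma [known]: "holds Admirable [IE 4, IE 4] (-2)"
  by (rule holdsI[where rs="
      [(0, [([AE 2, IE 4], -2)]), (4, [([AI 1, AE 2, II 1, IE 2], -2)]), (4, [([AI 1, AE 2,
      IE 1], -1), ([II 2], -1)]), (4, [([AI 1, II 3], 0), ([AE 2], -2)])]"],
    code_simp, simp only: parts_simps known)

lemma [known]: "holds Admirable [IE 4] (-2)"
  by (rule holdsI[where rs="
      [(0, [([AE 2], -2)]), (2, [([AI 1, II 1], -2)]), (2, [([II 2], -1)]), (1, [([AI 1,
      AI 1], 0)])]"],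
    code_simp, simp only: parts_simps known)

lemma [known]: "holds Admirable [AI 1, AI 2, AI 3] (-1)"
  by (rule holdsI[where rs="
      [(0, [([AI 1, AI 3], -2)]), (2, [([AI 1, AI 2, II 1], -1)]), (0, [([AI 1, AI 3], -2)]),
      (3, [([AI 1, AI 1], 0), ([II 2], -1)]), (0, [([AI 1, AI 2, II 1], -1)]), (2, [([AI 2,
      AI 2], -2)])]"],
    code_simp, simp only: parts_simps known)

lemma [known]: "holds Admirable [AI 1, AI 2, AE 5, IE 4] (-2)"
  by (rule holdsI[where rs="
      [(0, [([AI 1, AE 5, IE 4], -3)]), (9, [([AI 1, AI 2, AE 1, AE 5, II 1], -1)]), (0, [([AI 1,
      AE 5, IE 4], -3)]), (5, [([AI 1, AI 1], 0), ([IE 4, IE 4], -2)]), (5, [([AI 1, AI 1], 0),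
      ([AI 1, IE 3], -1), ([IE 4], -2)]), (9, [([AI 1, AE 1, IE 2], -1), ([AI 2, AI 2,
      AI 2], -1)]), (8, [([AI 1, AE 2, IE 1], -1), ([AI 1, AI 2, AI 3], -1)]), (5, [([AI 1,
      AI 1], 0), ([AI 4], -1), ([IE 4], -2)]), (10, [([AI 1, IE 3], -1), ([AA 4, AI 2], -2)]),
      (1, [([AI 1, AI 2, AE 1, AE 5, II 1], -1)]), (9, [([AA 3, AI 1], 0), ([AI 2, AE 1,
      IE 1], -1), ([II 2], -1)]), (10, [([AI 1, II 3], 0), ([AA 4, AI 2], -2)])]"],
    code_simp, simp only: parts_simps known)

lemma [known]: "holds Admirable [AI 1, AE 9, IE 4] (-3)"
  by (rule holdsI[where rs="
      [(6, [([AE 2, IE 4], -2), ([AA 6], -1)]), (2, [([AI 1, AI 2, AE 5, IE 4], -2)]),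
      (2, [([AI 1, AI 1], 0), ([AI 1, AE 5, IE 4], -3)]), (2, [([AI 1, AI 2, AE 5, IE 4], -2)]),
      (5, [([AI 1, AI 2, AI 3], -1), ([AE 2, IE 4], -2)]), (8, [([AI 4], -1), ([IE 4,
      IE 4], -2)]), (12, [([AI 1, IE 3], -1), ([AI 3, AI 5], -2)]), (11, [([AI 1, AE 1,
      IE 2], -1), ([AI 2, AI 6], -2)]), (10, [([AI 1, AE 2, IE 1], -1), ([AI 1, AI 7], -2)]),
      (0, [([AI 1, AI 7], -2), ([IE 4], -2)]), (10, [([AI 1, IE 3], -1), ([AE 2], -2),
      ([AA 6], -1)]), (10, [([AI 1, AE 2, II 1, IE 2], -2), ([AA 6], -1)]), (10, [([AI 1, AE 2,
      IE 1], -1), ([II 2], -1), ([AA 6], -1)]), (10, [([AI 1, II 3], 0), ([AE 2], -2),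
      ([AA 6], -1)])]"],
    code_simp, simp only: parts_simps known)

lemma [known]: "holds Admirable [AE 3, AE 5] (-2)"
  by (rule holdsI[where rs="
      [(2, [([AE 4, IE 2], -2)]), (2, [([AI 1, IE 1], -1), ([AE 4], -2)]), (6, [([AA 4,
      AI 2], -2)]), (4, [([AE 2, IE 4], -2)]), (0, [([AE 3, IE 3], -2)]), (0, [([AI 1, AE 3], -1),
      ([IE 2], -2)]), (4, [([AI 3, AE 2, IE 1], -3)]), (4, [([AE 2], -2), ([AI 4], -1)])]"],
    code_simp, simp only: parts_simps known)

lemma [known]: "holds Admirable [AE 1, AE 3] (-2)"
  by (rule holdsI[where rs="
      [(0, [([AE 2], -2)]), (2, [([IE 2], -2)]), (0, [([AE 1, IE 1], -2)]), (2, [([AI 2], -3)])]"],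
    code_simp, simp only: parts_simps known)

lemma [known]: "holds Admirable [AI 1, AE 2, AE 3] (-1)"
  by (rule holdsI[where rs="
      [(0, [([AE 1, AE 3], -2)]), (2, [([AI 1, AE 2, IE 1], -1)]), (0, [([AI 1, AE 3], -1)]),
      (3, [([AI 1, AE 1, IE 2], -1)]), (0, [([AI 1, AE 2, IE 1], -1)]), (0, [([AI 1, AI 1], 0),
      ([AE 2], -2)])]"],
    code_simp, simp only: parts_simps known)

lemma [known]: "holds Admirable [AI 1, AI 2, IE 1] (-2)"
  by (rule holdsI[where rs="
      [(0, [([AI 1, IE 1], -1)]), (1, [([II 1, IE 1], -1)]), (0, [([AI 1, IE 1], -1)]),
      (0, [([AI 2], -3)])]"],
    code_simp, simp only: parts_simps known)

lemma [known]: "holds Admirable [AI 1, AI 2, AE 3, IE 2] (-2)"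
  by (rule holdsI[where rs="
      [(0, [([AI 1, AE 3], -1), ([IE 2], -2)]), (2, [([AI 1, AE 2, II 1, IE 2], -2)]),
      (0, [([AI 1, AE 3], -1), ([IE 2], -2)]), (3, [([AI 1, AI 1], 0), ([IE 2, IE 2], -2)]),
      (0, [([AI 1, AI 2, IE 1, IE 2], -2)]), (6, [([AI 1, AI 1], 0), ([AI 2, AI 2], -2)]),
      (6, [([AI 1, AI 2, IE 1], -2), ([AA 2], -1)]), (4, [([AI 1, AI 2, II 1], -1),
      ([AE 2], -2)])]"],
    code_simp, simp only: parts_simps known)

lemma [known]: "holds Admirable [II 8] (-3)"
  by (rule holdsI[where rs="
      [(0, [([AI 6], -3)]), (0, [([II 6], -1)]), (0, [([AI 1, II 5], -2)]), (0, [([AI 2,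
      II 4], -2)])]"],
    code_simp, simp only: parts_simps known)

lemma [known]: "holds Admirable [AI 1, AE 3, IE 10] (-3)"
  by (rule holdsI[where rs="
      [(7, [([AE 3, AE 5], -2), ([AI 4], -1)]), (10, [([AI 1, AI 7, AE 2, IE 2], -2)]),
      (10, [([AI 1, AE 2, IE 1], -1), ([AI 1, AI 7], -2)]), (9, [([AI 1, AE 3], -1), ([AI 2,
      AI 6], -2)]), (4, [([AI 1, AE 3], -1), ([AI 4], -1), ([AE 4], -2)]), (6, [([AI 1, AE 2,
      AE 3], -1), ([AI 5, II 1], -2)]), (6, [([AI 1, AE 2, AE 3], -1), ([II 2], -1),
      ([AI 4], -1)]), (3, [([AI 1, II 3], 0), ([AE 3, AE 5], -2)]), (6, [([AI 1, AE 2, AE 3], -1),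
      ([AI 2, II 4], -2)]), (10, [([AI 1, II 5], -2), ([AE 2, IE 4], -2)]), (9, [([AE 3,
      IE 3], -2), ([II 6], -1)]), (2, [([AI 1, AI 2, AE 3, IE 2], -2), ([AI 4], -1)]),
      (10, [([AI 1, AE 2, IE 1], -1), ([II 8], -3)]), (1, [([AI 1, AE 3], -1), ([AI 1,
      AI 7], -2)])]"],
    code_simp, simp only: parts_simps known)

lemma [known]: "holds Admirable [AI 2, AI 7, II 1] (-3)"
  by (rule holdsI[where rs="
      [(1, [([II 1, II 1], 0), ([AI 6], -3)]), (8, [([AI 1, AI 7], -2)]), (6, [([AI 1, II 1], -2),
      ([II 6], -1)]), (0, [([AI 2, II 1, II 5], -3)]), (8, [([AI 2, AI 2, II 4], -1)]),
      (4, [([AI 1, AI 2, II 1], -1), ([AI 1, AI 3], -2)]), (6, [([AI 1, II 1], -2), ([II 2], -1),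
      ([AI 4], -1)]), (0, [([II 1, II 1], 0), ([AI 2], -3), ([AI 4], -1)]), (8, [([AI 2,
      AI 6], -2)]), (0, [([AI 1, AI 7], -2)])]"],
    code_simp, simp only: parts_simps known)

lemma [known]: "holds Admirable [AI 5, AI 7] (-2)"
  by (rule holdsI[where rs="
      [(1, [([AI 1, AI 2, AI 7], -1)]), (1, [([AI 1, AI 2, AI 7], -1)]), (0, [([AI 1, AI 7], -2),
      ([II 2], -1)]), (0, [([AI 2, AI 7, II 1], -3)]), (2, [([AI 1, AI 7], -2), ([AA 2], -1)]),
      (6, [([AI 4], -1), ([II 6], -1)]), (0, [([AI 5, II 5], -2)]), (6, [([AI 2, II 4], -2),
      ([AI 4], -1)]), (4, [([AI 1, AI 1], 0), ([AI 3, AI 5], -2)]), (0, [([II 2], -1), ([AI 3,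
      AI 5], -2)]), (0, [([AI 5, II 1], -2), ([AI 4], -1)]), (6, [([AI 4], -1), ([AI 6], -3)])]"],
    code_simp, simp only: parts_simps known)

lemma [known]: "holds Admirable [AE 1, IE 5] (-2)"
  by (rule holdsI[where rs="
      [(1, [([AI 1, AE 3], -1)]), (4, [([IE 4], -2)]), (2, [([AI 1, II 1], -2), ([AE 1,
      AE 1], 0)]), (4, [([II 2], -1), ([IE 2], -2)]), (4, [([II 3, IE 1], -1)]),
      (4, [([II 4], -3)])]"],
    code_simp, simp only: parts_simps known)

text \<open>Against openings at the seventh or eighth of 16 vertices Admirable takes the last vertex
  but one on the longer side.\<close>

lemma [known]: "holds Admirable [AI 7, AE 1, IE 6] (-3)"
  by (rule holdsI[where rs="
      [(11, [([AE 1, AE 1], 0), ([AI 4], -1), ([II 6], -1)]), (11, [([AI 1, II 5], -2), ([AE 1,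
      AE 1], 0), ([AI 4], -1)]), (9, [([AE 1, AE 3], -2), ([AI 2, AI 2, II 4], -1)]),
      (11, [([AE 1, AE 1], 0), ([AI 3, II 3], -2), ([AI 4], -1)]), (11, [([AE 1, AE 1], 0),
      ([II 2], -1), ([AI 4], -1), ([AI 4], -1)]), (11, [([AE 1, AE 1], 0), ([AI 5, II 1], -2),
      ([AI 4], -1)]), (9, [([AE 1, AE 3], -2), ([AI 2, AI 6], -2)]), (12, [([AI 5, AI 7], -2)]),
      (11, [([AE 1, IE 5], -2), ([AA 6], -1)]), (3, [([AE 1, AE 1], 0), ([AI 2, AI 7,
      II 1], -3)]), (0, [([AI 1, AI 7, AE 1, IE 3], -2)]), (1, [([AI 1, AE 1, IE 2], -1), ([AI 1,
      AI 7], -2)]), (1, [([AI 1, AI 7], -2), ([AI 2, AE 1, IE 1], -1)]), (6, [([AA 1, AE 1], -1),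
      ([AI 5, II 5], -2)])]"],
    code_simp, simp only: parts_simps known)

lemma [known]: "holds Admirable [AI 1, AE 1, AE 4] (-1)"
  by (rule holdsI[where rs="
      [(0, [([AE 4], -2)]), (1, [([AI 1, AE 3], -1)]), (4, [([AI 1, IE 3], -1)]), (0, [([AI 1,
      AE 1, IE 2], -1)]), (3, [([AI 2, AE 1, IE 1], -1)]), (4, [([AI 1, AI 3], -2)])]"],
    code_simp, simp only: parts_simps known)

lemma [known]: "holds Admirable [AE 1, II 3] (-1)"
  by (rule holdsI[where rs="
      [(1, [([AI 1, AI 1], 0)]), (2, [([II 2], -1)]), (2, [([II 1, II 1], 0)])]"],
    code_simp, simp only: parts_simps known)

lemma [known]: "holds Admirable [AI 6, AE 1, IE 7] (-3)"
  by (rule holdsI[where rs="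
      [(11, [([AE 1, AE 1], 0), ([AI 5, II 5], -2)]), (8, [([AI 1, AE 1, AE 4], -1), ([AI 2,
      II 4], -2)]), (12, [([AE 1, II 3], -1), ([AI 2, AI 6], -2)]), (11, [([AE 1, AE 1], 0),
      ([II 2], -1), ([AI 3, AI 5], -2)]), (11, [([AE 1, AE 1], 0), ([AI 5, II 1], -2),
      ([AI 4], -1)]), (9, [([AE 1, AE 3], -2), ([AI 3, AI 5], -2)]), (12, [([AI 6, AI 6], -2)]),
      (1, [([AI 1, AE 1, AE 4], -1), ([AI 6], -3)]), (6, [([AE 1, IE 5], -2), ([AI 5,
      II 1], -2)]), (4, [([AE 1, AE 1], 0), ([AI 2, AI 6], -2), ([II 2], -1)]), (4, [([AI 1,
      II 3], 0), ([AE 1, AE 1], 0), ([AI 6], -3)]), (1, [([AI 1, AE 1, IE 2], -1), ([AI 2,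
      AI 6], -2)]), (2, [([AI 2, AE 1, IE 1], -1), ([AI 2, AI 6], -2)]), (12, [([AI 6], -3),
      ([II 6], -1)])]"],
    code_simp, simp only: parts_simps known)

text \<open>Unlike Impish, Admirable never answers next to the opening. No edge is settled in the
  first round, so each resulting group must carry the whole bound by itself.\<close>

lemma Admirable_EE16 [known]: "holds Admirable [EE 16] (-3)"
  by (rule holdsI[where rs="
      [(14, [([AI 14], -3)]), (12, [([AI 11, AE 2, IE 1], -3)]), (3, [([AI 1, AE 11, IE 2], -3)]),
      (4, [([AI 1, AE 10, IE 3], -3)]), (5, [([AI 1, AE 9, IE 4], -3)]), (1, [([AI 1, AE 3,
      IE 10], -3)]), (13, [([AI 7, AE 1, IE 6], -3)]), (13, [([AI 6, AE 1, IE 7], -3)])]"],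
    code_simp, simp only: parts_simps known)

section \<open>Remainders modulo 16\<close>

lemma Admirable_EE2 [known]: "holds Admirable [EE 2] (-1)"
  by (rule holdsI[where rs="
      [(0, [])]"],
    code_simp, simp only: parts_simps known)

text \<open>The guarantee is the same as for two vertices, which halves the loss per vertex when a
  remainder is cut up.\<close>

lemma Admirable_EE4 [known]: "holds Admirable [EE 4] (-1)"
  by (rule holdsI[where rs="
      [(1, [([AI 1, AE 1], -1)]), (2, [([AI 1, IE 1], -1)])]"],
    code_simp, simp only: parts_simps known)

text \<open>Runs of 2, 4 and 6 vertices at an end of the path all have guarantee -2; two of them can
  flank Admirable's opening vertex.\<close>

lemma Admirable_AE6 [known]: "holds Admirable [AE 6] (-2)"
  by (rule holdsI[where rs="
      [(1, [([AI 1, AE 3], -1)]), (0, [([IE 4], -2)]), (0, [([AI 1, IE 3], -1)]), (4, [([AI 1,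
      AI 3], -2)]), (4, [([AI 4], -1)]), (0, [([AI 4], -1)])]"],
    code_simp, simp only: parts_simps known)

lemma [known]: "holds Admirable [IE 6] (-2)"
  by (rule holdsI[where rs="
      [(0, [([AE 4], -2)]), (2, [([AI 1, AE 2, II 1], -2)]), (0, [([AI 1, IE 3], -1)]),
      (3, [([AE 1, II 3], -1)]), (1, [([AI 1, AI 2, IE 1], -2)]), (0, [([AI 4], -1)])]"],
    code_simp, simp only: parts_simps known)

lemma [known]: "holds Admirable [AA 5, AI 1] (-2)"
  by (rule holdsI[where rs="
      [(4, [([AI 4], -1)]), (0, [([AI 1, AI 3], -2)]), (4, [([AI 2, AI 2], -2)]),
      (2, [([AA 2], -1), ([AA 2], -1)])]"],
    code_simp, simp only: parts_simps known)

lemma [known]: "holds Admirable [AI 3, IE 3] (-3)"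
  by (rule holdsI[where rs="
      [(0, [([AI 1, IE 3], -1)]), (1, [([AI 1, IE 3], -1)]), (0, [([AI 1, IE 3], -1)]),
      (1, [([AI 1, AI 3], -2)]), (2, [([II 1, IE 1], -1), ([AI 2], -3)]), (0, [([AI 1,
      AI 3], -2)])]"],
    code_simp, simp only: parts_simps known)

lemma [known]: "holds Admirable [AI 5, IE 1] (-3)"
  by (rule holdsI[where rs="
      [(1, [([AI 1, AI 2, IE 1], -2)]), (0, [([II 3, IE 1], -1)]), (0, [([AI 1, IE 1], -1),
      ([II 2], -1)]), (0, [([II 1, IE 1], -1), ([AI 2], -3)]), (4, [([AI 4], -1)]),
      (0, [([AI 4], -1)])]"],
    code_simp, simp only: parts_simps known)

text \<open>This is the position after opening in the middle of 15 vertices. Both sides are odd, so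
  they have to be bounded jointly; the bound equals that of two even sides.\<close>

lemma Admirable_AE7_AE7 [known]: "holds Admirable [AE 7, AE 7] (-4)"
  by (rule holdsI[where rs="
      [(12, [([AA 6], -1), ([IE 6], -2)]), (11, [([AA 5, AI 1], -2), ([AE 1, IE 5], -2)]),
      (10, [([AA 4, AI 2], -2), ([AE 2, IE 4], -2)]), (12, [([AI 3, IE 3], -3), ([AA 6], -1)]),
      (6, [([IE 2], -2), ([AI 4], -1), ([AE 6], -2)]), (12, [([AI 5, IE 1], -3), ([AA 6], -1)]),
      (6, [([AI 6], -3), ([AE 6], -2)])]"],
    code_simp, simp only: parts_simps known)

section \<open>Blocks\<close>

lemma Impish_blocks:
  shows Impish_16: "secure Impish {#seg None 16 None#} 3"
    and Impish_2: "secure Impish {#seg None 2 None#} 1"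
    and Impish_1_1: "secure Impish {#seg None 1 (Some Admirable), seg None 1 (Some Admirable)#} 0"
  using Impish_EE16 Impish_EE2 Impish_AE1_AE1 by (simp_all add: holds_def seg_def)

lemma Admirable_blocks:
  shows Admirable_16: "secure Admirable {#seg None 16 None#} (-3)"
    and Admirable_4: "secure Admirable {#seg None 4 None#} (-1)"
    and Admirable_2: "secure Admirable {#seg None 2 None#} (-1)"
    and Admirable_7_7:
      "secure Admirable {#seg None 7 (Some Admirable), seg None 7 (Some Admirable)#} (-4)"
  using Admirable_EE16 Admirable_EE4 Admirable_EE2 Admirable_AE7_AE7
  by (simp_all add: holds_def seg_def)

lemma Admirable_246:
  "i \<in> {2, 4, 6} \<Longrightarrow> secure Admirable {#seg None i (Some Admirable)#} (-2)"
  using Admirable_AE2 Admirable_AE4 Admirable_AE6 by (auto simp: holds_def seg_def)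

text \<open>Blocks are attached at the free end of a run. Since \<open>r\<close> and
  \<open>K\<close> are arbitrary, this also works on either side of an opening vertex.\<close>

lemma secure_blocks:
  assumes "secure p {#seg None m None#} b" "secure p (add_mset (seg None j r) K) c"
  shows "secure p (add_mset (seg None (m * k + j) r) K) (c + int k * (b - 1))"
proof (induction k)
  case 0
  then show ?case using assms(2) by simp
next
  case (Suc k)
  from secure_join[OF assms(1) this] show ?case by (simp add: algebra_simps)
qed

text \<open>A block of 16 nets \<open>3 - 1\<close> and a block of 2 nets \<open>1 - 1\<close>, so
  any even length can be added without loss.\<close>

lemma Impish_extend:
  assumes "secure Impish (add_mset (seg None j r) K) c"
  shows "secure Impish (add_mset (seg None (16 * k + (2 * t + j)) r) K) (c + 2 * int k)"
  using secure_blocks[OF Impish_16 secure_blocks[OF Impish_2 assms], of k t] by (simp add: mult.commute)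

text \<open>One block is the starting point and pays for no joining edge. This explains the final 1:
  the block contributes 3 instead of 2 if it has 16 vertices, and 1 instead of 0 if it has
  2.\<close>

lemma Impish_even:
  assumes "even n" "n \<noteq> 0"
  shows "secure Impish {#seg None n None#} (2 * int (n div 16) + 1)"
proof (cases "16 dvd n")
  case True
  then obtain k where "n = 16 * k" by blast
  then obtain k' where k: "n = 16 * k' + (2 * 0 + 16)" using assms(2) by (cases k) auto
  show ?thesis using Impish_extend[OF Impish_16, of k' 0] unfolding k by simp
next
  case False
  then have r: "n mod 16 \<noteq> 0" "even (n mod 16)"
    using assms(1) by (auto simp: mod_eq_0_iff_dvd dvd_mod_iff)
  then obtain t where t: "n mod 16 = 2 * t + 2" by (metis dvdE add.commute mult_Suc_right not0_implies_Suc mult_0_right)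
  then have n: "n = 16 * (n div 16) + (2 * t + 2)" using div_mult_mod_eq[of n 16] by presburger
  show ?thesis using Impish_extend[OF Impish_2, of "n div 16" t] n by (simp add: add.commute)
qed

text \<open>Splitting a path at one vertex destroys at most one complete block.\<close>

lemma Suc_add_div_le:
  fixes d :: nat
  assumes "d > 0"
  shows "Suc (i + j) div d \<le> i div d + j div d + 1"
proof -
  have "i < d * Suc (i div d)" "j < d * Suc (j div d)"
    using dividend_less_times_div[OF assms] by simp_all
  then have "Suc (i + j) < d * (i div d + j div d + 2)" by (simp add: algebra_simps)
  then have "Suc (i + j) div d < i div d + j div d + 2"
    using assms by (simp add: div_less_iff_less_mult mult.commute)
  then show ?thesis by simp
qed

text \<open>On each side blocks of 16 and of 2 are cut off from the outer end until at most one free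
  vertex remains next to the opening. As \<open>i + j\<close> is even, the leftovers are both 0 or
  both 1.\<close>

lemma Impish_opening:
  assumes "even (i + j)"
  shows "secure Impish {#seg None i (Some Admirable), seg None j (Some Admirable)#}
    (2 * int (i div 16) + 2 * int (j div 16))"
proof -
  let ?seg = "\<lambda>i. seg None i (Some Admirable)"
  have dec: "16 * (i div 16) + (2 * (i mod 16 div 2) + i mod 2) = i" for i :: nat
    using mod_mod_cancel[of 2 16 i] mult_div_mod_eq[of 2 "i mod 16"] by simp
  have "secure Impish {#?seg (i mod 2), ?seg (j mod 2)#} 0"
  proof (cases "even i")
    case True
    then show ?thesis
      using assms by (intro secure.final) (auto simp: even_iff_mod_2_eq_zero edge_commute[of None])
  next
    case False
    then have "i mod 2 = 1" "j mod 2 = 1" using assms by presburger+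
    then show ?thesis using Impish_1_1 by simp
  qed
  from Impish_extend[OF this, of "i div 16" "i mod 16 div 2"]
  have "secure Impish {#?seg (j mod 2), ?seg i#} (2 * int (i div 16))"
    by (simp only: dec add_mset_commute add_0)
  from Impish_extend[OF this, of "j div 16" "j mod 16 div 2"] show ?thesis
    by (simp only: dec add_mset_commute)
qed

text \<open>Blocks of 16, 4 and 2 cost 4, 2 and 2. A remainder needs at most three blocks of 4 and
  one of 2, hence the 8; blocks of 2 alone could cost 14.\<close>

lemma Admirable_even:
  assumes "even n"
  shows "secure Admirable {#seg None n None#} (- (4 * int (n div 16)) - 8)"
proof -
  define q a b where "q = n div 16" and "a = n mod 16 div 4" and "b = n mod 4 div 2"
  have "a < 4" "b < 2" by (simp_all add: a_def b_def less_mult_imp_div_less)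
  then have bounds: "int a \<le> 3" "int b \<le> 1" by simp_all
  have "even (n mod 4)" using assms by (simp add: dvd_mod_iff)
  then have n: "16 * q + (4 * a + (2 * b + 0)) = n"
    using mod_mod_cancel[of 4 16 n] mult_div_mod_eq[of 4 "n mod 16"] by (simp add: q_def a_def b_def)
  have "secure Admirable {#seg None 0 None#} 0" by (rule secure.final) auto
  from secure_blocks[OF Admirable_16 secure_blocks[OF Admirable_4 secure_blocks[OF Admirable_2 this]], of q a b]
  have "secure Admirable {#seg None n None#}
      (0 + int b * (-1 - 1) + int a * (-1 - 1) + int q * (-3 - 1))"
    unfolding n .
  then show ?thesis unfolding q_def[symmetric] by (rule secure_mono) (use bounds in simp)
qed

text \<open>Up to \<open>r = 13\<close> the opening splits the block into two even sides of at most
  6 vertices, each with guarantee -2. For \<open>r = 15\<close> the even sides would have to total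
  14, beyond two runs of 6; the middle vertex is taken instead.\<close>

lemma Admirable_odd_block:
  assumes "odd r" "r < 16"
  shows "\<exists>i j. r = Suc (i + j) \<and>
    secure Admirable {#seg None i (Some Admirable), seg None j (Some Admirable)#} (-4)"
proof -
  let ?seg = "\<lambda>i. seg None i (Some Admirable)"
  have "secure Admirable {#?seg 0#} (-2)" by (rule secure.final) auto
  then have single: "secure Admirable {#?seg i#} (-2)" if "i \<in> {0, 2, 4, 6}" for i
    using that Admirable_246 by blast
  have pair: "secure Admirable {#?seg i, ?seg j#} (-4)" if "i \<in> {0, 2, 4, 6}" "j \<in> {0, 2, 4, 6}" for i j
    using secure_union[OF single[OF that(1)] single[OF that(2)]] by (simp add: add_mset_commute)
  have "r = 15 \<or> r = 1 \<or> r = 3 \<or> r = 5 \<or> r = 7 \<or> r = 9 \<or> r = 11 \<or> r = 13"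
    using assms by presburger
  then consider "r = 15" | "r = Suc (0 + 0)" | "r = Suc (0 + 2)" | "r = Suc (0 + 4)" | "r = Suc (0 + 6)"
    | "r = Suc (2 + 6)" | "r = Suc (4 + 6)" | "r = Suc (6 + 6)"
    by fastforce
  then show ?thesis
  proof cases
    case 1
    then show ?thesis using Admirable_7_7 by (intro exI[of _ 7]) simp
  qed (use pair in blast)+
qed

theorem theorem4p5:
  fixes n :: nat
  assumes "n \<ge> 1"
  shows "(even n \<longrightarrow>
            2 * \<lfloor>real n / 16\<rfloor> + 1 \<le> balance_game_A (path_graph n) \<and>
            balance_game_A (path_graph n) \<le> 4 * \<lceil>real n / 16\<rceil> + 5) \<and>
         (odd n \<longrightarrow>
            2 * \<lfloor>real n / 16\<rfloor> - 4 \<le> balance_game_A (path_graph n) \<and>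
            balance_game_A (path_graph n) \<le> 4 * \<lceil>real n / 16\<rceil>)"
proof -
  let ?G = "path_graph n" and ?e = "Map.empty :: nat labeling"
  have V: "verts ?G = {1..n}" by (simp add: path_graph_def)
  then have fin: "finite (verts ?G)" by simp
  have floor: "\<lfloor>real n / 16\<rfloor> = int (n div 16)"
    using floor_divide_of_nat_eq[of n 16] by simp
  have ceiling: "int (n div 16) \<le> \<lceil>real n / 16\<rceil>" "n mod 16 \<noteq> 0 \<Longrightarrow> \<lceil>real n / 16\<rceil> = int (n div 16) + 1"
  proof -
    have "real n = 16 * real (n div 16) + real (n mod 16)"
      by (metis div_mult_mod_eq mult.commute of_nat_add of_nat_mult of_nat_numeral)
    moreover have "real (n mod 16) < 16" by simp
    moreover have "n mod 16 \<noteq> 0 \<Longrightarrow> 1 \<le> real (n mod 16)" by linarith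
    ultimately show "int (n div 16) \<le> \<lceil>real n / 16\<rceil>"
      "n mod 16 \<noteq> 0 \<Longrightarrow> \<lceil>real n / 16\<rceil> = int (n div 16) + 1"
      by linarith+
  qed
  show ?thesis
  proof (intro conjI impI)
    assume "even n"
    then have "2 * int (n div 16) + 1 \<le> balance_game_A ?G"
      using secure_game_value[OF Impish_even segs_empty[symmetric], of n] assms
      by (simp add: balance_game_A_def)
    then show "2 * \<lfloor>real n / 16\<rfloor> + 1 \<le> balance_game_A ?G" by (simp add: floor)
  next
    assume even: "even n"
    then have "balance_game_A ?G \<le> game_value ?G Impish ?e"
      using first_move_advantage[OF fin, of ?e Admirable] V by (simp add: balance_game_A_def)
    moreover have "game_value ?G Impish ?e \<le> 4 * int (n div 16) + 8"
      using secure_game_value[OF Admirable_even[OF even] segs_empty[symmetric]] by simp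
    \<comment> \<open>Without a remainder the ceiling adds nothing, and the general loss 8 would
      exceed the allowed 5; blocks of 16 alone avoid it.\<close>
    moreover have "n mod 16 = 0 \<Longrightarrow> game_value ?G Impish ?e \<le> 4 * int (n div 16)"
    proof -
      assume "n mod 16 = 0"
      then have n: "16 * (n div 16) + 0 = n" by presburger
      have "secure Admirable {#seg None 0 None#} 0" by (rule secure.final) auto
      from secure_blocks[OF Admirable_16 this, of "n div 16"]
      have "secure Admirable {#seg None n None#} (- (4 * int (n div 16)))"
        unfolding n by (simp add: mult.commute)
      from secure_game_value[OF this segs_empty[symmetric]] show ?thesis by simp
    qed
    \<comment> \<open>With a remainder the ceiling is \<open>n div 16 + 1\<close>, and 8 is at most
      4 + 5.\<close>
    ultimately show "balance_game_A ?G \<le> 4 * \<lceil>real n / 16\<rceil> + 5" using ceiling by linarith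
  next
    assume odd: "odd n"
    obtain v where v: "v \<in> {1..n}" and gv: "balance_game_A ?G = game_value ?G Impish [v \<mapsto> label Admirable]"
      using game_value_attained[OF fin, of ?e Admirable] V assms by (auto simp: balance_game_A_def)
    define i where "i = v - 1"
    define j where "j = n - v"
    have n: "n = Suc (i + j)" and vi: "v = Suc i" using v by (auto simp: i_def j_def)
    have "card (verts ?G - dom [v \<mapsto> label Admirable]) = n - 1" using v by (simp add: V)
    then have "game_value ?G Admirable [v \<mapsto> label Admirable] \<le> balance_game_A ?G"
      using first_move_advantage[OF fin, of "[v \<mapsto> label Admirable]" Impish] odd by (simp add: gv)
    moreover have "2 * int (i div 16) + 2 * int (j div 16) \<le> game_value ?G Admirable [v \<mapsto> label Admirable]"
      using secure_game_value[OF Impish_opening segs_opening[symmetric], of i j] odd n vi by simp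
    moreover have "n div 16 \<le> i div 16 + j div 16 + 1"
      unfolding n by (rule Suc_add_div_le) simp
    \<comment> \<open>At most one block, worth 2, is lost at the opening vertex, so the estimates
      even give \<open>2 * int (n div 16) - 2\<close>.\<close>
    ultimately show "2 * \<lfloor>real n / 16\<rfloor> - 4 \<le> balance_game_A ?G" unfolding floor by linarith
  next
    assume odd: "odd n"
    let ?k = "n div 16"
    have r: "odd (n mod 16)" using odd by presburger
    then obtain i j where ij: "n mod 16 = Suc (i + j)"
      and sec: "secure Admirable {#seg None i (Some Admirable), seg None j (Some Admirable)#} (-4)"
      using Admirable_odd_block[of "n mod 16"] by auto
    \<comment> \<open>The incomplete block is placed at the right end of the path, so all complete
      blocks lie to the left of the opening vertex.\<close>
    have n: "n = Suc ((16 * ?k + i) + j)" using ij div_mult_mod_eq[of n 16] by linarith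
    let ?f = "[Suc (16 * ?k + i) \<mapsto> label Admirable]"
    have sec': "secure Admirable {#seg None (16 * ?k + i) (Some Admirable), seg None j (Some Admirable)#}
        (-4 + int ?k * (-3 - 1))"
      by (rule secure_blocks[OF Admirable_16 sec])
    have "segs None 0 (cells n ?f) = {#seg None (16 * ?k + i) (Some Admirable), seg None j (Some Admirable)#}"
      using segs_opening[of "16 * ?k + i" j Admirable] n by metis
    from secure_game_value[OF sec' this[symmetric]]
    have "game_value ?G Impish ?f \<le> 4 * int ?k + 4" by simp
    moreover have "Suc (16 * ?k + i) \<in> verts ?G - dom ?e" using n V by simp
    from game_value_optimal[OF fin this, of Admirable]
    have "balance_game_A ?G \<le> game_value ?G Impish ?f" by (simp add: balance_game_A_def)
    \<comment> \<open>An odd \<open>n\<close> is not a multiple of 16, so the ceiling exceeds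
      \<open>?k\<close> by 1 and absorbs the 4 of the incomplete block.\<close>
    moreover have "n mod 16 \<noteq> 0" using r by presburger
    ultimately show "balance_game_A ?G \<le> 4 * \<lceil>real n / 16\<rceil>" using ceiling by linarith
  qed
qed

end
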